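(* Fix an integer $m\geq 2$, and let $\mathcal{S}_m$ be the set of primitive Dirichlet characters of order dividing $m$. Let $\sim$ be the equivalence relation on $\mathcal{S}_m$ defined by $\chi_1\sim\chi_2$ if $\chi_2\in\{\chi_1,\overline{\chi}_1\}$, and let $[\chi]$ be the equivalence class of $\chi\in\mathcal{S}_m$ in $\mathcal{S}_m/\sim$. Fix $0<\delta<1/10$. Assume that if $\nu\in\mathcal{S}_m$, then all zeros of $L(s,\nu)$ in the disk $|z-1|<\delta$ are real. For all $\varepsilon>0$, there exists an effectively computable constant $q_0=q_0(\delta,\varepsilon,m)>0$ such that \[ \#\{[\chi]\in\mathcal{S}_m/\sim\ \colon q_\chi\geq q_0 \text{ and } L(s,\chi) \text{ has a real zero in } [1-(\log q_\chi)^{-\varepsilon},1)\}\leq 1. \]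
   Context: For a primitive Dirichlet character $\chi$, $q_\chi$ denotes its modulus (equal to its conductor), $\overline{\chi}$ its complex conjugate, and $L(s,\chi)$ its Dirichlet $L$-function (meromorphically continued to $\mathbb{C}$). The conditions on $\chi$ in the set depend only on the class $[\chi]$, since $q_\chi=q_{\overline{\chi}}$ and $L(s,\chi)$ and $L(s,\overline{\chi})$ have the same real zeros. *)

theory Defs
  imports "HOL-Complex_Analysis.Complex_Analysis"
begin

section \<open>Dirichlet characters\<close>

definition dirichlet_character :: "nat \<Rightarrow> (int \<Rightarrow> complex) \<Rightarrow> bool" where
  "dirichlet_character q chi \<longleftrightarrow>
     q > 0 \<and>
     (\<forall>a. chi (a + int q) = chi a) \<and>
     (\<forall>a b. chi (a * b) = chi a * chi b) \<and>
     (\<forall>a. chi a \<noteq> 0 \<longleftrightarrow> coprime a (int q))"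

definition principal_character :: "nat \<Rightarrow> int \<Rightarrow> complex" where
  "principal_character q a = (if coprime a (int q) then 1 else 0)"

text \<open>
  A character is primitive if it is not induced by a character of a proper divisor of its modulus.
  In particular the trivial character modulo 1 is primitive.
\<close>

definition primitive_character :: "nat \<Rightarrow> (int \<Rightarrow> complex) \<Rightarrow> bool" where
  "primitive_character q chi \<longleftrightarrow>
     dirichlet_character q chi \<and>
     (\<forall>d \<psi>. d dvd q \<and> dirichlet_character d \<psi> \<and> (\<forall>a. coprime a (int q) \<longrightarrow> chi a = \<psi> a)
        \<longrightarrow> d = q)"

text \<open>
  A function on the integers is a primitive character for at most one modulus
  (lemma \<open>modulus_eq\<close> below).
\<close>

definition modulus :: "(int \<Rightarrow> complex) \<Rightarrow> nat" where
  "modulus chi = (THE q. primitive_character q chi)"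

definition character_order :: "nat \<Rightarrow> (int \<Rightarrow> complex) \<Rightarrow> nat" where
  "character_order q chi = (LEAST k. k > 0 \<and> (\<lambda>a. chi a ^ k) = principal_character q)"

definition primitive_characters :: "nat \<Rightarrow> (int \<Rightarrow> complex) set" where
  "primitive_characters m = {chi. \<exists>q. primitive_character q chi \<and> character_order q chi dvd m}"

definition conj_rel :: "nat \<Rightarrow> ((int \<Rightarrow> complex) \<times> (int \<Rightarrow> complex)) set" where
  "conj_rel m =
     {(chi\<^sub>1, chi\<^sub>2). chi\<^sub>1 \<in> primitive_characters m \<and> chi\<^sub>2 \<in> primitive_characters m \<and>
                chi\<^sub>2 \<in> {chi\<^sub>1, cnj \<circ> chi\<^sub>1}}"

lemma periodic_int_mult:
  assumes "dirichlet_character q chi"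
  shows   "chi (a + int q * k) = chi a"
proof (induction k rule: int_induct[where k = 0])
  case (step1 i)
  have "chi ((a + int q * i) + int q) = chi (a + int q * i)"
    using assms unfolding dirichlet_character_def by blast
  thus ?case using step1 by (simp add: algebra_simps)
next
  case (step2 i)
  have "chi ((a + int q * (i - 1)) + int q) = chi (a + int q * (i - 1))"
    using assms unfolding dirichlet_character_def by blast
  thus ?case using step2 by (simp add: algebra_simps)
qed simp

lemma dirichlet_character_gcd:
  assumes 1: "dirichlet_character q chi" and 2: "dirichlet_character r chi"
  shows   "dirichlet_character (gcd q r) chi"
proof -
  have nz1: "chi a \<noteq> 0 \<longleftrightarrow> coprime a (int q)" for a
    using 1 unfolding dirichlet_character_def by blast
  have nz2: "chi a \<noteq> 0 \<longleftrightarrow> coprime a (int r)" for a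
    using 2 unfolding dirichlet_character_def by blast
  obtain u v where uv: "u * int q + v * int r = gcd (int q) (int r)"
    using bezout_int by blast
  have per: "chi (a + int (gcd q r)) = chi a" for a
  proof -
    have "int (gcd q r) = int q * u + int r * v"
      using uv by (simp add: mult.commute)
    hence "chi (a + int (gcd q r)) = chi ((a + int q * u) + int r * v)"
      by (simp add: add.assoc)
    thus ?thesis by (simp add: periodic_int_mult[OF 1] periodic_int_mult[OF 2])
  qed
  have supp: "chi a \<noteq> 0 \<longleftrightarrow> coprime a (int (gcd q r))" for a
  proof
    assume "chi a \<noteq> 0"
    thus "coprime a (int (gcd q r))"
      using nz1[of a] coprime_divisors[of a a "int (gcd q r)" "int q"] by simp
  next
    assume cop: "coprime a (int (gcd q r))"
    show "chi a \<noteq> 0"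
    proof
      assume "chi a = 0"
      hence ncop: "\<not> coprime a (int q)" using nz1 by blast
      have "gcd a (int q) \<noteq> 0" using 1 by (simp add: dirichlet_character_def)
      moreover have "\<not> is_unit (gcd a (int q))" using ncop by (simp add: coprime_iff_gcd_eq_1)
      ultimately obtain p where p: "prime p" "p dvd gcd a (int q)"
        using prime_divisor_exists[of "gcd a (int q)"] by blast
      hence pq: "p dvd a" "p dvd int q" by auto
      have "\<not> is_unit p" using p(1) not_prime_unit by blast
      hence "\<not> coprime p (int q)"
        using pq(2) coprime_common_divisor[of p "int q" p] by auto
      hence "\<not> coprime p (int r)" using nz1 nz2 by blast
      hence "p dvd int r" using p(1) prime_imp_coprime by blast
      hence "p dvd int (gcd q r)" using pq(2) by (simp flip: gcd_int_int_eq)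
      thus False using coprime_common_divisor[OF cop pq(1)] \<open>\<not> is_unit p\<close> by blast
    qed
  qed
  show ?thesis
    using 1 per supp unfolding dirichlet_character_def by simp
qed

lemma modulus_eq:
  assumes "primitive_character q chi"
  shows   "modulus chi = q"
proof -
  have "r = q" if "primitive_character r chi" for r
  proof -
    have "dirichlet_character (gcd q r) chi"
      using assms that by (intro dirichlet_character_gcd) (auto simp: primitive_character_def)
    hence "gcd q r = q" "gcd q r = r"
      using assms that gcd_dvd1[of q r] gcd_dvd2[of q r] unfolding primitive_character_def by blast+
    thus ?thesis by simp
  qed
  thus ?thesis unfolding modulus_def using assms by blast
qed


section \<open>Dirichlet \<open>L\<close>-functions\<close>

text \<open>
  The meromorphic continuation of the Dirichlet series to the whole plane. It is unique
  (lemma \<open>dirichlet_L_eqI\<close> below), since a nicely meromorphic function is continuous away from its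
  poles and takes the value 0 at its poles. The only pole that occurs for a primitive character is
  the one at \<open>s = 1\<close> of the Riemann zeta function (modulus 1), so the only point where
  \<open>dirichlet_L chi s = 0\<close> does not mean a zero is the real point 1.
\<close>

definition dirichlet_L :: "(int \<Rightarrow> complex) \<Rightarrow> complex \<Rightarrow> complex" where
  "dirichlet_L chi =
     (THE f. f nicely_meromorphic_on UNIV \<and>
             (\<forall>s. Re s > 1 \<longrightarrow>
                (\<lambda>n. chi (int (Suc n)) / of_nat (Suc n) powr s) sums f s))"

lemma dirichlet_L_eqI:
  assumes f: "f nicely_meromorphic_on UNIV"
             "\<And>s. Re s > 1 \<Longrightarrow> (\<lambda>n. chi (int (Suc n)) / of_nat (Suc n) powr s) sums f s"
  shows   "dirichlet_L chi = f"
  unfolding dirichlet_L_def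
proof (rule the_equality)
  show "f nicely_meromorphic_on UNIV \<and>
          (\<forall>s. Re s > 1 \<longrightarrow> (\<lambda>n. chi (int (Suc n)) / of_nat (Suc n) powr s) sums f s)"
    using f by blast
next
  fix g
  assume g: "g nicely_meromorphic_on UNIV \<and>
          (\<forall>s. Re s > 1 \<longrightarrow> (\<lambda>n. chi (int (Suc n)) / of_nat (Suc n) powr s) sums g s)"
  have eq: "f s = g s" if "Re s > 1" for s
    using f(2)[OF that] g that sums_unique2 by blast
  let ?h = "remove_sings (\<lambda>z. f z - g z)"
  have mero: "(\<lambda>z. f z - g z) meromorphic_on UNIV"
    using f(1) g by (auto simp: nicely_meromorphic_on_def intro!: meromorphic_intros)
  have iso: "isolated_singularity_at (\<lambda>z. f z - g z) z" for z
    by (rule meromorphic_on_isolated_singularity[OF meromorphic_on_subset[OF mero]]) simp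
  have hnice: "?h nicely_meromorphic_on UNIV"
    by (rule remove_sings_nicely_meromorphic[OF mero])
  have "eventually (\<lambda>z. z \<in> {z. Re z > 1}) (at 2)"
    by (rule eventually_at_in_open') (auto simp: open_halfspace_Re_gt)
  hence "eventually (\<lambda>z. f z - g z = 0) (at 2)"
    by eventually_elim (simp add: eq)
  moreover have "eventually (\<lambda>z. ?h z = f z - g z) (at 2)"
    by (rule eventually_remove_sings_eq_at[OF iso])
  ultimately have "eventually (\<lambda>z. ?h z = 0) (at 2)"
    by eventually_elim simp
  hence "frequently (\<lambda>z. ?h z = 0) (at 2)"
    by (intro eventually_frequently) auto
  hence h0: "?h z = 0" for z
    using frequently_eq_meromorphic_imp_constant[OF _ hnice open_UNIV connected_UNIV UNIV_I UNIV_I]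
    by blast
  show "g = f"
  proof
    fix z
    have "eventually (\<lambda>w. ?h w = f w - g w) (at z)"
      by (rule eventually_remove_sings_eq_at[OF iso])
    hence ev: "eventually (\<lambda>w. f w = g w) (at z)"
      by eventually_elim (simp add: h0)
    have pole: "is_pole f z \<longleftrightarrow> is_pole g z"
      using ev by (intro is_pole_cong) auto
    have tends: "(f \<longlongrightarrow> c) (at z) \<longleftrightarrow> (g \<longlongrightarrow> c) (at z)" for c
      using ev by (rule tendsto_cong)
    show "g z = f z"
    proof (cases "is_pole f z")
      case True
      have nl: "\<not> (h \<longlongrightarrow> c) (at z)" if "is_pole h z" for h and c :: complex
        using not_tendsto_and_filterlim_at_infinity[of "at z" h c] that
        unfolding is_pole_def by auto
      have "f z = 0" using f(1) nl[OF True, of "f z"]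
        unfolding nicely_meromorphic_on_def by blast
      moreover have "g z = 0" using g nl[of g "g z"] True pole
        unfolding nicely_meromorphic_on_def by blast
      ultimately show ?thesis by simp
    next
      case False
      hence "(f \<longlongrightarrow> f z) (at z)" "(g \<longlongrightarrow> g z) (at z)"
        using f(1) g pole unfolding nicely_meromorphic_on_def by blast+
      thus ?thesis using tends[of "f z"] tendsto_unique[of "at z" g "f z" "g z"] by simp
    qed
  qed
qed


section \<open>Computable functions\<close>

text \<open>
  \<open>recursive_function n f\<close>: the restriction of \<open>f\<close> to lists of length \<open>n\<close> is a total
  \<open>\<mu>\<close>-recursive (equivalently, total Turing computable) function of \<open>n\<close> natural numbers.
  Minimization is only applied where it yields a total function.


  An effectively computable constant \<open>q\<^sub>0(\<delta>, \<epsilon>, m)\<close> is expressed by one recursive function \<open>Q\<close>, chosen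
  before all parameters, for which \<open>Q [m, a, b, c, d]\<close> is an admissible value of the constant whenever
  \<open>0 < a/b \<le> \<delta>\<close> and \<open>0 < c/d \<le> \<epsilon>\<close>. Rational \<open>\<delta>\<close> and \<open>\<epsilon>\<close> may themselves be given as input; real ones
  enter through rational lower bounds. (For fixed parameters every single number is computable, so
  the uniformity is essential.)
\<close>

inductive recursive_function :: "nat \<Rightarrow> (nat list \<Rightarrow> nat) \<Rightarrow> bool" where
  zero: "recursive_function n (\<lambda>xs. 0)"
| succ: "recursive_function 1 (\<lambda>xs. Suc (hd xs))"
| proj: "i < n \<Longrightarrow> recursive_function n (\<lambda>xs. xs ! i)"
| comp: "recursive_function (length gs) f \<Longrightarrow> (\<forall>g\<in>set gs. recursive_function n g) \<Longrightarrow>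
           recursive_function n (\<lambda>xs. f (map (\<lambda>g. g xs) gs))"
| prec: "recursive_function n f \<Longrightarrow> recursive_function (Suc (Suc n)) g \<Longrightarrow>
           recursive_function (Suc n)
             (\<lambda>xs. rec_nat (f (tl xs)) (\<lambda>k r. g (k # r # tl xs)) (hd xs))"
| minim: "recursive_function (Suc n) f \<Longrightarrow>
           (\<And>xs. length xs = n \<Longrightarrow> \<exists>y. f (y # xs) = 0) \<Longrightarrow>
           recursive_function n (\<lambda>xs. LEAST y. f (y # xs) = 0)"

end

theory Submission
  imports Defs "HOL-Number_Theory.Number_Theory" "HOL-Real_Asymp.Real_Asymp"
begin

text \<open>
  Let \<open>\<chi>\<^sub>1, \<chi>\<^sub>2\<close> of moduli \<open>q\<^sub>1 \<le> q\<^sub>2\<close> violate the claim, with real zeros \<open>1 - \<lambda>\<^sub>1, 1 - \<lambda>\<^sub>2\<close>. Because of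
  \<open>(1 + Re \<chi>\<^sub>1) (1 + Re \<chi>\<^sub>2) \<ge> 0\<close>, the derivatives of even order \<open>k\<close> at \<open>s\<^sub>0 = 1 + \<eta>\<close>, \<open>\<eta> = \<delta>/10\<close>, of
  \<open>log L(s, \<chi>)\<close> for \<open>\<chi>\<close> among \<open>1, \<chi>\<^sub>1, \<chi>\<^sub>2, \<chi>\<^sub>1 \<chi>\<^sub>2, \<chi>\<^sub>1 cnj \<chi>\<^sub>2\<close> have a nonnegative combination. Only the trivial
  character gives a pole. All zeros near \<open>s\<^sub>0\<close> are real, so that for even \<open>k\<close> they all contribute with the
  same sign and can be dropped, except for the two given ones; no count of the zeros is needed. Zeros
  farther away contribute \<open>O(k log q\<^sub>2 (2/9)^k)\<close> relative to the pole. Hence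
  \<open>(1 + \<lambda>\<^sub>1/\<eta>)^-k + (1 + \<lambda>\<^sub>2/\<eta>)^-k \<le> 1 + O(k log q\<^sub>2 (2/9)^k)\<close>. With \<open>k\<close> about \<open>2 log log q\<^sub>2\<close> the second term
  is \<open>1 - O((log q\<^sub>2)^-\<epsilon> log log q\<^sub>2)\<close>, whereas the first one is \<open>(log q\<^sub>2)^-o(1)\<close>: this is a
  contradiction no matter how much larger \<open>q\<^sub>2\<close> is than \<open>q\<^sub>1\<close>.

  The meromorphic continuation is obtained by repeated summation by parts: a periodic sequence of
  mean zero has periodic partial sums, which again have mean zero after subtraction of a constant.
\<close>

section \<open>Continuation of Dirichlet series with periodic coefficients\<close>

text \<open>The positivity must hold term by term, so the five logarithms have to be sums over the
  same integers. All characters are therefore read modulo \<open>Q = q1 * q2\<close>; the Euler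
  factors removed by this have no zeros in Re s > 0 and cost at most a factor \<open>Q\<close>,
  which is harmless under a logarithm. The products are in general imprimitive, but the primitive
  characters inducing them again have order dividing \<open>m\<close>, so the hypothesis on zeros
  covers them; they are nontrivial because the two classes differ, and so one pole faces two zeros.
  The ratio 2/9 is geometric: the disk of radius r = 9 \<delta>/10 about 1 + \<delta>/10 just fits
  into |z - 1| < \<delta>, Borel-Caratheodory gives growth (2/r)^k, and the pole has size
  (10/\<delta>)^k. Since 2/9 < 1/e, a \<open>k\<close> of size 2 log log q gives an error factor
  (log q)^(-2). Effectivity: the one constant that is not written out is an absolute
  \<open>C\<close>, a growth bound that depends on no parameter and enters the recursive function as
  a fixed numeral.\<close>

fun powr_diff :: "nat \<Rightarrow> complex \<Rightarrow> real \<Rightarrow> complex" where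
  "powr_diff 0 s x = of_real x powr (-s)"
| "powr_diff (Suc K) s x = powr_diff K s x - powr_diff K s (x + 1)"

lemma holomorphic_powr_diff: "x > 0 \<Longrightarrow> (\<lambda>s. powr_diff K s x) holomorphic_on A"
  by (induction K arbitrary: x) (auto intro!: holomorphic_intros)

text \<open>Differencing commutes with d/dx, and the derivative of x^(-s) is -s x^(-(s+1)): only
  \<open>s\<close> is shifted, the order \<open>K\<close> stays.\<close>

lemma powr_diff_has_vector_derivative:
  "x > 0 \<Longrightarrow> (powr_diff K s has_vector_derivative (- s * powr_diff K (s + 1) x)) (at x)"
proof (induction K arbitrary: x)
  case 0
  have "((\<lambda>z. z powr (-s)) has_field_derivative (- s * of_real x powr (- s - 1))) (at (of_real x))"
    using 0 by (auto intro!: derivative_eq_intros simp: complex_nonpos_Reals_iff)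
  hence "((\<lambda>t. of_real t powr (-s)) has_vector_derivative (- s * of_real x powr (- s - 1))) (at x)"
    by (rule has_vector_derivative_real_field)
  moreover have "powr_diff 0 s = (\<lambda>t. of_real t powr (-s))" by auto
  ultimately show ?case by simp
next
  case (Suc K)
  have shifted: "((\<lambda>t. powr_diff K s (t + 1)) has_vector_derivative (- s * powr_diff K (s + 1) (x + 1))) (at x)"
  proof -
    have "((\<lambda>t::real. t + 1) has_vector_derivative 1) (at x)"
      by (auto intro!: derivative_eq_intros)
    from vector_diff_chain_at[OF this, of "powr_diff K s"] Suc.IH[of "x + 1"] Suc.prems
    show ?thesis by (simp add: o_def)
  qed
  have "powr_diff (Suc K) s = (\<lambda>t. powr_diff K s t - powr_diff K s (t + 1))" by auto
  thus ?case
    using has_vector_derivative_diff[OF Suc.IH[OF Suc.prems] shifted] by (simp add: algebra_simps)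
qed

text \<open>Each difference is controlled by a derivative at an intermediate point, which costs a
  factor |s + i| and gains one power of \<open>x\<close>. The induction trades one difference for
  the shift from \<open>s\<close> to \<open>s + 1\<close>, so the exponent of the decay is
  preserved.\<close>

lemma norm_powr_diff_le:
  assumes "x > 0" "Re s + K \<ge> 0"
  shows "norm (powr_diff K s x) \<le> (\<Prod>i<K. norm (s + of_nat i)) * x powr (- (Re s + K))"
  using assms
proof (induction K arbitrary: s x)
  case 0
  thus ?case by (simp add: norm_powr_real_powr)
next
  case (Suc K)
  have "\<exists>y\<in>{x<..<x+1}. norm (powr_diff K s (x + 1) - powr_diff K s x) \<le>
      norm ((\<lambda>h. h *\<^sub>R (- s * powr_diff K (s + 1) y)) ((x + 1) - x))"
  proof (rule mvt_general)
    show "continuous_on {x..x + 1} (powr_diff K s)"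
      using Suc.prems
      by (intro continuous_at_imp_continuous_on ballI
          has_vector_derivative_continuous[OF powr_diff_has_vector_derivative]) auto
    show "(powr_diff K s has_derivative (\<lambda>h. h *\<^sub>R (- s * powr_diff K (s + 1) y))) (at y)"
      if "x < y" "y < x + 1" for y
      using powr_diff_has_vector_derivative[of y K s] that Suc.prems by (simp add: has_vector_derivative_def)
  qed auto
  then obtain y where y: "x < y" "norm (powr_diff K s (x + 1) - powr_diff K s x) \<le> norm s * norm (powr_diff K (s + 1) y)"
    by (auto simp: norm_mult)
  have "norm (powr_diff (Suc K) s x) \<le> norm s * norm (powr_diff K (s + 1) y)"
    using y by (simp add: norm_minus_commute)
  also have "\<dots> \<le> norm s * ((\<Prod>i<K. norm ((s + 1) + of_nat i)) * y powr (- (Re (s + 1) + K)))"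
    using Suc.IH[of y "s + 1"] y Suc.prems by (intro mult_left_mono) auto
  also have "\<dots> = (\<Prod>i<Suc K. norm (s + of_nat i)) * y powr (- (Re s + Suc K))"
    unfolding prod.lessThan_Suc_shift by (simp add: add_ac)
  also have "\<dots> \<le> (\<Prod>i<Suc K. norm (s + of_nat i)) * x powr (- (Re s + Suc K))"
    using y Suc.prems by (intro mult_left_mono powr_mono2' prod_nonneg) auto
  finally show ?case .
qed

section \<open>Periodic sequences of mean zero and their partial sums\<close>

definition mean_zero :: "nat \<Rightarrow> (nat \<Rightarrow> complex) \<Rightarrow> bool" where
  "mean_zero q a \<longleftrightarrow> q > 0 \<and> (\<forall>n. a (n + q) = a n) \<and> (\<Sum>n<q. a n) = 0"

text \<open>Subtracting this average restores mean zero, as the constant term does in the passage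
  from one Bernoulli polynomial to the next; only then can the summation by parts be
  iterated.\<close>

definition psum_mean :: "nat \<Rightarrow> (nat \<Rightarrow> complex) \<Rightarrow> complex" where
  "psum_mean q a = (\<Sum>n<q. \<Sum>j<Suc n. a j) / of_nat q"

definition psum_centered :: "nat \<Rightarrow> (nat \<Rightarrow> complex) \<Rightarrow> nat \<Rightarrow> complex" where
  "psum_centered q a n = (\<Sum>j<Suc n. a j) - psum_mean q a"

lemma periodic_mod:
  fixes a :: "nat \<Rightarrow> 'a"
  assumes "\<And>n. a (n + q) = a n"
  shows "a (n mod q) = a n"
proof -
  have "a (m + k * q) = a m" for m k
  proof (induction k)
    case (Suc k)
    have "a (m + Suc k * q) = a ((m + k * q) + q)" by (simp add: algebra_simps)
    thus ?case using Suc assms by simp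
  qed auto
  from this[of "n mod q" "n div q"] show ?thesis by simp
qed

lemma psum_periodic:
  assumes "mean_zero q a"
  shows "(\<Sum>j<n + q. a j) = (\<Sum>j<n. a j)"
  using assms by (induction n) (auto simp: mean_zero_def)

lemma mean_zero_psum_centered:
  assumes "mean_zero q a"
  shows "mean_zero q (psum_centered q a)"
proof -
  have "psum_centered q a (n + q) = psum_centered q a n" for n
    using psum_periodic[OF assms, of "Suc n"] by (simp add: psum_centered_def)
  moreover have "(\<Sum>n<q. psum_centered q a n) = 0"
    using assms by (simp add: psum_centered_def sum_subtractf psum_mean_def mean_zero_def)
  ultimately show ?thesis using assms by (simp add: mean_zero_def)
qed

lemma norm_psum_le:
  assumes "mean_zero q a" "\<And>n. norm (a n) \<le> 1"
  shows "norm (\<Sum>j<n. a j) \<le> q"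
proof -
  have "(\<Sum>j<n. a j) = (\<Sum>j<n mod q. a j)"
    using periodic_mod[of "\<lambda>n. \<Sum>j<n. a j" q n] psum_periodic[OF assms(1)] by simp
  also have "norm \<dots> \<le> (\<Sum>j<n mod q. 1)"
    by (rule sum_norm_le) (use assms in auto)
  also have "\<dots> \<le> q" using assms(1) by (simp add: mean_zero_def less_imp_le)
  finally show ?thesis .
qed

lemma norm_psum_mean_le:
  assumes "mean_zero q a" "\<And>n. norm (a n) \<le> 1"
  shows "norm (psum_mean q a) \<le> q"
proof -
  have "norm (\<Sum>n<q. \<Sum>j<Suc n. a j) \<le> (\<Sum>n<q. real q)"
    by (rule sum_norm_le) (rule norm_psum_le[OF assms])
  thus ?thesis using assms(1) by (simp add: psum_mean_def norm_divide mean_zero_def divide_le_eq)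
qed

lemma periodic_bounded:
  fixes a :: "nat \<Rightarrow> complex"
  assumes "mean_zero q a"
  obtains B where "B \<ge> 0" "\<And>n. norm (a n) \<le> B"
proof
  have q: "q > 0" using assms by (simp add: mean_zero_def)
  show "norm (a n) \<le> (\<Sum>j<q. norm (a j))" for n
  proof -
    have "norm (a n) = norm (a (n mod q))"
      using periodic_mod[of a q n] assms by (simp add: mean_zero_def)
    also have "\<dots> \<le> (\<Sum>j<q. norm (a j))"
      using q by (intro member_le_sum) auto
    finally show ?thesis .
  qed
qed (auto intro: sum_nonneg)

section \<open>The differenced series and its continuation to the left\<close>

definition diff_series :: "nat \<Rightarrow> (nat \<Rightarrow> complex) \<Rightarrow> complex \<Rightarrow> complex" where
  "diff_series K a s = (\<Sum>n. a n * powr_diff K s (real n + 1))"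

lemma summable_Suc_powr: "e > 1 \<Longrightarrow> summable (\<lambda>n. (real n + 1) powr (-e))"
  using summable_Suc_iff[of "\<lambda>n. real n powr (-e)"] summable_real_powr_iff[of "-e"]
  by (simp add: add.commute)

lemma summable_diff_series:
  assumes B: "\<And>n. norm (a n) \<le> B" and s: "Re s + K > 1"
  shows "summable (\<lambda>n. norm (a n * powr_diff K s (real n + 1)))"
proof (rule summable_comparison_test')
  let ?C = "\<Prod>i<K. norm (s + of_nat i)"
  show "summable (\<lambda>n. B * ?C * (real n + 1) powr (- (Re s + K)))"
    using s by (intro summable_mult summable_Suc_powr) auto
  fix n
  have "norm (a n) * norm (powr_diff K s (real n + 1)) \<le> B * (?C * (real n + 1) powr (- (Re s + K)))"
    using s B norm_ge_zero[of "a n"] by (intro mult_mono norm_powr_diff_le) (auto intro: order_trans[OF norm_ge_zero B])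
  thus "norm (norm (a n * powr_diff K s (real n + 1))) \<le> B * ?C * (real n + 1) powr (- (Re s + K))"
    by (simp add: norm_mult mult_ac)
qed

lemma holomorphic_diff_series:
  assumes "mean_zero q a"
  shows "diff_series K a holomorphic_on {s. Re s > 1 - real K}"
proof (rule holomorphic_uniform_sequence)
  show "open {s. Re s > 1 - real K}" by (rule open_halfspace_Re_gt)
  show "(\<lambda>s. \<Sum>n<N. a n * powr_diff K s (real n + 1)) holomorphic_on {s. Re s > 1 - real K}" for N
    by (intro holomorphic_intros holomorphic_powr_diff) auto
  fix z assume "z \<in> {s. Re s > 1 - real K}"
  hence z: "Re z + K > 1" by simp
  define d where "d = (Re z + K - 1) / 2"
  have d: "d > 0" using z by (simp add: d_def)
  obtain B where B: "B \<ge> 0" "\<And>n. norm (a n) \<le> B" using periodic_bounded[OF assms] by blast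
  define C where "C = (\<Prod>i<K. norm z + d + real i)"
  have re: "Re w + K \<ge> 1 + d" if "w \<in> cball z d" for w
  proof -
    have "\<bar>Re (z - w)\<bar> \<le> d" using that abs_Re_le_cmod[of "z - w"] by (simp add: dist_norm)
    moreover have "2 * d = Re z + K - 1" by (simp add: d_def)
    ultimately show ?thesis by (simp add: abs_le_iff)
  qed
  have "uniform_limit (cball z d) (\<lambda>N s. \<Sum>n<N. a n * powr_diff K s (real n + 1)) (diff_series K a) sequentially"
    unfolding diff_series_def
  proof (rule Weierstrass_m_test)
    show "summable (\<lambda>n. B * (C * (real n + 1) powr (- (1 + d))))"
      using d by (intro summable_mult summable_Suc_powr) auto
    fix n w assume w: "w \<in> cball z d"
    have nw: "norm w \<le> norm z + d"
      using w norm_triangle_ineq2[of w z] by (simp add: dist_norm norm_minus_commute)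
    have "norm (powr_diff K w (real n + 1)) \<le> (\<Prod>i<K. norm (w + of_nat i)) * (real n + 1) powr (- (Re w + K))"
      using re[OF w] d by (intro norm_powr_diff_le) auto
    also have "\<dots> \<le> C * (real n + 1) powr (- (1 + d))"
      unfolding C_def
    proof (intro mult_mono prod_mono powr_mono)
      fix i assume "i \<in> {..<K}"
      show "0 \<le> norm (w + of_nat i) \<and> norm (w + of_nat i) \<le> norm z + d + real i"
        using nw norm_triangle_ineq[of w "of_nat i"] by simp
    qed (use re[OF w] d in \<open>auto intro!: prod_nonneg\<close>)
    finally show "norm (a n * powr_diff K w (real n + 1)) \<le> B * (C * (real n + 1) powr (- (1 + d)))"
      unfolding norm_mult using B by (intro mult_mono) auto
  qed
  moreover have "cball z d \<subseteq> {s. Re s > 1 - real K}"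
    using re d by force
  ultimately show "\<exists>d>0. cball z d \<subseteq> {s. Re s > 1 - real K} \<and>
      uniform_limit (cball z d) (\<lambda>N s. \<Sum>n<N. a n * powr_diff K s (real n + 1)) (diff_series K a) sequentially"
    using d by blast
qed

lemma sum_by_parts:
  fixes a f :: "nat \<Rightarrow> complex"
  shows "(\<Sum>n<N. a n * f n) = (\<Sum>n<N. (\<Sum>j<Suc n. a j) * (f n - f (Suc n))) + (\<Sum>j<N. a j) * f N"
  by (induction N) (auto simp: algebra_simps)

text \<open>Abel summation replaces \<open>a\<close> by its partial sums at the price of one more
  difference. The mean of the partial sums is split off; its contribution telescopes to a multiple
  of \<open>powr_diff K s 1\<close>, which is entire in \<open>s\<close>. The series on the right
  converges on a half-plane wider by one.\<close>

lemma diff_series_sum_by_parts: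
  assumes a: "mean_zero q a" and s: "Re s + K > 1"
  shows "diff_series K a s = diff_series (Suc K) (psum_centered q a) s + psum_mean q a * powr_diff K s 1"
proof -
  define f where "f = (\<lambda>n::nat. powr_diff K s (real n + 1))"
  define P where "P = (\<lambda>n. \<Sum>j<Suc n. a j)"
  obtain B where B: "B \<ge> 0" "\<And>n. norm (a n) \<le> B" using periodic_bounded[OF a] by blast
  have "(\<lambda>n. norm (1 * powr_diff K s (real n + 1))) \<longlonglongrightarrow> 0"
    by (rule summable_LIMSEQ_zero, rule summable_diff_series[of "\<lambda>_. 1" 1, OF _ s]) simp
  hence f0: "f \<longlonglongrightarrow> 0" unfolding f_def by (simp add: tendsto_norm_zero_iff)
  have "(\<lambda>n. a n * f n) sums diff_series K a s"
    unfolding f_def diff_series_def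
    using summable_norm_cancel[OF summable_diff_series[OF B(2) s]] by (rule summable_sums)
  hence "(\<lambda>N. \<Sum>n<N. a n * f n) \<longlonglongrightarrow> diff_series K a s" by (simp add: sums_def)
  \<comment> \<open>The boundary term vanishes because full periods cancel, so that the partial sums
    stay bounded.\<close>
  moreover have "(\<lambda>N. (\<Sum>j<N. a j) * f N) \<longlonglongrightarrow> 0"
  proof -
    obtain B' where B': "\<And>N. norm (\<Sum>j<N. a j) \<le> B'"
    proof
      fix N
      have q: "q > 0" using a by (simp add: mean_zero_def)
      have "(\<Sum>j<N. a j) = (\<Sum>j<N mod q. a j)"
        using periodic_mod[of "\<lambda>n. \<Sum>j<n. a j" q N] psum_periodic[OF a] by simp
      also have "norm \<dots> \<le> (\<Sum>j<N mod q. norm (a j))" by (rule norm_sum)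
      also have "\<dots> \<le> (\<Sum>j<q. norm (a j))"
        using q by (intro sum_mono2) (auto intro: less_trans[OF _ mod_less_divisor])
      finally show "norm (\<Sum>j<N. a j) \<le> (\<Sum>j<q. norm (a j))" .
    qed
    have "(\<lambda>N. f N * (\<Sum>j<N. a j)) \<longlonglongrightarrow> 0"
    proof (rule Lim_null_comparison)
      show "eventually (\<lambda>N. norm (f N * (\<Sum>j<N. a j)) \<le> norm (f N) * B') sequentially"
        by (intro always_eventually allI) (simp add: norm_mult mult_left_mono B')
      show "(\<lambda>N. norm (f N) * B') \<longlonglongrightarrow> 0"
        using tendsto_mult_left_zero[OF tendsto_norm_zero[OF f0]] .
    qed
    thus ?thesis by (simp add: mult.commute)
  qed
  ultimately have "(\<lambda>N. (\<Sum>n<N. a n * f n) - (\<Sum>j<N. a j) * f N) \<longlonglongrightarrow> diff_series K a s - 0"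
    by (rule tendsto_diff)
  moreover have "(\<Sum>n<N. a n * f n) - (\<Sum>j<N. a j) * f N = (\<Sum>n<N. P n * (f n - f (Suc n)))" for N
    by (subst sum_by_parts) (simp add: P_def)
  ultimately have "(\<lambda>N. \<Sum>n<N. P n * (f n - f (Suc n))) \<longlonglongrightarrow> diff_series K a s"
    by simp
  hence "(\<lambda>n. P n * (f n - f (Suc n))) sums diff_series K a s" by (simp add: sums_def)
  moreover have "(\<lambda>n. f n - f (Suc n)) sums (f 0 - 0)"
    by (rule telescope_sums'[OF f0])
  hence "(\<lambda>n. psum_mean q a * (f n - f (Suc n))) sums (psum_mean q a * (f 0 - 0))"
    by (rule sums_mult)
  ultimately have "(\<lambda>n. P n * (f n - f (Suc n)) - psum_mean q a * (f n - f (Suc n))) sums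
     (diff_series K a s - psum_mean q a * (f 0 - 0))" by (rule sums_diff)
  hence "(\<lambda>n. psum_centered q a n * powr_diff (Suc K) s (real n + 1)) sums
     (diff_series K a s - psum_mean q a * powr_diff K s 1)"
    by (simp add: f_def P_def psum_centered_def algebra_simps)
  hence "diff_series (Suc K) (psum_centered q a) s = diff_series K a s - psum_mean q a * powr_diff K s 1"
    unfolding diff_series_def by (rule sums_unique[symmetric])
  thus ?thesis by simp
qed

text \<open>\<open>K\<close> and \<open>a\<close> must vary in the induction: every step passes to
  the centered partial sums and to order \<open>K + 1\<close>.\<close>

lemma diff_series_continuation_strip:
  assumes "mean_zero q a"
  shows "\<exists>f. f holomorphic_on {s. Re s > 1 - real K - real J} \<and> (\<forall>s. Re s > 1 - real K \<longrightarrow> f s = diff_series K a s)"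
  using assms
proof (induction J arbitrary: K a)
  case 0
  show ?case by (rule exI[of _ "diff_series K a"]) (use holomorphic_diff_series[OF 0] in auto)
next
  case (Suc J)
  obtain f where f: "f holomorphic_on {s. Re s > 1 - real (Suc K) - real J}"
     "\<And>s. Re s > 1 - real (Suc K) \<Longrightarrow> f s = diff_series (Suc K) (psum_centered q a) s"
    using Suc.IH[OF mean_zero_psum_centered[OF Suc.prems]] by blast
  have *: "{s. Re s > 1 - real (Suc K) - real J} = {s. Re s > 1 - real K - real (Suc J)}" by auto
  show ?case
    by (rule exI[of _ "\<lambda>s. f s + psum_mean q a * powr_diff K s 1"])
       (use f diff_series_sum_by_parts[OF Suc.prems, of _ K] * in
         \<open>auto intro!: holomorphic_intros holomorphic_powr_diff\<close>)
qed

lemma diff_series_0_eq: "diff_series 0 a s = (\<Sum>n. a n / of_nat (Suc n) powr s)"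
  by (simp add: diff_series_def powr_minus divide_inverse add.commute)

lemma sums_diff_series_0:
  assumes "\<And>n. norm (a n) \<le> B" "Re s > 1"
  shows "(\<lambda>n. a n / of_nat (Suc n) powr s) sums diff_series 0 a s"
proof -
  have "summable (\<lambda>n. a n * powr_diff 0 s (real n + 1))"
    by (rule summable_norm_cancel[OF summable_diff_series]) (use assms in auto)
  hence "(\<lambda>n. a n * powr_diff 0 s (real n + 1)) sums diff_series 0 a s"
    unfolding diff_series_def by (rule summable_sums)
  thus ?thesis by (simp add: powr_minus divide_inverse add.commute)
qed

lemma halfplane_eqI:
  assumes "f holomorphic_on {s. Re s > \<sigma>}" "g holomorphic_on {s. Re s > \<sigma>}"
    and "\<And>s. Re s > \<tau> \<Longrightarrow> f s = g s" and "Re s > \<sigma>" "\<sigma> \<le> \<tau>"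
  shows "f s = g s"
proof (rule analytic_continuation_open[where f = f and g = g, of "{s. Re s > \<tau>}" "{s. Re s > \<sigma>}"])
  have "complex_of_real (\<tau> + 1) \<in> {s. Re s > \<tau>}" by simp
  thus "{s. Re s > \<tau>} \<noteq> {}" by blast
qed (use assms in \<open>auto simp: open_halfspace_Re_gt intro!: convex_connected convex_halfspace_Re_gt\<close>)

lemma diff_series_entire_continuation:
  assumes "mean_zero q a"
  shows "\<exists>F. F holomorphic_on UNIV \<and> (\<forall>s. Re s > 1 \<longrightarrow> F s = diff_series 0 a s)"
proof -
  define strip where "strip = (\<lambda>J f. f holomorphic_on {s. Re s > 1 - real J} \<and>
      (\<forall>s. Re s > 1 \<longrightarrow> f s = diff_series 0 a s))"
  have "\<exists>f. strip J f" for J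
    using diff_series_continuation_strip[OF assms, of 0 J] by (simp add: strip_def)
  then obtain f where f': "\<And>J. strip J (f J)" by metis
  have f: "f J holomorphic_on {s. Re s > 1 - real J}"
      "Re s > 1 \<Longrightarrow> f J s = diff_series 0 a s" for J s
    using f'[of J] by (auto simp: strip_def)
  have eq: "f I s = f J s" if "I \<le> J" "Re s > 1 - real I" for I J s
  proof (rule halfplane_eqI[OF f(1)[of I] _ _ that(2)])
    show "f J holomorphic_on {s. 1 - real I < Re s}"
      using that(1) by (intro holomorphic_on_subset[OF f(1)[of J]]) auto
    show "f I w = f J w" if "Re w > 1" for w using that by (simp add: f(2))
  qed simp
  \<comment> \<open>The index is at least 2 - Re s, which puts \<open>s\<close> strictly inside the
    half-plane of that continuation; by \<open>eq\<close> every other admissible index gives the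
    same value.\<close>
  define F where "F = (\<lambda>s. f (nat \<lceil>2 - Re s\<rceil>) s)"
  have F: "F s = f J s" if "Re s > 1 - real J" for J s
  proof -
    define I where "I = nat \<lceil>2 - Re s\<rceil>"
    have I: "Re s > 1 - real I" unfolding I_def by linarith
    have "f I s = f J s"
    proof (cases "I \<le> J")
      case True
      thus ?thesis using I by (rule eq)
    next
      case False
      hence "f J s = f I s" using that by (intro eq) auto
      thus ?thesis ..
    qed
    thus ?thesis by (simp add: F_def I_def)
  qed
  have "F holomorphic_on (\<Union>J. {s. Re s > 1 - real J})"
  proof (rule holomorphic_on_UN_open)
    show "F holomorphic_on {s. Re s > 1 - real J}" for J
      using f(1)[of J] by (rule holomorphic_transform) (simp add: F)
  qed (rule open_halfspace_Re_gt)
  moreover have "(\<Union>J. {s. Re s > 1 - real J}) = UNIV"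
  proof (intro equalityI subsetI UNIV_I)
    fix s :: complex
    have "Re s > 1 - real (nat \<lceil>2 - Re s\<rceil>)" by linarith
    thus "s \<in> (\<Union>J. {s. Re s > 1 - real J})" by blast
  qed
  moreover have "F s = diff_series 0 a s" if "Re s > 1" for s
    using F[of 0 s] f(2)[OF that] that by simp
  ultimately show ?thesis by auto
qed

text \<open>One summation by parts already converges for Re s > 0, and for Re s \<ge> 1/2 its terms
  decay like n^(-3/2). Partial sums and their mean are at most \<open>q\<close>, whence the linear
  dependence on the modulus.\<close>

lemma continuation_bound:
  assumes a: "mean_zero q a" "\<And>n. norm (a n) \<le> 1"
    and F: "F holomorphic_on UNIV" "\<And>s. Re s > 1 \<Longrightarrow> F s = diff_series 0 a s"
    and s: "Re s \<ge> 1/2"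
  shows "norm (F s) \<le> q * (1 + 2 * norm s * (\<Sum>n. (real n + 1) powr (-(3/2))))"
proof -
  have s0: "Re s > 0" using s by simp
  have "F s = diff_series 1 (psum_centered q a) s + psum_mean q a * powr_diff 0 s 1"
  proof (rule halfplane_eqI[where f = F and \<sigma> = 0 and \<tau> = 1])
    show "(\<lambda>s. diff_series 1 (psum_centered q a) s + psum_mean q a * powr_diff 0 s 1) holomorphic_on {s. Re s > 0}"
      using holomorphic_diff_series[OF mean_zero_psum_centered[OF a(1)], of 1]
      by (intro holomorphic_intros holomorphic_powr_diff) auto
    show "F w = diff_series 1 (psum_centered q a) w + psum_mean q a * powr_diff 0 w 1" if "Re w > 1" for w
      using F(2)[OF that] diff_series_sum_by_parts[OF a(1), of w 0] that by simp
  qed (use F(1) s0 holomorphic_on_subset in auto)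
  hence "F s = diff_series 1 (psum_centered q a) s + psum_mean q a" by simp
  hence "norm (F s) \<le> norm (diff_series 1 (psum_centered q a) s) + norm (psum_mean q a)"
    using norm_triangle_ineq by metis
  moreover have "norm (psum_mean q a) \<le> q" by (rule norm_psum_mean_le[OF a])
  moreover have "norm (diff_series 1 (psum_centered q a) s) \<le> 2 * q * norm s * (\<Sum>n. (real n + 1) powr (-(3/2)))"
  proof -
    have sm: "summable (\<lambda>n. 2 * q * norm s * (real n + 1) powr (-(3/2)))"
      by (intro summable_mult summable_Suc_powr) auto
    have pc: "norm (psum_centered q a n) \<le> 2 * q" for n
      using norm_triangle_ineq4[of "\<Sum>j<Suc n. a j" "psum_mean q a"]
        norm_psum_le[OF a, of "Suc n"] norm_psum_mean_le[OF a] by (simp add: psum_centered_def)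
    have le: "norm (psum_centered q a n * powr_diff 1 s (real n + 1)) \<le> 2 * q * norm s * (real n + 1) powr (-(3/2))" for n
    proof -
      have "norm (powr_diff 1 s (real n + 1)) \<le> norm s * (real n + 1) powr (-(Re s + 1))"
        using norm_powr_diff_le[of "real n + 1" s 1] s by simp
      also have "\<dots> \<le> norm s * (real n + 1) powr (-(3/2))"
        using s by (intro mult_left_mono powr_mono) auto
      finally have "norm (psum_centered q a n) * norm (powr_diff 1 s (real n + 1)) \<le>
          (2 * q) * (norm s * (real n + 1) powr (-(3/2)))"
        using pc by (intro mult_mono) auto
      thus ?thesis by (simp add: norm_mult mult_ac)
    qed
    have "norm (diff_series 1 (psum_centered q a) s) \<le> (\<Sum>n. 2 * q * norm s * (real n + 1) powr (-(3/2)))"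
      unfolding diff_series_def by (rule norm_suminf_le[OF le sm])
    also have "\<dots> = 2 * q * norm s * (\<Sum>n. (real n + 1) powr (-(3/2)))"
      by (intro suminf_mult summable_Suc_powr) auto
    finally show ?thesis .
  qed
  ultimately show ?thesis by (simp add: algebra_simps)
qed

section \<open>Real zeros and the logarithmic derivative\<close>

lemma factor_out_zero:
  assumes "f holomorphic_on S" "open S" "connected S" "a \<in> S" "f a = 0" "s \<in> S" "f s \<noteq> 0"
  obtains n g where "n > 0" "g holomorphic_on S" "g a \<noteq> 0" "\<And>z. z \<in> S \<Longrightarrow> f z = (z - a) ^ n * g z"
proof -
  have nc: "\<not> f constant_on S"
    unfolding constant_on_def using assms(4-7) by fastforce
  obtain g r n where n: "0 < n" and r: "0 < r" "ball a r \<subseteq> S"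
      and g: "g holomorphic_on ball a r" "\<And>w. w \<in> ball a r \<Longrightarrow> f w = (w - a)^n * g w"
             "\<And>w. w \<in> ball a r \<Longrightarrow> g w \<noteq> 0"
    by (rule holomorphic_factor_zero_nonconstant[OF assms(1-5) nc]) (rule that; assumption)
  \<comment> \<open>Near \<open>a\<close> this is the local factor \<open>g\<close>, elsewhere the
    quotient; the two open pieces cover \<open>S\<close>.\<close>
  define G where "G = (\<lambda>z. if z = a then g a else f z / (z - a) ^ n)"
  have "G holomorphic_on ball a r"
    using g(1) by (rule holomorphic_transform) (auto simp: G_def g(2))
  moreover have "G holomorphic_on S - {a}"
  proof (rule holomorphic_transform[where f = "\<lambda>z. f z / (z - a) ^ n"])
    show "(\<lambda>z. f z / (z - a) ^ n) holomorphic_on S - {a}"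
      by (intro holomorphic_intros holomorphic_on_subset[OF assms(1)]) auto
  qed (auto simp: G_def)
  ultimately have "G holomorphic_on (ball a r \<union> (S - {a}))"
    using assms(2) by (intro holomorphic_on_Un) (auto intro: open_delete)
  moreover have "ball a r \<union> (S - {a}) = S"
    using r assms(4) by auto
  ultimately have "G holomorphic_on S" by simp
  moreover have "f z = (z - a) ^ n * G z" if "z \<in> S" for z
    using n assms(5) by (auto simp: G_def)
  moreover have "G a \<noteq> 0"
    using g(3) r by (simp add: G_def)
  ultimately show ?thesis using that n by blast
qed

text \<open>
  On the sphere of radius \<open>2 r\<close> every point is at least as far from a zero in the ball of radius \<open>r\<close>
  as the centre is, so dividing out such a zero does not spoil the growth bound relative to the centre.
\<close>

lemma factor_out_zeros_in_ball:
  fixes f :: "complex \<Rightarrow> complex"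
  assumes "finite Z" "f holomorphic_on ball s R" "0 < r" "2 * r < R" "f s \<noteq> 0"
    and "\<And>z. dist s z = 2 * r \<Longrightarrow> norm (f z) \<le> M * norm (f s)"
    and "{z \<in> ball s r. f z = 0} = Z"
  shows "\<exists>g n. g holomorphic_on ball s R \<and> g s \<noteq> 0 \<and> (\<forall>z\<in>ball s r. g z \<noteq> 0) \<and>
    (\<forall>z. dist s z = 2 * r \<longrightarrow> norm (g z) \<le> M * norm (g s)) \<and>
    (\<forall>z\<in>ball s R. f z = (\<Prod>a\<in>Z. (z - a) ^ n a) * g z) \<and> (\<forall>a\<in>Z. n a > (0::nat))"
  using assms
proof (induction Z arbitrary: f rule: finite_induct)
  case empty
  show ?case
    by (rule exI[of _ f], rule exI[of _ "\<lambda>_. 1"]) (use empty in auto)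
next
  case (insert a Z f)
  have a: "f a = 0" "a \<in> ball s r" using insert.prems(6) by auto
  have aS: "a \<in> ball s R" "s \<in> ball s R" using a insert.prems by auto
  obtain n g where g: "n > 0" "g holomorphic_on ball s R" "g a \<noteq> 0"
      "\<And>z. z \<in> ball s R \<Longrightarrow> f z = (z - a) ^ n * g z"
    by (rule factor_out_zero[OF insert.prems(1) open_ball connected_ball aS(1) a(1) aS(2)
          insert.prems(4)]) (rule that; assumption)
  have zeros: "{z \<in> ball s r. g z = 0} = Z"
  proof -
    have "{z \<in> ball s r. g z = 0} = {z \<in> ball s r. f z = 0} - {a}"
      using g insert.prems(2,3) by auto
    thus ?thesis using insert.prems(6) insert.hyps by auto
  qed
  have gs: "g s \<noteq> 0" using g(4)[OF aS(2)] insert.prems(4) by auto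
  have bound: "norm (g z) \<le> M * norm (g s)" if z: "dist s z = 2 * r" for z
  proof -
    have zS: "z \<in> ball s R" using z insert.prems by auto
    have "dist s z \<le> dist s a + dist a z" by (rule dist_triangle)
    hence far: "norm (s - a) \<le> norm (z - a)" "0 < norm (z - a)"
      using z a insert.prems(2) by (auto simp: dist_norm norm_minus_commute)
    have "norm (z - a) ^ n * norm (g z) = norm (f z)"
      using g(4)[OF zS] by (simp add: norm_mult norm_power)
    also have "\<dots> \<le> M * norm (f s)" using insert.prems(5)[OF z] .
    also have "\<dots> = M * norm (g s) * norm (s - a) ^ n"
      using g(4)[OF aS(2)] by (simp add: norm_mult norm_power)
    also have "\<dots> \<le> M * norm (g s) * norm (z - a) ^ n"
    proof (intro mult_left_mono power_mono far)
      \<comment> \<open>The sign of \<open>M\<close> is forced by the bound at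
        \<open>z\<close>.\<close>
      have "0 \<le> M * norm (f s)" using insert.prems(5)[OF z] norm_ge_zero order_trans by blast
      hence "0 \<le> M" using insert.prems(4) by (simp add: zero_le_mult_iff)
      thus "0 \<le> M * norm (g s)" by simp
    qed auto
    finally show ?thesis using far by (simp add: mult.commute)
  qed
  from insert.IH[OF g(2) insert.prems(2,3) gs bound zeros]
  obtain h m where h: "h holomorphic_on ball s R" "h s \<noteq> 0" "\<forall>z\<in>ball s r. h z \<noteq> 0"
    "\<forall>z. dist s z = 2 * r \<longrightarrow> norm (h z) \<le> M * norm (h s)"
    "\<forall>z\<in>ball s R. g z = (\<Prod>a\<in>Z. (z - a) ^ m a) * h z" "\<forall>a\<in>Z. m a > 0"
    by blast
  have "f z = (\<Prod>b\<in>insert a Z. (z - b) ^ (m(a := n)) b) * h z" if "z \<in> ball s R" for z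
  proof -
    have "(\<Prod>b\<in>Z. (z - b) ^ (m(a := n)) b) = (\<Prod>b\<in>Z. (z - b) ^ m b)"
      using insert.hyps by (intro prod.cong) auto
    thus ?thesis using insert.hyps g(4)[OF that] h(5) that by (simp add: mult.assoc)
  qed
  hence "\<forall>z\<in>ball s R. f z = (\<Prod>b\<in>insert a Z. (z - b) ^ (m(a := n)) b) * h z" by blast
  moreover have "\<forall>b\<in>insert a Z. (m(a := n)) b > 0" using h(6) g(1) by simp
  ultimately show ?case
    by (intro exI[of _ h] exI[of _ "m(a := n)"] conjI h(1-4))
qed

section \<open>Derivatives of partial fractions and of the zero-free factor\<close>

lemma higher_deriv_inverse_diff:
  fixes a z :: complex
  assumes "z \<noteq> a"
  shows "(deriv ^^ j) (\<lambda>w. 1 / (w - a)) z = (-1) ^ j * fact j / (z - a) ^ Suc j"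
  using assms
proof (induction j arbitrary: z)
  case (Suc j)
  have "eventually (\<lambda>w. w \<in> - {a}) (nhds z)"
    using Suc.prems by (intro eventually_nhds_in_open) auto
  hence "eventually (\<lambda>w. (deriv ^^ j) (\<lambda>w. 1 / (w - a)) w = (-1) ^ j * fact j / (w - a) ^ Suc j) (nhds z)"
    by eventually_elim (use Suc.IH in auto)
  hence "deriv ((deriv ^^ j) (\<lambda>w. 1 / (w - a))) z = deriv (\<lambda>w. (-1) ^ j * fact j / (w - a) ^ Suc j) z"
    by (intro deriv_cong_ev) auto
  also have "((\<lambda>w. (-1) ^ j * fact j / (w - a) ^ Suc j) has_field_derivative
     ((-1) ^ j * fact j * (- of_nat (Suc j) * (z - a) ^ j) / ((z - a) ^ Suc j)^2)) (at z)"
    using Suc.prems by (auto intro!: derivative_eq_intros simp: power2_eq_square minus_mult_left[symmetric] simp del: power_Suc minus_add_distrib)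
  hence "deriv (\<lambda>w. (-1) ^ j * fact j / (w - a) ^ Suc j) z =
     (-1) ^ j * fact j * (- of_nat (Suc j) * (z - a) ^ j) / ((z - a) ^ Suc j)^2"
    by (rule DERIV_imp_deriv)
  also have "\<dots> = (-1) ^ Suc j * fact (Suc j) / (z - a) ^ Suc (Suc j)"
  proof -
    define y where "y = z - a"
    have "y \<noteq> 0" using Suc.prems by (simp add: y_def)
    thus ?thesis unfolding y_def[symmetric] by (simp add: field_simps power2_eq_square)
  qed
  finally show ?case by simp
qed auto

text \<open>The map w / (2 A - w) sends the half-plane Re w < A into the unit disk, so the Schwarz
  lemma turns a one-sided bound on the real part into a bound for the modulus on the circle of
  radius \<open>r/2\<close>. Cauchy's inequality on that circle explains the factor 2 in
  \<open>2 / r\<close>.\<close>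

lemma borel_caratheodory_coeff:
  fixes h :: "complex \<Rightarrow> complex"
  assumes h: "h holomorphic_on ball s r" "h s = 0" and r: "r > 0"
    and A: "A > 0" "\<And>z. z \<in> ball s r \<Longrightarrow> Re (h z) < A"
  shows "norm ((deriv ^^ k) h s) \<le> fact k * (2 * A) * (2 / r) ^ k"
proof -
  define \<phi> where "\<phi> = (\<lambda>z. h (s + of_real r * z) / (of_real (2*A) - h (s + of_real r * z)))"
  have mem: "s + of_real r * z \<in> ball s r" if "norm z < 1" for z
    using that r by (auto simp: dist_norm norm_mult)
  have nz: "of_real (2*A) - h w \<noteq> 0" if "w \<in> ball s r" for w
  proof
    assume "of_real (2*A) - h w = 0"
    hence "h w = of_real (2 * A)" by simp
    thus False using A(2)[OF that] A(1) by simp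
  qed
  have "(h \<circ> (\<lambda>z. s + of_real r * z)) holomorphic_on ball 0 1"
    by (rule holomorphic_on_compose_gen[OF _ h(1)]) (auto intro!: holomorphic_intros mem[unfolded mem_ball])
  hence hol: "(\<lambda>z. h (s + of_real r * z)) holomorphic_on ball 0 1" by (simp add: o_def)
  have phi: "\<phi> holomorphic_on ball 0 1"
    unfolding \<phi>_def by (intro holomorphic_intros hol nz mem) auto
  have lt: "norm (\<phi> z) < 1" if "norm z < 1" for z
  proof -
    let ?w = "h (s + of_real r * z)"
    have "Re ?w < A" using A(2) mem[OF that] by blast
    \<comment> \<open>The difference of the two squares is 4 A (A - Re w).\<close>
    hence "(norm ?w)^2 < (norm (of_real (2*A) - ?w))^2"
      unfolding cmod_power2 using A(1)
      by (simp add: power2_eq_square algebra_simps)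
    hence "norm ?w < norm (of_real (2*A) - ?w)"
      by (rule power2_less_imp_less) auto
    moreover have "0 < norm (of_real (2*A) - ?w)" using nz[OF mem[OF that]] by simp
    ultimately show ?thesis unfolding \<phi>_def norm_divide by (simp del: of_real_mult)
  qed
  have phi0: "\<phi> 0 = 0" by (simp add: \<phi>_def h(2))
  \<comment> \<open>Schwarz gives |h| \<le> |2 A - h| / 2 \<le> A + |h| / 2 at half the
    radius.\<close>
  have small: "norm (h w) \<le> 2 * A" if w: "norm (s - w) = r/2" for w
  proof -
    define z where "z = (w - s) / of_real r"
    have nz': "norm z = 1/2" using w r by (simp add: z_def norm_divide norm_minus_commute)
    have wz: "w = s + of_real r * z" using r by (simp add: z_def)
    have le: "norm (\<phi> z) \<le> 1/2"
      using Schwarz_Lemma(1)[OF phi phi0 lt, of z] nz' by simp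
    have "of_real (2*A) - h w \<noteq> 0" using nz mem[of z] nz' wz by simp
    hence "norm (h w) = norm (\<phi> z) * norm (of_real (2*A) - h w)"
      unfolding \<phi>_def wz[symmetric] by (simp add: norm_divide)
    also have "\<dots> \<le> 1/2 * norm (of_real (2*A) - h w)"
      using le by (intro mult_right_mono) auto
    also have "norm (of_real (2*A) - h w) \<le> 2 * A + norm (h w)"
      using norm_triangle_ineq4[of "of_real (2*A)" "h w"] A(1) by simp
    finally show ?thesis by simp
  qed
  have "norm ((deriv ^^ k) h s) \<le> fact k * (2*A) / (r/2) ^ k"
  proof (rule Cauchy_inequality)
    show "h holomorphic_on ball s (r/2)"
      using r by (intro holomorphic_on_subset[OF h(1)]) auto
    show "continuous_on (cball s (r/2)) h"
      using r by (intro continuous_on_subset[OF holomorphic_on_imp_continuous_on[OF h(1)]]) auto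
  qed (use r small in auto)
  thus ?thesis by (simp add: power_divide field_simps)
qed

lemma higher_deriv_sum:
  fixes f :: "'a \<Rightarrow> complex \<Rightarrow> complex"
  assumes "finite A" "\<And>a. a \<in> A \<Longrightarrow> f a holomorphic_on S" "open S" "z \<in> S"
  shows "(deriv ^^ n) (\<lambda>w. \<Sum>a\<in>A. f a w) z = (\<Sum>a\<in>A. (deriv ^^ n) (f a) z)"
  using assms(1,2)
proof (induction rule: finite_induct)
  case empty
  have "(deriv ^^ n) (\<lambda>w. 0::complex) z = 0"
    by (induction n) (simp_all add: higher_deriv_const)
  thus ?case by simp
next
  case (insert a A)
  have "(deriv ^^ n) (\<lambda>w. f a w + (\<Sum>a\<in>A. f a w)) z = (deriv ^^ n) (f a) z + (deriv ^^ n) (\<lambda>w. \<Sum>a\<in>A. f a w) z"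
    using insert.prems by (intro higher_deriv_add[OF _ _ assms(3,4)] holomorphic_intros) auto
  thus ?case using insert by simp
qed

text \<open>
  A Landau-type bound: for even \<open>k\<close> every real zero pushes the \<open>(k-1)\<close>-st derivative of the
  logarithmic derivative in the same direction, so all zeros but one may be dropped.
\<close>

lemma log_deriv_real_zeros_le:
  fixes f :: "complex \<Rightarrow> complex" and x r R A :: real
  defines "s \<equiv> complex_of_real x"
  assumes f: "f holomorphic_on ball s R" and r: "0 < r" "2 * r < R" and fs: "f s \<noteq> 0" and A: "A > 0"
    and bound: "\<And>z. dist s z = 2 * r \<Longrightarrow> norm (f z) \<le> exp A * norm (f s)"
    and real: "\<And>z. z \<in> ball s r \<Longrightarrow> f z = 0 \<Longrightarrow> z \<in> \<real>"
    and k: "even k" "k > 0"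
  shows "Re ((deriv ^^ (k - 1)) (\<lambda>z. deriv f z / f z) s) \<le> fact (k - 1) * (4 * real k * A * (2 / r) ^ k)"
    and "\<And>\<beta>. \<bar>x - \<beta>\<bar> < r \<Longrightarrow> f (of_real \<beta>) = 0 \<Longrightarrow>
      Re ((deriv ^^ (k - 1)) (\<lambda>z. deriv f z / f z) s) \<le>
        fact (k - 1) * (4 * real k * A * (2 / r) ^ k - 1 / (x - \<beta>) ^ k)"
proof -
  define Z where "Z = {z \<in> ball s r. f z = 0}"
  have sR: "s \<in> ball s R" "s \<in> ball s r" using r by auto
  have fin: "finite Z"
  proof (cases "f constant_on ball s R")
    case True
    have "f z \<noteq> 0" if "z \<in> ball s r" for z
    proof -
      have "z \<in> ball s R" using that r by auto
      thus ?thesis using True fs sR unfolding constant_on_def by fastforce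
    qed
    hence "Z = {}" by (auto simp: Z_def)
    thus ?thesis by simp
  next
    case False
    have "finite {z \<in> cball s r. f z = 0}"
      using r by (intro holomorphic_compact_finite_zeros[OF f open_ball connected_ball compact_cball _ False]) auto
    moreover have "Z \<subseteq> {z \<in> cball s r. f z = 0}" by (auto simp: Z_def)
    ultimately show ?thesis by (rule finite_subset[rotated])
  qed
  from factor_out_zeros_in_ball[OF fin f r fs bound Z_def[symmetric]]
  obtain g n where g: "g holomorphic_on ball s R" "g s \<noteq> 0" "\<forall>z\<in>ball s r. g z \<noteq> 0"
    "\<forall>z. dist s z = 2 * r \<longrightarrow> norm (g z) \<le> exp A * norm (g s)"
    "\<forall>z\<in>ball s R. f z = (\<Prod>a\<in>Z. (z - a) ^ n a) * g z" "\<forall>a\<in>Z. n a > (0::nat)"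
    by blast
  \<comment> \<open>The growth bound is known on the sphere of radius \<open>2 * r\<close>; the
    maximum modulus principle carries it into the ball, where \<open>g\<close> has no zeros and thus
    a logarithm.\<close>
  have gle: "norm (g z) \<le> exp A * norm (g s)" if "z \<in> ball s r" for z
  proof (rule maximum_modulus_frontier[where f = g and S = "cball s (2*r)" and \<xi> = z])
    show "g holomorphic_on interior (cball s (2 * r))" "continuous_on (closure (cball s (2 * r))) g"
      using r g(1) by (auto intro!: holomorphic_on_subset[OF g(1)]
         continuous_on_subset[OF holomorphic_on_imp_continuous_on[OF g(1)]])
  qed (use g(4) that r in \<open>auto simp: dist_commute\<close>)
  obtain h0 where h0: "h0 holomorphic_on ball s r" "\<And>z. z \<in> ball s r \<Longrightarrow> exp (h0 z) = g z"
    using holomorphic_logarithm_exists[OF convex_ball open_ball _ _ sR(2), of g]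
      holomorphic_on_subset[OF g(1)] r g(3) by (metis less_add_same_cancel1 mult_2 order.strict_trans subset_ball order_less_imp_le)
  define h where "h = (\<lambda>z. h0 z - h0 s)"
  have h: "h holomorphic_on ball s r" "h s = 0" unfolding h_def by (auto intro!: holomorphic_intros h0)
  have expA: "norm (exp (h z)) \<le> exp A" if "z \<in> ball s r" for z
    using gle[OF that] h0(2)[OF that] h0(2)[OF sR(2)] g(2)
    by (simp add: h_def exp_diff norm_divide divide_le_eq del: norm_exp_eq_Re)
  \<comment> \<open>Borel-Caratheodory asks for a strict inequality; doubling \<open>A\<close>
    provides it and makes the constant \<open>4 * A\<close>.\<close>
  have "Re (h z) < 2 * A" if "z \<in> ball s r" for z
    using expA[OF that] A by simp
  from borel_caratheodory_coeff[OF h r(1) _ this, of k] A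
  have coeff: "norm ((deriv ^^ k) h s) \<le> fact k * (4 * A) * (2 / r) ^ k" by simp
  define S where "S = ball s r - Z"
  have S: "open S" "s \<in> S" "S \<subseteq> ball s r"
    using fin fs sR by (auto simp: S_def Z_def intro!: open_Diff finite_imp_closed)
  have ld: "deriv f z / f z = (\<Sum>a\<in>Z. of_nat (n a) * (1 / (z - a))) + deriv h z" if z: "z \<in> S" for z
  proof -
    have zr: "z \<in> ball s r" "z \<in> ball s R" using z S r by auto
    have ne: "z \<noteq> a" if "a \<in> Z" for a using that z by (auto simp: S_def)
    have dP: "((\<lambda>w. \<Prod>a\<in>Z. (w - a) ^ n a) has_field_derivative
        (\<Prod>a\<in>Z. (z - a) ^ n a) * (\<Sum>a\<in>Z. of_nat (n a) * (1 / (z - a)))) (at z)"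
    proof -
      have "((\<lambda>w. \<Prod>a\<in>Z. (w - a) ^ n a) has_field_derivative
         (\<Sum>a\<in>Z. (of_nat (n a) * (z - a) ^ (n a - 1)) * (\<Prod>b\<in>Z - {a}. (z - b) ^ n b))) (at z)"
        by (intro has_field_derivative_prod) (auto intro!: derivative_eq_intros)
      moreover have "(of_nat (n a) * (z - a) ^ (n a - 1)) * (\<Prod>b\<in>Z - {a}. (z - b) ^ n b) =
         (\<Prod>a\<in>Z. (z - a) ^ n a) * (of_nat (n a) * (1 / (z - a)))" if "a \<in> Z" for a
      proof -
        have "(\<Prod>a\<in>Z. (z - a) ^ n a) = (z - a) ^ n a * (\<Prod>b\<in>Z - {a}. (z - b) ^ n b)"
          using fin that by (rule prod.remove)
        moreover have "(z - a) ^ n a = (z - a) ^ (n a - 1) * (z - a)"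
          using g(6) that by (metis Suc_diff_1 power_Suc2)
        ultimately show ?thesis using ne[OF that] by simp
      qed
      ultimately show ?thesis by (simp add: sum_distrib_left)
    qed
    have dh: "(h has_field_derivative deriv h z) (at z)"
      using holomorphic_derivI[OF h(1) open_ball zr(1)] .
    define c where "c = exp (h0 s)"
    have gh: "g w = c * exp (h w)" if "w \<in> ball s r" for w
      using h0(2)[OF that] by (simp add: h_def c_def exp_diff)
    have "((\<lambda>w. (\<Prod>a\<in>Z. (w - a) ^ n a) * (c * exp (h w))) has_field_derivative
        (\<Prod>a\<in>Z. (z - a) ^ n a) * (\<Sum>a\<in>Z. of_nat (n a) * (1 / (z - a))) * (c * exp (h z))
        + (c * (exp (h z) * deriv h z)) * (\<Prod>a\<in>Z. (z - a) ^ n a)) (at z)"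
      by (rule DERIV_mult[OF dP DERIV_cmult[OF DERIV_fun_exp[OF dh]]])
    hence "(f has_field_derivative
        (\<Prod>a\<in>Z. (z - a) ^ n a) * (\<Sum>a\<in>Z. of_nat (n a) * (1 / (z - a))) * (c * exp (h z))
        + (c * (exp (h z) * deriv h z)) * (\<Prod>a\<in>Z. (z - a) ^ n a)) (at z)"
    proof (rule has_field_derivative_transform_within_open[OF _ S(1) z])
      fix w assume w: "w \<in> S"
      hence "w \<in> ball s r" using S(3) by blast
      moreover from this have "w \<in> ball s R" using r by auto
      ultimately show "(\<Prod>a\<in>Z. (w - a) ^ n a) * (c * exp (h w)) = f w" using g(5) gh by simp
    qed
    hence "deriv f z = (\<Prod>a\<in>Z. (z - a) ^ n a) * (\<Sum>a\<in>Z. of_nat (n a) * (1 / (z - a))) * (c * exp (h z))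
        + (c * (exp (h z) * deriv h z)) * (\<Prod>a\<in>Z. (z - a) ^ n a)"
      by (rule DERIV_imp_deriv)
    also have "\<dots> = ((\<Sum>a\<in>Z. of_nat (n a) * (1 / (z - a))) + deriv h z) * f z"
      using g(5) zr gh[OF zr(1)] by (simp add: algebra_simps)
    finally show ?thesis using z S by (auto simp: S_def Z_def)
  qed
  have holS: "(\<lambda>z. of_nat (n a) * (1 / (z - a))) holomorphic_on S" if "a \<in> Z" for a
    using that by (intro holomorphic_intros) (auto simp: S_def)
  have holdh: "deriv h holomorphic_on S"
    using holomorphic_deriv[OF h(1) open_ball] S(3) holomorphic_on_subset by blast
  have "(deriv ^^ (k - 1)) (\<lambda>z. deriv f z / f z) s =
      (deriv ^^ (k - 1)) (\<lambda>z. (\<Sum>a\<in>Z. of_nat (n a) * (1 / (z - a))) + deriv h z) s"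
    using eventually_nhds_in_open[OF S(1,2)]
    by (intro higher_deriv_cong_ev refl) (auto elim!: eventually_mono simp: ld)
  also have "\<dots> = (deriv ^^ (k - 1)) (\<lambda>z. \<Sum>a\<in>Z. of_nat (n a) * (1 / (z - a))) s +
      (deriv ^^ (k - 1)) (deriv h) s"
    by (intro higher_deriv_add[OF _ holdh S(1,2)] holomorphic_on_sum holS)
  also have "(deriv ^^ (k - 1)) (deriv h) s = (deriv ^^ k) h s"
    using k(2) by (metis Suc_diff_1 comp_apply funpow_Suc_right)
  also have "(deriv ^^ (k - 1)) (\<lambda>z. \<Sum>a\<in>Z. of_nat (n a) * (1 / (z - a))) s =
      (\<Sum>a\<in>Z. (deriv ^^ (k - 1)) (\<lambda>z. of_nat (n a) * (1 / (z - a))) s)"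
    by (rule higher_deriv_sum[OF fin holS S(1,2)])
  \<comment> \<open>\<open>k - 1\<close> is odd, hence the minus sign.\<close>
  also have "\<dots> = (\<Sum>a\<in>Z. of_nat (n a) * (- fact (k - 1) / (s - a) ^ k))"
  proof (rule sum.cong[OF refl])
    fix a assume a: "a \<in> Z"
    hence ne: "s \<noteq> a" using S(2) by (auto simp: S_def)
    have "(\<lambda>z. 1 / (z - a)) holomorphic_on S"
      using a by (intro holomorphic_intros) (auto simp: S_def)
    hence "(deriv ^^ (k - 1)) (\<lambda>z. of_nat (n a) * (1 / (z - a))) s =
        of_nat (n a) * (deriv ^^ (k - 1)) (\<lambda>z. 1 / (z - a)) s"
      using S by (intro higher_deriv_cmult) auto
    also have "(deriv ^^ (k - 1)) (\<lambda>z. 1 / (z - a)) s = - fact (k - 1) / (s - a) ^ k"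
      using higher_deriv_inverse_diff[OF ne, of "k - 1"] k by simp
    finally show "(deriv ^^ (k - 1)) (\<lambda>z. of_nat (n a) * (1 / (z - a))) s =
      of_nat (n a) * (- fact (k - 1) / (s - a) ^ k)" .
  qed
  finally have eq: "Re ((deriv ^^ (k - 1)) (\<lambda>z. deriv f z / f z) s) =
     (\<Sum>a\<in>Z. Re (of_nat (n a) * (- fact (k - 1) / (s - a) ^ k))) + Re ((deriv ^^ k) h s)"
    by simp
  have term_eq: "Re (of_nat (n a) * (- fact (k - 1) / (s - a) ^ k)) =
      - (fact (k - 1) * (real (n a) / (x - Re a) ^ k))" if "a \<in> Z" for a
  proof -
    obtain y where y: "a = of_real y" using \<open>a \<in> Z\<close> real by (auto simp: Z_def elim!: Reals_cases)
    have "of_nat (n a) * (- fact (k - 1) / (s - a) ^ k) =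
        complex_of_real (real (n a) * (- fact (k - 1) / (x - y) ^ k))"
      by (simp add: y s_def)
    thus ?thesis by (simp only: Re_complex_of_real) (simp add: y)
  qed
  \<comment> \<open>As \<open>k\<close> is even, a real zero on either side of \<open>x\<close>
    gives a nonpositive term.\<close>
  have neg: "Re (of_nat (n a) * (- fact (k - 1) / (s - a) ^ k)) \<le> 0" if "a \<in> Z" for a
    unfolding term_eq[OF that] using k(1)
    by (simp add: zero_le_even_power zero_le_divide_iff)
  have hb: "Re ((deriv ^^ k) h s) \<le> fact (k - 1) * (4 * real k * A * (2 / r) ^ k)"
    using coeff abs_Re_le_cmod[of "(deriv ^^ k) h s"] k(2)
    by (simp add: fact_reduce[of k] algebra_simps)
  have np: "(\<Sum>a\<in>W. Re (of_nat (n a) * (- fact (k - 1) / (s - a) ^ k))) \<le> 0" if "W \<subseteq> Z" for W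
    by (rule sum_nonpos) (use neg that in blast)
  show "Re ((deriv ^^ (k - 1)) (\<lambda>z. deriv f z / f z) s) \<le> fact (k - 1) * (4 * real k * A * (2 / r) ^ k)"
    unfolding eq using np[OF order_refl] hb by linarith
  fix \<beta> :: real
  assume b: "\<bar>x - \<beta>\<bar> < r" "f (of_real \<beta>) = 0"
  have bZ: "complex_of_real \<beta> \<in> Z"
    using b by (auto simp: Z_def s_def dist_norm simp flip: of_real_diff)
  have "(\<Sum>a\<in>Z. Re (of_nat (n a) * (- fact (k - 1) / (s - a) ^ k))) \<le>
      Re (of_nat (n (of_real \<beta>)) * (- fact (k - 1) / (s - of_real \<beta>) ^ k))"
    unfolding sum.remove[OF fin bZ] using np[of "Z - {of_real \<beta>}"] by (simp only: add_le_same_cancel1) blast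
  also have "\<dots> = - (fact (k - 1) * (real (n (of_real \<beta>)) / (x - \<beta>) ^ k))"
    using term_eq[OF bZ] by simp
  \<comment> \<open>The multiplicity of the zero is at least 1.\<close>
  also have "\<dots> \<le> - (fact (k - 1) * (1 / (x - \<beta>) ^ k))"
    using g(6) bZ k(1) by (auto intro!: mult_left_mono divide_right_mono simp: Suc_le_eq zero_le_even_power)
  finally show "Re ((deriv ^^ (k - 1)) (\<lambda>z. deriv f z / f z) s) \<le>
        fact (k - 1) * (4 * real k * A * (2 / r) ^ k - 1 / (x - \<beta>) ^ k)"
    unfolding eq using hb by (simp add: algebra_simps)
qed

section \<open>The logarithm of a Dirichlet series\<close>

definition dirichlet_sum :: "(nat \<Rightarrow> complex) \<Rightarrow> complex \<Rightarrow> complex" where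
  "dirichlet_sum b s = (\<Sum>n. b (Suc n) / of_nat (Suc n) powr s)"

lemma norm_dirichlet_term: "norm (b (Suc n) / of_nat (Suc n) powr s) = norm (b (Suc n)) * (real n + 1) powr (- Re s)"
proof -
  have "norm (complex_of_real (real n + 1) powr s) = (real n + 1) powr Re s"
    by (subst norm_powr_real_powr) auto
  moreover have "complex_of_real (real n + 1) = of_nat (Suc n)" by simp
  ultimately have "norm (of_nat (Suc n) powr s) = (real n + 1) powr Re s" by metis
  thus ?thesis unfolding norm_divide by (simp add: powr_minus divide_inverse del: of_nat_Suc)
qed

lemma summable_norm_dirichlet:
  assumes "\<And>n. norm (b n) \<le> 1" "Re s > 1"
  shows "summable (\<lambda>n. norm (b (Suc n) / of_nat (Suc n) powr s))"
proof (rule summable_comparison_test')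
  show "summable (\<lambda>n. (real n + 1) powr (- Re s))" using assms(2) by (rule summable_Suc_powr)
  show "norm (norm (b (Suc n) / of_nat (Suc n) powr s)) \<le> (real n + 1) powr (- Re s)" for n
    using mult_right_mono[OF assms(1)[of "Suc n"], of "(real n + 1) powr (- Re s)"]
    by (simp only: real_norm_def abs_norm_cancel norm_dirichlet_term) simp
qed

lemma dirichlet_sums:
  assumes "\<And>n. norm (b n) \<le> 1" "Re s > 1"
  shows "(\<lambda>n. b (Suc n) / of_nat (Suc n) powr s) sums dirichlet_sum b s"
  unfolding dirichlet_sum_def by (rule summable_sums[OF summable_norm_cancel[OF summable_norm_dirichlet[OF assms]]])

lemma uniform_limit_dirichlet_sum:
  assumes "\<And>n. norm (b n) \<le> 1" "\<sigma> > 1"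
  shows "uniform_limit {s. Re s > \<sigma>} (\<lambda>N s. \<Sum>n<N. b (Suc n) / of_nat (Suc n) powr s) (dirichlet_sum b) sequentially"
  unfolding dirichlet_sum_def
proof (rule Weierstrass_m_test)
  show "summable (\<lambda>n. (real n + 1) powr (- \<sigma>))" using assms(2) by (rule summable_Suc_powr)
  show "norm (b (Suc n) / of_nat (Suc n) powr s) \<le> (real n + 1) powr (- \<sigma>)" if "s \<in> {s. Re s > \<sigma>}" for n s
  proof -
    have "norm (b (Suc n)) * (real n + 1) powr (- Re s) \<le> 1 * (real n + 1) powr (- \<sigma>)"
      using that assms(1) by (intro mult_mono powr_mono) auto
    thus ?thesis by (simp add: norm_dirichlet_term del: of_nat_Suc)
  qed
qed

lemma higher_deriv_dirichlet_term:
  fixes c :: complex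
  assumes "m > 0"
  shows "(deriv ^^ k) (\<lambda>s. c / of_nat m powr s) = (\<lambda>s. c * (- of_real (ln (real m))) ^ k / of_nat m powr s)"
proof (induction k)
  case (Suc k)
  have "deriv (\<lambda>s. c * (- of_real (ln (real m))) ^ k / of_nat m powr s) z =
      c * (- of_real (ln (real m))) ^ Suc k / of_nat m powr z" for z
  proof (rule DERIV_imp_deriv)
    have "((\<lambda>s. of_nat m powr s) has_field_derivative of_real (ln (real m)) * of_nat m powr z) (at z)"
      using has_field_derivative_powr_right[of "of_nat m" z] assms by (simp add: Ln_of_nat)
    thus "((\<lambda>s. c * (- of_real (ln (real m))) ^ k / of_nat m powr s) has_field_derivative
        c * (- of_real (ln (real m))) ^ Suc k / of_nat m powr z) (at z)"
      using assms by (auto intro!: derivative_eq_intros simp: field_simps)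
  qed
  thus ?case using Suc by auto
qed auto

lemma holomorphic_dirichlet_term: "m > 0 \<Longrightarrow> (\<lambda>s. c / of_nat m powr s) holomorphic_on A"
  by (intro holomorphic_intros) auto

lemma higher_deriv_dirichlet_sum:
  assumes b: "\<And>n. norm (b n) \<le> 1" and s: "Re s > 1"
  shows "(\<lambda>n. b (Suc n) * (- of_real (ln (real (Suc n)))) ^ k / of_nat (Suc n) powr s) sums
           (deriv ^^ k) (dirichlet_sum b) s"
proof -
  define \<sigma> where "\<sigma> = (1 + Re s) / 2"
  have sig: "\<sigma> > 1" "Re s > \<sigma>" using s by (auto simp: \<sigma>_def)
  have op: "open {s. Re s > \<sigma>}" by (rule open_halfspace_Re_gt)
  have "(\<lambda>N. (deriv ^^ k) (\<lambda>s. \<Sum>n<N. b (Suc n) / of_nat (Suc n) powr s) s) \<longlonglongrightarrow> (deriv ^^ k) (dirichlet_sum b) s"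
  proof (rule higher_deriv_complex_uniform_limit[OF uniform_limit_dirichlet_sum[OF b sig(1)]])
    show "\<forall>\<^sub>F N in sequentially. (\<lambda>s. \<Sum>n<N. b (Suc n) / of_nat (Suc n) powr s) holomorphic_on {s. Re s > \<sigma>}"
      by (intro always_eventually allI holomorphic_on_sum holomorphic_dirichlet_term) auto
  qed (use op sig in auto)
  moreover have "(deriv ^^ k) (\<lambda>s. \<Sum>n<N. b (Suc n) / of_nat (Suc n) powr s) s =
      (\<Sum>n<N. b (Suc n) * (- of_real (ln (real (Suc n)))) ^ k / of_nat (Suc n) powr s)" for N
  proof -
    have "(deriv ^^ k) (\<lambda>s. \<Sum>n<N. b (Suc n) / of_nat (Suc n) powr s) s =
        (\<Sum>n<N. (deriv ^^ k) (\<lambda>s. b (Suc n) / of_nat (Suc n) powr s) s)"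
      by (rule higher_deriv_sum[OF _ _ open_UNIV]) (auto intro!: holomorphic_dirichlet_term simp del: of_nat_Suc)
    thus ?thesis by (simp add: higher_deriv_dirichlet_term del: of_nat_Suc)
  qed
  ultimately show ?thesis by (simp add: sums_def)
qed

lemma holomorphic_dirichlet_sum:
  assumes b: "\<And>n. norm (b n) \<le> 1"
  shows "dirichlet_sum b holomorphic_on {s. Re s > 1}"
proof (rule holomorphic_uniform_sequence)
  show "open {s. Re s > 1}" by (rule open_halfspace_Re_gt)
  show "(\<lambda>s. \<Sum>n<N. b (Suc n) / of_nat (Suc n) powr s) holomorphic_on {s. Re s > 1}" for N
    by (intro holomorphic_on_sum holomorphic_dirichlet_term) auto
  fix s :: complex assume "s \<in> {s. Re s > 1}"
  hence s: "Re s > 1" by simp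
  define \<sigma> where "\<sigma> = (1 + Re s) / 2"
  have sig: "\<sigma> > 1" "Re s > \<sigma>" using s by (auto simp: \<sigma>_def)
  have "open {s. Re s > \<sigma>}" by (rule open_halfspace_Re_gt)
  then obtain d where d: "d > 0" "cball s d \<subseteq> {s. Re s > \<sigma>}"
    using sig(2) by (auto simp: open_contains_cball)
  show "\<exists>d>0. cball s d \<subseteq> {s. Re s > 1} \<and> uniform_limit (cball s d)
     (\<lambda>N s. \<Sum>n<N. b (Suc n) / of_nat (Suc n) powr s) (dirichlet_sum b) sequentially"
  proof (intro exI[of _ d] conjI)
    show "uniform_limit (cball s d)
     (\<lambda>N s. \<Sum>n<N. b (Suc n) / of_nat (Suc n) powr s) (dirichlet_sum b) sequentially"
      using uniform_limit_on_subset[OF uniform_limit_dirichlet_sum[OF b sig(1)] d(2)] .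
  qed (use d sig in auto)
qed

text \<open>Serves to fix the multiplicative constant that a comparison of logarithmic derivatives
  leaves open.\<close>

lemma dirichlet_sum_at_infinity:
  assumes b: "\<And>n. norm (b n) \<le> 1"
  shows "((\<lambda>x. dirichlet_sum b (of_real x)) \<longlongrightarrow> b 1) at_top"
proof -
  define Z where "Z = (\<Sum>n. (real n + 2) powr (-2))"
  have sZ: "summable (\<lambda>n. (real n + 2) powr (-2))"
    using summable_Suc_iff[of "\<lambda>n. (real n + 1) powr (-2)"] summable_Suc_powr[of 2] by (simp add: add_ac)
  have "((\<lambda>x. dirichlet_sum b (of_real x) - b 1) \<longlongrightarrow> 0) at_top"
  proof (rule Lim_null_comparison)
    show "\<forall>\<^sub>F x in at_top. norm (dirichlet_sum b (of_real x) - b 1) \<le> 2 powr (2 - x) * Z"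
      using eventually_ge_at_top[of 2]
    proof eventually_elim
      case (elim x)
      let ?t = "\<lambda>n. b (Suc n) / of_nat (Suc n) powr complex_of_real x"
      have sx: "summable (\<lambda>n. norm (?t n))" using elim by (intro summable_norm_dirichlet b) auto
      have "dirichlet_sum b (of_real x) = (\<Sum>n. ?t (Suc n)) + ?t 0"
        unfolding dirichlet_sum_def using suminf_split_head[OF summable_norm_cancel[OF sx]] by simp
      hence "dirichlet_sum b (of_real x) - b 1 = (\<Sum>n. ?t (Suc n))" by simp
      also have "norm \<dots> \<le> (\<Sum>n. 2 powr (2 - x) * (real n + 2) powr (-2))"
      proof (rule norm_suminf_le)
        show "summable (\<lambda>n. 2 powr (2 - x) * (real n + 2) powr (-2))" by (intro summable_mult sZ)
        fix n
        have "norm (?t (Suc n)) \<le> (real (Suc n) + 1) powr (- x)"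
          using mult_right_mono[OF b[of "Suc (Suc n)"], of "(real (Suc n) + 1) powr (- x)"]
            norm_dirichlet_term[of b "Suc n" "of_real x"] by (simp del: of_nat_Suc)
        \<comment> \<open>Two powers are kept for convergence; the others are largest at n = 0
          because 2 - x \<le> 0.\<close>
        also have "\<dots> = (real n + 2) powr (2 - x) * (real n + 2) powr (-2)"
          by (simp flip: powr_add add: add_ac)
        also have "\<dots> \<le> 2 powr (2 - x) * (real n + 2) powr (-2)"
          using elim by (intro mult_right_mono powr_mono2') auto
        finally show "norm (?t (Suc n)) \<le> 2 powr (2 - x) * (real n + 2) powr (-2)" .
      qed
      also have "\<dots> = 2 powr (2 - x) * Z" unfolding Z_def by (rule suminf_mult[OF sZ])
      finally show ?case .
    qed
    show "((\<lambda>x. 2 powr (2 - x) * Z) \<longlongrightarrow> 0) at_top" by real_asymp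
  qed
  thus ?thesis by (simp add: LIM_zero_iff)
qed

text \<open>The value at \<open>n = 1\<close> is \<open>0 / 0 = 0\<close>, as it should be.\<close>

definition log_coeff :: "(nat \<Rightarrow> complex) \<Rightarrow> nat \<Rightarrow> complex" where
  "log_coeff \<psi> n = of_real (mangoldt n / ln (real n)) * \<psi> n"

text \<open>Because \<open>mangoldt n\<close> is at most ln n, the logarithm is itself a
  \<open>dirichlet_sum\<close> to which all the lemmas above apply.\<close>

lemma norm_log_coeff_le:
  assumes "\<And>n. norm (\<psi> n) \<le> 1"
  shows "norm (log_coeff \<psi> n) \<le> 1"
proof -
  have "mangoldt n / ln (real n) \<le> 1" "0 \<le> mangoldt n / ln (real n)"
  proof -
    consider "n = 0" | "n = 1" | "n \<ge> 2" by linarith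
    hence "mangoldt n / ln (real n) \<le> 1 \<and> 0 \<le> mangoldt n / ln (real n)"
    proof cases
      case 3
      thus ?thesis using mangoldt_le[of n] mangoldt_nonneg[of n] by (auto simp: divide_le_eq)
    qed auto
    thus "mangoldt n / ln (real n) \<le> 1" "0 \<le> mangoldt n / ln (real n)" by auto
  qed
  hence "\<bar>mangoldt n / ln (real n)\<bar> * norm (\<psi> n) \<le> 1 * 1"
    using assms by (intro mult_mono) auto
  thus ?thesis by (simp add: log_coeff_def norm_mult del: of_real_divide)
qed

lemma log_coeff_mult_ln: "log_coeff \<psi> n * of_real (ln (real n)) = mangoldt n * \<psi> n"
proof -
  consider "n = 0" | "n = 1" | "n \<ge> 2" by linarith
  thus ?thesis
    by cases (auto simp: log_coeff_def)
qed

lemma has_sum_shift_Suc: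
  "(f has_sum S) {0<..} \<longleftrightarrow> ((\<lambda>n. f (Suc n)) has_sum S) (UNIV :: nat set)"
  by (rule has_sum_reindex_bij_witness[where i = Suc and j = "\<lambda>n. n - 1"]) auto

text \<open>Absolute summability permits regrouping the pairs (a, b) by their product.\<close>

lemma has_sum_convolution:
  fixes f g :: "nat \<Rightarrow> complex"
  assumes f: "(f has_sum F) {0<..}" "(\<lambda>n. norm (f n)) summable_on {0<..}"
    and g: "(g has_sum G) {0<..}" "(\<lambda>n. norm (g n)) summable_on {0<..}"
  shows "((\<lambda>n. \<Sum>d | d dvd n. f (n div d) * g d) has_sum F * G) {0<..}"
proof -
  have "(\<lambda>x. norm (case x of (a, b) \<Rightarrow> f a * g b)) summable_on {0<..} \<times> {0<..}"
  proof (rule summable_on_SigmaI)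
    show "((\<lambda>b. norm (case (a, b) of (a, b) \<Rightarrow> f a * g b)) has_sum norm (f a) * (\<Sum>\<^sub>\<infinity>b\<in>{0<..}. norm (g b))) {0<..}" for a
      using has_sum_cmult_right[OF has_sum_infsum[OF g(2)], of "norm (f a)"] by (simp add: norm_mult)
    show "(\<lambda>a. norm (f a) * (\<Sum>\<^sub>\<infinity>b\<in>{0<..}. norm (g b))) summable_on {0<..}"
      by (intro summable_on_cmult_left f)
  qed auto
  hence sm: "(\<lambda>(a, b). f a * g b) summable_on {0<..} \<times> {0<..}"
    by (rule abs_summable_summable)
  have "((\<lambda>(a, b). f a * g b) has_sum F * G) ({0<..} \<times> {0<..})"
  proof (rule has_sum_SigmaI)
    show "((\<lambda>b. case (a, b) of (a, b) \<Rightarrow> f a * g b) has_sum f a * G) {0<..}" for a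
      using has_sum_cmult_right[OF g(1), of "f a"] by simp
    show "((\<lambda>a. f a * G) has_sum F * G) {0<..}"
      using has_sum_cmult_left[OF f(1)] .
  qed (use sm in auto)
  also have "?this \<longleftrightarrow> ((\<lambda>(n, d). f (n div d) * g d) has_sum F * G) (SIGMA n:{0<..}. {d. d dvd n})"
    by (rule has_sum_reindex_bij_witness[where i = "\<lambda>(n, d). (n div d, d)" and j = "\<lambda>(a, b). (a * b, b)"])
       (auto elim!: dvdE intro: Nat.gr0I)
  finally have *: "((\<lambda>(n, d). f (n div d) * g d) has_sum F * G) (SIGMA n:{0<..}. {d. d dvd n})" .
  show ?thesis
  proof (rule has_sum_SigmaD[OF *])
    fix n :: nat assume "n \<in> {0<..}"
    hence "finite {d. d dvd n}" by simp
    thus "((\<lambda>d. case (n, d) of (n, d) \<Rightarrow> f (n div d) * g d) has_sum (\<Sum>d | d dvd n. f (n div d) * g d)) {d. d dvd n}"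
      using has_sum_finite by fastforce
  qed
qed

text \<open>An Euler product is avoided. Write D and H for the two sums. That
  \<open>mangoldt\<close> convolved with 1 is ln gives D H' = D' for completely multiplicative
  \<open>\<psi>\<close>; so D exp(-H) is constant, and its limit at infinity is 1.\<close>

lemma dirichlet_sum_eq_exp:
  assumes one: "\<psi> 1 = 1" and mult: "\<And>m n. \<psi> (m * n) = \<psi> m * \<psi> n" and le: "\<And>n. norm (\<psi> n) \<le> 1"
    and s: "Re s > 1"
  shows "dirichlet_sum \<psi> s = exp (dirichlet_sum (log_coeff \<psi>) s)"
proof -
  let ?D = "dirichlet_sum \<psi>" and ?H = "dirichlet_sum (log_coeff \<psi>)"
  note hle = norm_log_coeff_le[of \<psi>, OF le]
  have op: "open {s. Re s > 1}" by (rule open_halfspace_Re_gt)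
  have dD: "(?D has_field_derivative deriv ?D z) (at z)" "(?H has_field_derivative deriv ?H z) (at z)"
    if "Re z > 1" for z
    using that holomorphic_derivI[OF holomorphic_dirichlet_sum[of \<psi>, OF le] op]
      holomorphic_derivI[OF holomorphic_dirichlet_sum[of "log_coeff \<psi>", OF hle] op] by auto
  have key: "?D z * deriv ?H z = deriv ?D z" if z: "Re z > 1" for z
  proof -
    define f where "f = (\<lambda>n. \<psi> n / of_nat n powr z)"
    define g where "g = (\<lambda>n. - (mangoldt n * \<psi> n) / of_nat n powr z)"
    have "summable (\<lambda>n. norm (f (Suc n)))"
      unfolding f_def by (rule summable_norm_dirichlet[of \<psi>, OF le z])
    hence f: "((\<lambda>n. f (Suc n)) has_sum ?D z) UNIV" "(\<lambda>n. norm (f (Suc n))) summable_on UNIV"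
      using dirichlet_sums[of \<psi>, OF le z] norm_summable_imp_has_sum
      by (auto simp: f_def summable_on_UNIV_nonneg_real_iff simp del: of_nat_Suc)
    have geq: "log_coeff \<psi> (Suc n) * (- of_real (ln (real (Suc n)))) ^ 1 / of_nat (Suc n) powr z = g (Suc n)" for n
      using log_coeff_mult_ln[of \<psi> "Suc n"] by (simp add: g_def del: of_nat_Suc)
    have gs: "(\<lambda>n. g (Suc n)) sums deriv ?H z"
      using higher_deriv_dirichlet_sum[of "log_coeff \<psi>", OF hle z, of 1] unfolding geq by simp
    \<comment> \<open>Absolute convergence is reduced to the derivative formula: with the
      coefficients |log_coeff| at the real point Re z, the differentiated series has the terms
      -|g|.\<close>
    have "summable (\<lambda>n. norm (g (Suc n)))"
    proof -
      have le': "norm (of_real (norm (log_coeff \<psi> n)) :: complex) \<le> 1" for n using hle by simp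
      have "(\<lambda>n. of_real (norm (log_coeff \<psi> (Suc n))) * (- of_real (ln (real (Suc n)))) ^ 1 / of_nat (Suc n) powr of_real (Re z)) sums
          (deriv ^^ 1) (dirichlet_sum (\<lambda>n. of_real (norm (log_coeff \<psi> n)))) (of_real (Re z))"
        using z by (intro higher_deriv_dirichlet_sum le') simp
      hence "summable (\<lambda>n. Re (of_real (norm (log_coeff \<psi> (Suc n))) * (- of_real (ln (real (Suc n)))) ^ 1 / of_nat (Suc n) powr of_real (Re z)))"
        by (intro summable_Re) (auto simp: summable_def)
      also have "(\<lambda>n. Re (of_real (norm (log_coeff \<psi> (Suc n))) * (- of_real (ln (real (Suc n)))) ^ 1 / of_nat (Suc n) powr of_real (Re z)))
          = (\<lambda>n. - norm (g (Suc n)))"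
      proof
        fix n
        have "complex_of_real (real (Suc n)) powr of_real (Re z) = of_real (real (Suc n) powr Re z)"
          by (rule powr_of_real) auto
        hence "(of_nat (Suc n) :: complex) powr of_real (Re z) = of_real (real (Suc n) powr Re z)" by simp
        hence "of_real (norm (log_coeff \<psi> (Suc n))) * (- of_real (ln (real (Suc n)))) ^ 1 / of_nat (Suc n) powr of_real (Re z)
          = complex_of_real (- (norm (log_coeff \<psi> (Suc n)) * ln (real (Suc n))) / real (Suc n) powr Re z)"
          by (simp del: of_nat_Suc)
        moreover have "norm (g (Suc n)) = norm (log_coeff \<psi> (Suc n)) * ln (real (Suc n)) * (real n + 1) powr (- Re z)"
          using norm_dirichlet_term[of "\<lambda>m. mangoldt m * \<psi> m" n z]
          by (simp add: g_def log_coeff_mult_ln[symmetric] norm_mult del: of_nat_Suc)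
        ultimately show "Re (of_real (norm (log_coeff \<psi> (Suc n))) * (- of_real (ln (real (Suc n)))) ^ 1 / of_nat (Suc n) powr of_real (Re z))
           = - norm (g (Suc n))" by (simp only: Re_complex_of_real) (simp add: powr_minus divide_inverse add.commute)
      qed
      finally show ?thesis using summable_minus_iff by blast
    qed
    hence g: "((\<lambda>n. g (Suc n)) has_sum deriv ?H z) UNIV" "(\<lambda>n. norm (g (Suc n))) summable_on UNIV"
      using gs norm_summable_imp_has_sum
      by (auto simp: summable_on_UNIV_nonneg_real_iff)
    have sh: "(\<lambda>n. norm (h (Suc n))) summable_on UNIV \<Longrightarrow> (\<lambda>n. norm (h n)) summable_on {0<..}" for h :: "nat \<Rightarrow> complex"
      unfolding summable_on_def has_sum_shift_Suc .
    have "((\<lambda>n. \<Sum>d | d dvd n. f (n div d) * g d) has_sum ?D z * deriv ?H z) {0<..}"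
      using f g by (intro has_sum_convolution sh) (auto simp: has_sum_shift_Suc)
    also have "?this \<longleftrightarrow> ((\<lambda>n. \<psi> n * (- of_real (ln (real n))) ^ 1 / of_nat n powr z) has_sum ?D z * deriv ?H z) {0<..}"
    proof (rule has_sum_cong)
      fix n :: nat assume "n \<in> {0<..}"
      hence n: "n > 0" by simp
      have "f (n div d) * g d = (- \<psi> n / of_nat n powr z) * mangoldt d" if dvd: "d dvd n" for d
      proof -
        obtain e where e: "n = d * e" using dvd by blast
        have pos: "d > 0" "e > 0" using n e by auto
        have "(of_nat n :: complex) powr z = of_nat d powr z * of_nat e powr z"
          using powr_times_real[of "of_nat d" "of_nat e" z] pos by (simp add: e)
        thus ?thesis using pos by (simp add: f_def g_def e mult mult_ac)
      qed
      hence "(\<Sum>d | d dvd n. f (n div d) * g d) = (\<Sum>d | d dvd n. (- \<psi> n / of_nat n powr z) * mangoldt d)"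
        by (intro sum.cong) auto
      also have "\<dots> = (- \<psi> n / of_nat n powr z) * of_real (ln (real n))"
        using n by (simp only: sum_distrib_left[symmetric]) (simp add: mangoldt_sum)
      finally show "(\<Sum>d | d dvd n. f (n div d) * g d) = \<psi> n * (- of_real (ln (real n))) ^ 1 / of_nat n powr z"
        by simp
    qed
    finally have "(\<lambda>n. \<psi> (Suc n) * (- of_real (ln (real (Suc n)))) ^ 1 / of_nat (Suc n) powr z) sums (?D z * deriv ?H z)"
      unfolding has_sum_shift_Suc by (rule has_sum_imp_sums)
    moreover have "(\<lambda>n. \<psi> (Suc n) * (- of_real (ln (real (Suc n)))) ^ 1 / of_nat (Suc n) powr z) sums deriv ?D z"
      using higher_deriv_dirichlet_sum[of \<psi>, OF le z, of 1] by simp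
    ultimately show ?thesis by (rule sums_unique2)
  qed
  have "\<exists>c. \<forall>z\<in>{s. Re s > 1}. ?D z * exp (- ?H z) = c"
  proof (rule has_field_derivative_zero_constant)
    show "convex {s. Re s > 1}" by (rule convex_halfspace_Re_gt)
    fix z assume "z \<in> {s. Re s > 1}"
    hence z: "Re z > 1" by simp
    have "((\<lambda>z. ?D z * exp (- ?H z)) has_field_derivative
      deriv ?D z * exp (- ?H z) + exp (- ?H z) * (- deriv ?H z) * ?D z) (at z)"
      by (rule DERIV_mult[OF dD(1)[OF z] DERIV_fun_exp[OF DERIV_minus[OF dD(2)[OF z]]]])
    moreover have "deriv ?D z * exp (- ?H z) + exp (- ?H z) * (- deriv ?H z) * ?D z = 0"
      unfolding key[OF z, symmetric] by (simp add: algebra_simps)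
    ultimately show "((\<lambda>z. ?D z * exp (- ?H z)) has_field_derivative 0) (at z within {s. Re s > 1})"
      by (metis has_field_derivative_at_within)
  qed
  then obtain c where c: "\<And>z. Re z > 1 \<Longrightarrow> ?D z * exp (- ?H z) = c" by auto
  have "((\<lambda>x. ?D (of_real x) * exp (- ?H (of_real x))) \<longlongrightarrow> \<psi> 1 * exp (- log_coeff \<psi> 1)) at_top"
    by (intro tendsto_intros dirichlet_sum_at_infinity le hle)
  moreover have "((\<lambda>x. ?D (of_real x) * exp (- ?H (of_real x))) \<longlongrightarrow> c) at_top"
    by (rule tendsto_eventually, rule eventually_mono[OF eventually_gt_at_top[of 1]]) (simp add: c)
  ultimately have "\<psi> 1 * exp (- log_coeff \<psi> 1) = c"
    by (rule tendsto_unique[rotated]) simp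
  hence "c = 1" using one by (simp add: log_coeff_def)
  hence "?D s * exp (- ?H s) = 1" using c[OF s] by simp
  thus ?thesis by (simp add: exp_minus field_simps)
qed

section \<open>Dirichlet characters\<close>

lemma character_pos: "dirichlet_character q chi \<Longrightarrow> q > 0"
  by (simp add: dirichlet_character_def)

lemma character_mult: "dirichlet_character q chi \<Longrightarrow> chi (a * b) = chi a * chi b"
  by (simp add: dirichlet_character_def)

lemma character_nonzero_iff: "dirichlet_character q chi \<Longrightarrow> chi a \<noteq> 0 \<longleftrightarrow> coprime a (int q)"
  by (simp add: dirichlet_character_def)

lemma character_one: 
  assumes "dirichlet_character q chi"
  shows "chi 1 = 1"
proof -
  have "chi (1 * 1) = chi 1 * chi 1" by (rule character_mult[OF assms])
  moreover have "chi 1 \<noteq> 0" by (simp add: character_nonzero_iff[OF assms])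
  ultimately show ?thesis by simp
qed

lemma character_power: 
  assumes "dirichlet_character q chi"
  shows "chi (a ^ k) = chi a ^ k"
  by (induction k) (simp_all add: character_one[OF assms] character_mult[OF assms])

lemma character_cong:
  assumes "dirichlet_character q chi" "[a = b] (mod int q)"
  shows "chi a = chi b"
proof -
  obtain k where "b = a + int q * k" using assms(2) by (auto simp: cong_iff_lin)
  thus ?thesis using periodic_int_mult[OF assms(1)] by simp
qed

lemma character_power_totient:
  assumes chi: "dirichlet_character q chi" and a: "coprime a (int q)"
  shows "chi a ^ totient q = 1"
proof -
  define b where "b = nat (a mod int q)"
  have q: "q > 0" using chi by (rule character_pos)
  have ib: "int b = a mod int q" using q by (simp add: b_def)
  have "coprime (int b) (int q)" using a unfolding ib by (simp add: coprime_mod_left_iff q)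
  hence "[b ^ totient q = 1] (mod q)" by (intro euler_theorem) simp
  hence "[int (b ^ totient q) = int 1] (mod int q)" by (simp only: cong_int_iff)
  hence "chi (int b ^ totient q) = chi 1" by (intro character_cong[OF chi]) simp
  hence "chi (int b) ^ totient q = 1" by (simp add: character_power[OF chi] character_one[OF chi])
  moreover have "chi (int b) = chi a"
    by (rule character_cong[OF chi]) (simp add: ib cong_def)
  ultimately show ?thesis by simp
qed

lemma norm_character_eq_1:
  assumes chi: "dirichlet_character q chi" "coprime a (int q)"
  shows "norm (chi a) = 1"
proof -
  have "norm (chi a) ^ totient q = 1"
    using arg_cong[OF character_power_totient[OF chi], of norm] by (simp add: norm_power)
  thus ?thesis
    using power_eq_iff_eq_base[of "totient q" "norm (chi a)" 1] character_pos[OF chi(1)] by simp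
qed

lemma norm_character_le:
  assumes chi: "dirichlet_character q chi"
  shows "norm (chi a) \<le> 1"
proof (cases "coprime a (int q)")
  case True
  thus ?thesis using norm_character_eq_1[OF chi] by simp
qed (use character_nonzero_iff[OF chi, of a] in auto)

text \<open>Off the units both functions vanish; \<open>k > 0\<close> excludes 0^0 = 1.\<close>

lemma power_eq_principal_iff:
  assumes chi: "dirichlet_character q chi" and k: "k > 0"
  shows "(\<lambda>a. chi a ^ k) = principal_character q \<longleftrightarrow> (\<forall>a. coprime a (int q) \<longrightarrow> chi a ^ k = 1)"
  using character_nonzero_iff[OF chi] k by (auto simp: principal_character_def fun_eq_iff)

lemma character_order_dvd_iff:
  assumes chi: "dirichlet_character q chi" and m: "m > 0"
  shows "character_order q chi dvd m \<longleftrightarrow> (\<forall>a. coprime a (int q) \<longrightarrow> chi a ^ m = 1)"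
proof -
  define P where "P = (\<lambda>k. k > 0 \<and> (\<lambda>a. chi a ^ k) = principal_character q)"
  have P: "P k \<longleftrightarrow> k > 0 \<and> (\<forall>a. coprime a (int q) \<longrightarrow> chi a ^ k = 1)" for k
    using power_eq_principal_iff[OF chi] by (auto simp: P_def)
  define r where "r = character_order q chi"
  have r: "r = (LEAST k. P k)" by (simp add: r_def character_order_def P_def)
  \<comment> \<open>Euler's theorem supplies a positive exponent, so the \<open>LEAST\<close> in the
    definition of the order is attained.\<close>
  have "P (totient q)"
    unfolding P using character_power_totient[OF chi] character_pos[OF chi] by simp
  hence Pr: "P r" unfolding r by (rule LeastI)
  have "r dvd m" if *: "\<forall>a. coprime a (int q) \<longrightarrow> chi a ^ m = 1"
  proof (rule ccontr)
    assume "\<not> r dvd m"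
    hence pos: "m mod r > 0" by (auto simp: dvd_eq_mod_eq_0)
    have "chi a ^ (m mod r) = 1" if a: "coprime a (int q)" for a
    proof -
      have "chi a ^ m = chi a ^ (r * (m div r) + m mod r)" by simp
      also have "\<dots> = (chi a ^ r) ^ (m div r) * chi a ^ (m mod r)"
        by (simp only: power_add power_mult)
      also have "\<dots> = chi a ^ (m mod r)" using Pr a by (simp add: P)
      finally show ?thesis using * a by simp
    qed
    hence "P (m mod r)" using pos by (simp add: P)
    moreover have "m mod r < r" using Pr by (simp add: P)
    ultimately show False unfolding r using not_less_Least by blast
  qed
  moreover have "chi a ^ m = 1" if "r dvd m" "coprime a (int q)" for a
    using that Pr by (auto simp: P power_mult elim!: dvdE)
  ultimately show ?thesis by (auto simp: r_def)
qed

text \<open>Add to \<open>a\<close> the product of \<open>d\<close> with all primes that divide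
  \<open>Q\<close> but not \<open>a\<close>. Every prime divisor of \<open>Q\<close> then divides
  exactly one of the two summands: if it divides \<open>a\<close>, it divides neither
  \<open>d\<close> nor the product.\<close>

lemma coprime_lift:
  fixes a d Q :: int
  assumes "coprime a d" "Q > 0"
  obtains b where "[b = a] (mod d)" "coprime b Q"
proof
  define T where "T = {p. prime p \<and> p dvd Q \<and> \<not> p dvd a}"
  have fin: "finite T"
    by (rule finite_subset[of _ "{p. prime p \<and> p dvd Q}"]) (use assms(2) in \<open>auto simp: T_def intro!: finite_prime_divisors\<close>)
  define b where "b = a + d * \<Prod>T"
  show "[b = a] (mod d)" by (simp add: b_def cong_def)
  show "coprime b Q"
  proof (rule ccontr)
    assume "\<not> coprime b Q"
    hence "\<not> is_unit (gcd b Q)" by (simp add: coprime_iff_gcd_eq_1)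
    moreover have "gcd b Q \<noteq> 0" using assms(2) by simp
    ultimately obtain p where "prime p" "p dvd gcd b Q" using prime_divisor_exists by blast
    hence p: "prime p" "p dvd b" "p dvd Q" by auto
    show False
    proof (cases "p dvd a")
      case True
      hence "p dvd d * \<Prod>T" using p(2) by (simp add: b_def dvd_add_right_iff)
      hence "p dvd d \<or> p dvd \<Prod>T" using p(1) prime_dvd_mult_iff by blast
      thus False
      proof
        assume "p dvd d"
        thus False using assms(1) True p(1) by (meson coprime_common_divisor not_prime_unit)
      next
        assume "p dvd \<Prod>T"
        then obtain t where "t \<in> T" "p dvd t" using fin p(1) by (auto simp: prime_dvd_prod_iff)
        hence "p = t" using p(1) by (auto simp: T_def intro: primes_dvd_imp_eq)
        thus False using \<open>t \<in> T\<close> True by (simp add: T_def)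
      qed
    next
      case False
      hence "p \<in> T" using p by (simp add: T_def)
      hence "p dvd d * \<Prod>T" using dvd_prodI[OF fin, of p "\<lambda>x. x"] by simp
      hence "p dvd a" using p(2) by (simp add: b_def dvd_add_left_iff)
      thus False using False by simp
    qed
  qed
qed

text \<open>Take the least modulus of a character inducing \<open>psi\<close>. Whatever induces
  \<open>nu\<close> also induces \<open>psi\<close>, so minimality makes \<open>nu\<close>
  primitive.\<close>

lemma inducing_primitive_character:
  assumes psi: "dirichlet_character Q psi"
  obtains d nu where "d dvd Q" "primitive_character d nu" "\<And>a. coprime a (int Q) \<Longrightarrow> psi a = nu a"
proof -
  define P where "P = (\<lambda>d. d dvd Q \<and> (\<exists>nu. dirichlet_character d nu \<and> (\<forall>a. coprime a (int Q) \<longrightarrow> psi a = nu a)))"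
  have "P Q" using psi by (auto simp: P_def)
  define d where "d = (LEAST d. P d)"
  have "P d" unfolding d_def using \<open>P Q\<close> by (rule LeastI)
  then obtain nu where d: "d dvd Q" and nu: "dirichlet_character d nu"
     "\<And>a. coprime a (int Q) \<Longrightarrow> psi a = nu a"
    unfolding P_def by blast
  have "e = d" if e: "e dvd d" "dirichlet_character e xi" "\<forall>a. coprime a (int d) \<longrightarrow> nu a = xi a" for e xi
  proof -
    have "psi a = xi a" if "coprime a (int Q)" for a
    proof -
      have "coprime a (int d)" using that d coprime_divisors[of a a "int d" "int Q"] by simp
      thus ?thesis using e(3) nu(2)[OF that] by simp
    qed
    moreover have "e dvd Q" using e(1) d by (rule dvd_trans)
    ultimately have "P e" using e(2) unfolding P_def by blast
    hence "d \<le> e" unfolding d_def by (rule Least_le)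
    moreover have "e \<le> d" using e(1) character_pos[OF nu(1)] by (rule dvd_imp_le)
    ultimately show ?thesis by simp
  qed
  hence "primitive_character d nu"
    using nu(1) unfolding primitive_character_def by blast
  thus ?thesis using that d nu(2) by blast
qed

text \<open>Both characters are induced from the gcd of the moduli, so primitivity forces each
  modulus to equal it. This is used to see that a product of two characters is nontrivial.\<close>

lemma primitive_eq_if_agree:
  assumes p1: "primitive_character q1 chi1" and p2: "primitive_character q2 chi2"
    and agree: "\<And>a. coprime a (int q1) \<Longrightarrow> coprime a (int q2) \<Longrightarrow> chi1 a = chi2 a"
  shows "q1 = q2 \<and> chi1 = chi2"
proof -
  note d1 = p1[unfolded primitive_character_def, THEN conjunct1]
  note d2 = p2[unfolded primitive_character_def, THEN conjunct1]
  have pos: "q1 > 0" "q2 > 0" using character_pos d1 d2 by auto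
  define g where "g = gcd q1 q2"
  have gd: "g dvd q1" "g dvd q2" "int g = gcd (int q1) (int q2)" by (auto simp: g_def)
  have g0: "g > 0" using pos by (simp add: g_def)
  have well: "chi1 x = chi1 y"
    if xy: "[x = y] (mod int g)" "coprime x (int q1)" "coprime y (int q1)" "coprime y (int q2)" for x y
  proof -
    obtain t where t: "y = x + int g * t" using xy(1) by (auto simp: cong_iff_lin)
    obtain u v where uv: "u * int q1 + v * int q2 = int g"
      using bezout_int[of "int q1" "int q2"] gd(3) by auto
    \<comment> \<open>By the Chinese remainder theorem for congruent residues, \<open>b\<close>
      agrees with \<open>x\<close> modulo \<open>q1\<close> and with \<open>y\<close> modulo
      \<open>q2\<close>; there the two characters can be exchanged.\<close>
    define b where "b = x + int q1 * (u * t)"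
    have b1: "[b = x] (mod int q1)" by (simp add: b_def cong_def)
    have "y = b + int q2 * (v * t)" by (simp add: b_def t uv[symmetric] algebra_simps)
    hence b2: "[b = y] (mod int q2)" by (simp add: cong_def)
    have cb: "coprime b (int q1)" "coprime b (int q2)"
      using b1 b2 xy cong_imp_coprime cong_sym by blast+
    have "chi1 x = chi1 b" using character_cong[OF d1 b1] by simp
    also have "\<dots> = chi2 b" by (rule agree[OF cb])
    also have "\<dots> = chi2 y" by (rule character_cong[OF d2 b2])
    also have "\<dots> = chi1 y" using agree xy by simp
    finally show ?thesis .
  qed
  have "\<exists>b. [b = a] (mod int g) \<and> coprime b (int q1) \<and> coprime b (int q2)" if a: "coprime a (int g)" for a
  proof -
    obtain b where "[b = a] (mod int g)" "coprime b (int q1 * int q2)"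
      using coprime_lift[of a "int g" "int q1 * int q2"] a pos by auto
    thus ?thesis by auto
  qed
  then obtain L where L: "\<And>a. coprime a (int g) \<Longrightarrow> [L a = a] (mod int g) \<and> coprime (L a) (int q1) \<and> coprime (L a) (int q2)"
    by metis
  \<comment> \<open>The value is read off at a lift coprime to both moduli; \<open>well\<close>
    makes it independent of the lift.\<close>
  define psi where "psi = (\<lambda>a. if coprime a (int g) then chi1 (L a) else 0)"
  have psi_eq: "psi a = chi1 b" if "[b = a] (mod int g)" "coprime b (int q1)" for a b
  proof -
    have "coprime b (int g)" using that gd(1) coprime_divisors[of b b "int g" "int q1"] by simp
    hence a: "coprime a (int g)" using that(1) cong_imp_coprime by blast
    have "[b = L a] (mod int g)" using that(1) L[OF a] cong_trans cong_sym by blast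
    hence "chi1 b = chi1 (L a)" using L[OF a] that by (intro well) auto
    thus ?thesis using a by (simp add: psi_def)
  qed
  have psi: "dirichlet_character g psi"
    unfolding dirichlet_character_def
  proof (intro conjI allI)
    show "g > 0" by fact
    show "psi (a + int g) = psi a" for a
    proof (cases "coprime a (int g)")
      case True
      have "[L a = a + int g] (mod int g)" using L[OF True] by (simp add: cong_def)
      thus ?thesis using psi_eq[of "L a"] L[OF True] by metis
    next
      case False
      moreover have "\<not> coprime (a + int g) (int g)" using False by (simp add: coprime_iff_gcd_eq_1)
      ultimately show ?thesis by (simp add: psi_def)
    qed
    show "psi (a * b) = psi a * psi b" for a b
    proof (cases "coprime a (int g) \<and> coprime b (int g)")
      case True
      have "[L a * L b = a * b] (mod int g)" using L True by (intro cong_mult) auto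
      moreover have "coprime (L a * L b) (int q1)" using L True by simp
      ultimately have "psi (a * b) = chi1 (L a * L b)" by (rule psi_eq)
      thus ?thesis using True by (simp add: character_mult[OF d1] psi_def)
    qed (auto simp: psi_def)
    show "psi a \<noteq> 0 \<longleftrightarrow> coprime a (int g)" for a
      using L[of a] character_nonzero_iff[OF d1, of "L a"] by (auto simp: psi_def)
  qed
  have a1: "chi1 a = psi a" if "coprime a (int q1)" for a
    using psi_eq[of a a] that by simp
  have a2: "chi2 a = psi a" if c: "coprime a (int q2)" for a
  proof -
    \<comment> \<open>\<open>a\<close> may share primes with \<open>q1\<close>, so
      \<open>agree\<close> applies only after a lift.\<close>
    obtain b where b: "[b = a] (mod int q2)" "coprime b (int q1 * int q2)"
      using coprime_lift[of a "int q2" "int q1 * int q2"] c pos by auto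
    have "[b = a] (mod int g)" using b(1) gd(2) by (meson cong_dvd_modulus of_nat_dvd_iff)
    hence "psi a = chi1 b" using b(2) by (intro psi_eq) auto
    also have "\<dots> = chi2 b" using b(2) by (intro agree) auto
    also have "\<dots> = chi2 a" by (rule character_cong[OF d2 b(1)])
    finally show ?thesis by simp
  qed
  have "g = q1" using p1 psi gd(1) a1 unfolding primitive_character_def by blast
  moreover have "g = q2" using p2 psi gd(2) a2 unfolding primitive_character_def by blast
  ultimately have eq: "q1 = q2" by simp
  have "chi1 a = chi2 a" for a
    using agree[of a] character_nonzero_iff[OF d1, of a] character_nonzero_iff[OF d2, of a] eq by metis
  thus ?thesis using eq by auto
qed

lemma dirichlet_character_times:
  assumes "dirichlet_character q1 chi1" "dirichlet_character q2 chi2"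
  shows "dirichlet_character (q1 * q2) (\<lambda>a. chi1 a * chi2 a)"
proof -
  have "chi1 (a + int (q1 * q2)) = chi1 a" for a
    using character_cong[OF assms(1), of "a + int (q1 * q2)" a] by (simp add: cong_def)
  moreover have "chi2 (a + int (q1 * q2)) = chi2 a" for a
    using character_cong[OF assms(2), of "a + int (q1 * q2)" a] by (simp add: cong_def)
  ultimately show ?thesis using assms by (auto simp: dirichlet_character_def)
qed

lemma dirichlet_character_cnj: "dirichlet_character q chi \<Longrightarrow> dirichlet_character q (cnj \<circ> chi)"
  by (simp add: dirichlet_character_def)

lemma primitive_character_cnj:
  assumes "primitive_character q chi"
  shows "primitive_character q (cnj \<circ> chi)"
  unfolding primitive_character_def
proof (intro conjI allI impI)
  note chi = assms[unfolded primitive_character_def]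
  show "dirichlet_character q (cnj \<circ> chi)" using chi dirichlet_character_cnj by blast
  fix d psi assume *: "d dvd q \<and> dirichlet_character d psi \<and> (\<forall>a. coprime a (int q) \<longrightarrow> (cnj \<circ> chi) a = psi a)"
  have "chi a = (cnj \<circ> psi) a" if "coprime a (int q)" for a
  proof -
    have "cnj (chi a) = psi a" using * that by simp
    hence "cnj (cnj (chi a)) = cnj (psi a)" by (rule arg_cong)
    thus ?thesis by simp
  qed
  thus "d = q" using chi * dirichlet_character_cnj[of d psi] by blast
qed

lemma trivial_character: "dirichlet_character 1 (\<lambda>_. 1)"
  by (simp add: dirichlet_character_def)

lemma primitive_trivial: "primitive_character 1 (\<lambda>_. 1)"
  using trivial_character by (simp add: primitive_character_def)

lemma primitive_modulus_1: 
  assumes "primitive_character 1 chi"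
  shows "chi = (\<lambda>_. 1)"
  using primitive_eq_if_agree[OF assms primitive_trivial] character_cong[of 1 chi _ 1]
    character_one[of 1 chi] assms
  by (auto simp: primitive_character_def)

lemma primitive_nontrivial:
  assumes "primitive_character q chi" "q \<noteq> 1"
  obtains a where "coprime a (int q)" "chi a \<noteq> 1"
proof (rule ccontr)
  assume "\<not> thesis"
  hence "\<forall>a. coprime a (int q) \<longrightarrow> chi a = (\<lambda>_. 1) a" using that by blast
  hence "1 dvd q \<and> dirichlet_character 1 (\<lambda>_. 1) \<and> (\<forall>a. coprime a (int q) \<longrightarrow> chi a = (\<lambda>_. 1) a)"
    using trivial_character by simp
  hence "1 = q" using assms(1)[unfolded primitive_character_def, THEN conjunct2] by blast
  thus False using assms(2) by simp
qed

text \<open>Multiplication by the unit \<open>a\<close> permutes the residues, so the sum equals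
  \<open>chi a\<close> times itself.\<close>

lemma sum_character_eq_0:
  assumes chi: "dirichlet_character q chi" and a: "coprime a (int q)" "chi a \<noteq> 1"
  shows "(\<Sum>n<q. chi (int n)) = 0"
proof -
  have q: "q > 0" using chi by (rule character_pos)
  define h where "h = (\<lambda>n. nat ((a * int n) mod int q))"
  have hint: "int (h n) = (a * int n) mod int q" for n using q by (simp add: h_def)
  have inj: "inj_on h {..<q}"
  proof
    fix x y assume xy: "x \<in> {..<q}" "y \<in> {..<q}" "h x = h y"
    hence "[a * int x = a * int y] (mod int q)" using hint by (metis cong_def)
    hence "[int x = int y] (mod int q)" using a(1) by (simp add: cong_mult_lcancel)
    thus "x = y" using xy by (simp add: cong_int_iff cong_def)
  qed
  have "h ` {..<q} \<subseteq> {..<q}"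
  proof
    fix y assume "y \<in> h ` {..<q}"
    then obtain x where "y = h x" by blast
    hence "int y < int q" using hint[of x] q by simp
    thus "y \<in> {..<q}" by simp
  qed
  hence "h ` {..<q} = {..<q}" using inj by (simp add: endo_inj_surj)
  hence "(\<Sum>n<q. chi (int n)) = (\<Sum>n<q. chi (int (h n)))"
    using sum.reindex[OF inj, of "\<lambda>n. chi (int n)"] by simp
  also have "\<dots> = (\<Sum>n<q. chi a * chi (int n))"
  proof (rule sum.cong[OF refl])
    fix n
    have "chi (int (h n)) = chi (a * int n)" by (rule character_cong[OF chi]) (simp add: hint cong_def)
    thus "chi (int (h n)) = chi a * chi (int n)" by (simp add: character_mult[OF chi])
  qed
  also have "\<dots> = chi a * (\<Sum>n<q. chi (int n))" by (simp add: sum_distrib_left)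
  finally show ?thesis using a(2) by simp
qed

lemma sum_character_Suc:
  assumes chi: "dirichlet_character q chi"
  shows "(\<Sum>n<q. chi (int (Suc n))) = (\<Sum>n<q. chi (int n))"
proof -
  have "(\<Sum>n<Suc q. chi (int n)) = chi 0 + (\<Sum>n<q. chi (int (Suc n)))"
    by (subst sum.lessThan_Suc_shift) simp
  moreover have "chi (int q) = chi 0" by (rule character_cong[OF chi]) (simp add: cong_def)
  ultimately show ?thesis by simp
qed

lemma equiv_conj_rel: "equiv (primitive_characters m) (conj_rel m)"
proof (rule equivI)
  show "conj_rel m \<subseteq> primitive_characters m \<times> primitive_characters m" by (auto simp: conj_rel_def)
  show "refl_on (primitive_characters m) (conj_rel m)" by (auto simp: refl_on_def conj_rel_def)
  show "sym (conj_rel m)"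
    by (auto simp: sym_def conj_rel_def o_def fun_eq_iff)
  show "trans (conj_rel m)"
    by (auto simp: trans_def conj_rel_def o_def fun_eq_iff)
qed

section \<open>Continuation and growth of \<open>L\<close>-functions\<close>

text \<open>Mean zero over a period is what sets the nontrivial characters apart: the continuation
  by parts applies and leaves no pole.\<close>

lemma nontrivial_L:
  assumes prim: "primitive_character q chi" and q: "q \<noteq> 1"
  shows "dirichlet_L chi holomorphic_on UNIV"
    and "\<And>s. Re s > 1 \<Longrightarrow> dirichlet_L chi s = dirichlet_sum (\<lambda>n. chi (int n)) s"
    and "\<And>s. Re s \<ge> 1/2 \<Longrightarrow> norm (dirichlet_L chi s) \<le> q * (1 + 2 * norm s * (\<Sum>n. (real n + 1) powr (-(3/2))))"
proof -
  have chi: "dirichlet_character q chi" using prim by (simp add: primitive_character_def)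
  define a where "a = (\<lambda>n. chi (int (Suc n)))"
  obtain c where c: "coprime c (int q)" "chi c \<noteq> 1" using primitive_nontrivial[OF prim q] .
  have mz: "mean_zero q a"
    unfolding mean_zero_def
  proof (intro conjI allI)
    show "q > 0" by (rule character_pos[OF chi])
    show "a (n + q) = a n" for n
    proof -
      have "chi (int (Suc n) + int q) = chi (int (Suc n))"
        using chi unfolding dirichlet_character_def by blast
      moreover have "int (Suc (n + q)) = int (Suc n) + int q" by simp
      ultimately show ?thesis unfolding a_def by metis
    qed
    show "sum a {..<q} = 0"
      unfolding a_def sum_character_Suc[OF chi] by (rule sum_character_eq_0[OF chi c])
  qed
  have le: "norm (a n) \<le> 1" for n unfolding a_def by (rule norm_character_le[OF chi])
  obtain F where F: "F holomorphic_on UNIV" "\<And>s. Re s > 1 \<Longrightarrow> F s = diff_series 0 a s"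
    using diff_series_entire_continuation[OF mz] by blast
  have L: "dirichlet_L chi = F"
  proof (rule dirichlet_L_eqI)
    show "F nicely_meromorphic_on UNIV"
      using F(1) by (intro analytic_on_imp_nicely_meromorphic_on) (simp add: analytic_on_open)
    show "(\<lambda>n. chi (int (Suc n)) / of_nat (Suc n) powr s) sums F s" if "Re s > 1" for s
      using sums_diff_series_0[of a 1 s, OF le that] F(2)[OF that] by (simp add: a_def)
  qed
  show "dirichlet_L chi holomorphic_on UNIV" using L F(1) by simp
  show "dirichlet_L chi s = dirichlet_sum (\<lambda>n. chi (int n)) s" if "Re s > 1" for s
    using L F(2)[OF that] by (simp add: diff_series_0_eq dirichlet_sum_def a_def)
  show "norm (dirichlet_L chi s) \<le> q * (1 + 2 * norm s * (\<Sum>n. (real n + 1) powr (-(3/2))))"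
    if "Re s \<ge> 1/2" for s
    unfolding L by (rule continuation_bound[OF mz le F that])
qed

lemma has_sum_dirichlet:
  assumes "\<And>n. norm (b n) \<le> 1" "Re s > 1"
  shows "((\<lambda>n. b n / of_nat n powr s) has_sum dirichlet_sum b s) {0<..}"
  unfolding has_sum_shift_Suc
  by (rule norm_summable_imp_has_sum[OF summable_norm_dirichlet[OF assms] dirichlet_sums[OF assms]])

text \<open>
  The instance \<open>c = b p\<close> removes an Euler factor; \<open>c = 2\<close> with constant \<open>b\<close> gives the alternating zeta
  function.
\<close>

lemma dirichlet_sum_multiples:
  fixes b b' :: "nat \<Rightarrow> complex"
  assumes b: "\<And>n. norm (b n) \<le> 1" and b': "\<And>n. norm (b' n) \<le> 1" and s: "Re s > 1" and p: "p > 0"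
    and mult: "\<And>n. n > 0 \<Longrightarrow> b (p * n) - b' (p * n) = c * b n"
    and eq: "\<And>n. \<not> p dvd n \<Longrightarrow> b' n = b n"
  shows "dirichlet_sum b' s = (1 - c / of_nat p powr s) * dirichlet_sum b s"
proof -
  have "((\<lambda>n. c / of_nat p powr s * (b n / of_nat n powr s)) has_sum
      (c / of_nat p powr s * dirichlet_sum b s)) {0<..}"
    by (rule has_sum_cmult_right[OF has_sum_dirichlet[of b, OF b s]])
  also have "?this \<longleftrightarrow> ((\<lambda>n. (b n - b' n) / of_nat n powr s) has_sum (c / of_nat p powr s * dirichlet_sum b s))
      {n\<in>{0<..}. p dvd n}"
  proof (rule has_sum_reindex_bij_witness[where i = "\<lambda>n. n div p" and j = "\<lambda>n. p * n"])
    fix n :: nat assume n: "n \<in> {0<..}"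
    have "(of_nat (p * n) :: complex) powr s = of_nat p powr s * of_nat n powr s"
      using powr_times_real[of "of_nat p" "of_nat n" s] p n by simp
    thus "(b (p * n) - b' (p * n)) / of_nat (p * n) powr s = c / of_nat p powr s * (b n / of_nat n powr s)"
      using mult[of n] n by simp
  qed (use p in \<open>auto elim!: dvdE intro: Nat.gr0I\<close>)
  also have "\<dots> \<longleftrightarrow> ((\<lambda>n. (b n - b' n) / of_nat n powr s) has_sum (c / of_nat p powr s * dirichlet_sum b s)) {0<..}"
    by (rule has_sum_cong_neutral) (auto simp: eq)
  finally have 1: "((\<lambda>n. (b n - b' n) / of_nat n powr s) has_sum (c / of_nat p powr s * dirichlet_sum b s)) {0<..}" .
  have "((\<lambda>n. b n / of_nat n powr s - b' n / of_nat n powr s) has_sum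
      (dirichlet_sum b s - dirichlet_sum b' s)) {0<..}"
    using has_sum_add[OF has_sum_dirichlet[of b, OF b s] has_sum_uminusI[OF has_sum_dirichlet[of b', OF b' s]]] by simp
  hence "((\<lambda>n. (b n - b' n) / of_nat n powr s) has_sum (dirichlet_sum b s - dirichlet_sum b' s)) {0<..}"
    by (simp add: diff_divide_distrib)
  with 1 have "c / of_nat p powr s * dirichlet_sum b s = dirichlet_sum b s - dirichlet_sum b' s"
    by (rule has_sum_unique)
  thus ?thesis by (simp add: algebra_simps)
qed

lemma sieved_dirichlet_sum:
  fixes b :: "nat \<Rightarrow> complex"
  assumes b: "\<And>n. norm (b n) \<le> 1" and mult: "\<And>m n. b (m * n) = b m * b n" and s: "Re s > 1"
    and P: "finite P" "\<And>p. p \<in> P \<Longrightarrow> prime p"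
  shows "dirichlet_sum (\<lambda>n. if \<exists>p\<in>P. p dvd n then 0 else b n) s =
    dirichlet_sum b s * (\<Prod>p\<in>P. 1 - b p / of_nat p powr s)"
  using P
proof (induction P rule: finite_induct)
  case (insert p P)
  define f where "f = (\<lambda>P n. if \<exists>p\<in>P. p dvd n then 0 else b n)"
  have p: "prime p" using insert.prems by auto
  \<comment> \<open>Multiplication by the new prime \<open>p\<close> does not affect divisibility by
    the others, so the already sieved coefficients are still multiplicative at
    \<open>p\<close>.\<close>
  have nd: "(\<exists>r\<in>P. r dvd p * n) \<longleftrightarrow> (\<exists>r\<in>P. r dvd n)" for n
    using insert.prems insert.hyps(2) p
    by (metis insertCI prime_dvd_mult_iff primes_dvd_imp_eq dvd_mult)
  have "dirichlet_sum (f (insert p P)) s = (1 - b p / of_nat p powr s) * dirichlet_sum (f P) s"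
  proof (rule dirichlet_sum_multiples[OF _ _ s])
    show "f P (p * n) - f (insert p P) (p * n) = b p * f P n" for n
      by (auto simp: f_def nd mult)
  qed (use b p in \<open>auto simp: f_def prime_gt_0_nat\<close>)
  moreover have "dirichlet_sum (f P) s = dirichlet_sum b s * (\<Prod>p\<in>P. 1 - b p / of_nat p powr s)"
    unfolding f_def using insert.prems by (intro insert.IH) auto
  ultimately show ?case using insert.hyps by (simp add: f_def)
qed auto

section \<open>The zeta function near its pole\<close>

lemma mean_zero_alternating: "mean_zero 2 (\<lambda>n. (-1) ^ n)"
  by (simp add: mean_zero_def numeral_2_eq_2)

text \<open>Excludes from the unit disk about 1 all zeros 1 + 2 pi i n / ln 2 of 1 - 2^(1-s) except
  1 itself.\<close>

lemma exp_eq_1_small: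
  fixes z :: complex
  assumes "norm z < 1" "exp z = 1"
  shows "z = 0"
proof -
  from assms(2) obtain n :: int where n: "Re z = 0" "Im z = of_int (2 * n) * pi"
    by (auto simp: exp_eq_1)
  have "\<bar>Im z\<bar> < 1" using assms(1) abs_Im_le_cmod[of z] by linarith
  hence "2 * \<bar>real_of_int n\<bar> * pi < 1" unfolding n(2) by (simp add: abs_mult)
  moreover have "2 * \<bar>real_of_int n\<bar> * pi \<ge> 2 * \<bar>real_of_int n\<bar> * 1"
    using pi_ge_two by (intro mult_left_mono) auto
  ultimately have "n = 0" by linarith
  thus ?thesis using n by (simp add: complex_eq_iff)
qed

text \<open>The alternating zeta function E = (1 - 2^(1-s)) zeta(s) has coefficients of mean zero
  and is therefore entire. In the disk, u = 1 - 2^(1-s) has just a simple zero at 1; with v = u / (s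
  - 1), the quotient E / v is (s - 1) zeta(s).\<close>

lemma zeta_L:
  obtains F where "F holomorphic_on ball 1 1"
    "\<And>s. s \<in> ball 1 1 \<Longrightarrow> s \<noteq> 1 \<Longrightarrow> F s = (s - 1) * dirichlet_L (\<lambda>_. 1) s"
    "\<And>s. Re s > 1 \<Longrightarrow> dirichlet_L (\<lambda>_. 1) s = dirichlet_sum (\<lambda>_. 1) s"
proof -
  define e :: "nat \<Rightarrow> complex" where "e = (\<lambda>n. (-1) ^ n)"
  obtain E where E: "E holomorphic_on UNIV" "\<And>s. Re s > 1 \<Longrightarrow> E s = diff_series 0 e s"
    using diff_series_entire_continuation[OF mean_zero_alternating] unfolding e_def by blast
  define u :: "complex \<Rightarrow> complex" where "u = (\<lambda>s. 1 - exp (- ((s - 1) * of_real (ln 2))))"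
  have powr2: "(2::complex) powr s = exp (s * of_real (ln 2))" for s
    using Ln_of_nat[of 2] by (simp add: powr_def)
  have sums_eq: "E s = u s * dirichlet_sum (\<lambda>_. 1) s" if s: "Re s > 1" for s
  proof -
    define e' :: "nat \<Rightarrow> complex" where "e' = (\<lambda>n. if even n then -1 else 1)"
    have "E s = dirichlet_sum e' s"
      unfolding E(2)[OF s] diff_series_0_eq dirichlet_sum_def
      by (intro arg_cong[of _ _ suminf] ext) (auto simp: e_def e'_def)
    also have "\<dots> = (1 - 2 / of_nat 2 powr s) * dirichlet_sum (\<lambda>_. 1) s"
      by (rule dirichlet_sum_multiples[OF _ _ s]) (auto simp: e'_def)
    also have "1 - 2 / of_nat 2 powr s = u s"
    proof -
      have "exp (complex_of_real (ln 2)) = 2" unfolding exp_of_real by simp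
      hence "exp (- ((s - 1) * of_real (ln 2))) = 2 / exp (s * of_real (ln 2))"
        by (simp add: algebra_simps exp_diff)
      thus ?thesis by (simp add: u_def powr2)
    qed
    finally show ?thesis .
  qed
  have uhol: "u holomorphic_on A" for A unfolding u_def by (intro holomorphic_intros)
  have u_nz: "u s \<noteq> 0" if "Re s > 1" for s
  proof
    assume "u s = 0"
    hence "norm (exp (- ((s - 1) * of_real (ln 2)))) = norm (1::complex)" by (simp add: u_def)
    hence "(Re s - 1) * ln 2 = 0" by simp
    thus False using that by simp
  qed
  have u_nz': "u s \<noteq> 0" if "s \<in> ball 1 1" "s \<noteq> 1" for s
  proof
    assume "u s = 0"
    moreover have "norm (- ((s - 1) * complex_of_real (ln 2))) < 1"
    proof -
      have "norm (s - 1) * ln 2 \<le> norm (s - 1) * 1"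
        using ln_le_minus_one[of 2] by (intro mult_left_mono) auto
      thus ?thesis using that(1) by (simp add: norm_mult dist_norm norm_minus_commute)
    qed
    ultimately have "- ((s - 1) * complex_of_real (ln 2)) = 0"
      by (intro exp_eq_1_small) (auto simp: u_def)
    thus False using that(2) by simp
  qed
  define f where "f = (\<lambda>s. E s / u s)"
  have mero: "f meromorphic_on UNIV"
    unfolding f_def
    by (intro meromorphic_on_divide analytic_on_imp_meromorphic_on)
       (use E(1) uhol in \<open>auto simp: analytic_on_open\<close>)
  have rs: "remove_sings f s = f s" if "u s \<noteq> 0" for s
  proof (rule remove_sings_at_analytic)
    have "E analytic_on {s}" "u analytic_on {s}"
      using E(1) uhol[of UNIV] analytic_on_subset[of _ UNIV "{s}"] by (auto simp: analytic_on_open)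
    thus "f analytic_on {s}" unfolding f_def using that by (intro analytic_intros) auto
  qed
  \<comment> \<open>\<open>dirichlet_L\<close> must be continuous off its poles and 0 at them;
    \<open>remove_sings\<close> arranges this at the zeros of \<open>u\<close>.\<close>
  have L: "dirichlet_L (\<lambda>_. 1) = remove_sings f"
  proof (rule dirichlet_L_eqI)
    show "remove_sings f nicely_meromorphic_on UNIV" by (rule remove_sings_nicely_meromorphic[OF mero])
    fix s :: complex assume s: "Re s > 1"
    have "remove_sings f s = dirichlet_sum (\<lambda>_. 1) s"
      using rs[OF u_nz[OF s]] sums_eq[OF s] u_nz[OF s] by (simp add: f_def)
    thus "(\<lambda>n. 1 / of_nat (Suc n) powr s) sums remove_sings f s"
      using dirichlet_sums[of "\<lambda>_. 1" s] s by simp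
  qed
  define v where "v = (\<lambda>z. if z = 1 then deriv u 1 else (u z - u 1) / (z - 1))"
  have u1: "u 1 = 0" by (simp add: u_def)
  have vhol: "v holomorphic_on ball 1 1" unfolding v_def by (rule pole_lemma_open[OF uhol open_ball])
  have "(u has_field_derivative of_real (ln 2)) (at 1)"
    unfolding u_def by (auto intro!: derivative_eq_intros)
  hence "v 1 \<noteq> 0" by (simp add: v_def DERIV_imp_deriv)
  hence v_nz: "v s \<noteq> 0" if "s \<in> ball 1 1" for s
    using u_nz'[OF that] u1 by (cases "s = 1") (auto simp: v_def)
  show ?thesis
  proof
    show "(\<lambda>s. E s / v s) holomorphic_on ball 1 1"
      by (intro holomorphic_on_divide vhol v_nz holomorphic_on_subset[OF E(1)]) auto
    show "E s / v s = (s - 1) * dirichlet_L (\<lambda>_. 1) s" if "s \<in> ball 1 1" "s \<noteq> 1" for s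
      using that rs[OF u_nz'[OF that]] by (simp add: L f_def v_def u1)
    show "dirichlet_L (\<lambda>_. 1) s = dirichlet_sum (\<lambda>_. 1) s" if "Re s > 1" for s
      using rs[OF u_nz[OF that]] sums_eq[OF that] u_nz[OF that] by (simp add: L f_def)
  qed
qed

text \<open>The factor \<open>s - 1\<close> removes the pole of the zeta function, the case \<open>d = 1\<close>.\<close>

lemma primitive_L_regularized:
  obtains C :: real where "C \<ge> 1" "\<And>d nu. primitive_character d nu \<Longrightarrow> \<exists>F. F holomorphic_on ball 1 1 \<and>
    (\<forall>s\<in>cball 1 (1/2). norm (F s) \<le> C * d) \<and>
    (\<forall>s\<in>ball 1 1. s \<noteq> 1 \<longrightarrow> F s = (if d = 1 then s - 1 else 1) * dirichlet_L nu s) \<and>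
    (\<forall>s\<in>ball 1 1. Re s > 1 \<longrightarrow> F s = (if d = 1 then s - 1 else 1) * dirichlet_sum (\<lambda>n. nu (int n)) s)"
proof -
  obtain F0 where F0: "F0 holomorphic_on ball 1 1"
    "\<And>s. s \<in> ball 1 1 \<Longrightarrow> s \<noteq> 1 \<Longrightarrow> F0 s = (s - 1) * dirichlet_L (\<lambda>_. 1) s"
    "\<And>s. Re s > 1 \<Longrightarrow> dirichlet_L (\<lambda>_. 1) s = dirichlet_sum (\<lambda>_. 1) s"
    using zeta_L by blast
  have "compact (F0 ` cball 1 (1/2))"
    by (intro compact_continuous_image holomorphic_on_imp_continuous_on holomorphic_on_subset[OF F0(1)]) auto
  then obtain B where B: "\<And>s. s \<in> cball 1 (1/2) \<Longrightarrow> norm (F0 s) \<le> B"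
    using compact_imp_bounded bounded_iff by (metis image_eqI)
  define Z where "Z = (\<Sum>n. (real n + 1) powr (-(3/2)))"
  have Z: "Z \<ge> 0" unfolding Z_def by (intro suminf_nonneg summable_Suc_powr) auto
  \<comment> \<open>|B| bounds the zeta function without its pole; 4 Z is the 2 |s| Z of the
    nontrivial characters, as |s| \<le> 2.\<close>
  define C where "C = 1 + \<bar>B\<bar> + 4 * Z"
  show ?thesis
  proof (rule that[of C])
    show "C \<ge> 1" using Z by (simp add: C_def)
    fix d nu assume nu: "primitive_character d nu"
    show "\<exists>F. F holomorphic_on ball 1 1 \<and>
    (\<forall>s\<in>cball 1 (1/2). norm (F s) \<le> C * d) \<and>
    (\<forall>s\<in>ball 1 1. s \<noteq> 1 \<longrightarrow> F s = (if d = 1 then s - 1 else 1) * dirichlet_L nu s) \<and>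
    (\<forall>s\<in>ball 1 1. Re s > 1 \<longrightarrow> F s = (if d = 1 then s - 1 else 1) * dirichlet_sum (\<lambda>n. nu (int n)) s)"
    proof (cases "d = 1")
      case True
      hence nu1: "nu = (\<lambda>_. 1)" using nu primitive_modulus_1 by simp
      have "norm (F0 s) \<le> C * d" if "s \<in> cball 1 (1/2)" for s
        using B[OF that] Z True by (simp add: C_def)
      moreover have "F0 s = (s - 1) * dirichlet_sum (\<lambda>n. 1) s" if "s \<in> ball 1 1" "Re s > 1" for s
      proof -
        have "s \<noteq> 1" using that(2) by auto
        thus ?thesis using F0(2)[OF that(1)] F0(3)[OF that(2)] by simp
      qed
      ultimately show ?thesis using F0(1,2) True by (intro exI[of _ F0]) (simp add: nu1)
    next
      case False
      note L = nontrivial_L[OF nu False]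
      have "norm (dirichlet_L nu s) \<le> C * d" if s: "s \<in> cball 1 (1/2)" for s
      proof -
        have "\<bar>Re (1 - s)\<bar> \<le> 1/2" using s abs_Re_le_cmod[of "1 - s"] by (simp add: dist_norm)
        hence "Re (1 - s) \<le> 1/2" by linarith
        hence re: "Re s \<ge> 1/2" by simp
        have ns: "norm s \<le> 2" using s norm_triangle_ineq4[of 1 "1 - s"] by (simp add: dist_norm)
        have "norm (dirichlet_L nu s) \<le> d * (1 + 2 * norm s * Z)" using L(3)[OF re] by (simp add: Z_def)
        also have "\<dots> \<le> d * (1 + 2 * 2 * Z)"
          using ns Z by (intro mult_left_mono add_left_mono mult_right_mono) auto
        also have "\<dots> \<le> d * C" by (intro mult_left_mono) (auto simp: C_def)
        finally show ?thesis by (simp add: mult.commute)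
      qed
      thus ?thesis using L(1,2) False
        by (intro exI[of _ "dirichlet_L nu"]) (auto intro: holomorphic_on_subset)
    qed
  qed
qed

text \<open>
  Here \<open>Q\<close> is a multiple of the conductor \<open>d\<close>, and \<open>F\<close> is the \<open>L\<close>-function of the character modulo \<open>Q\<close>
  induced by \<open>nu\<close>, without its pole.
\<close>

definition regularized_L_bound :: "real \<Rightarrow> nat \<Rightarrow> nat \<Rightarrow> (int \<Rightarrow> complex) \<Rightarrow> bool" where
  "regularized_L_bound C Q d nu \<longleftrightarrow> (\<exists>F. F holomorphic_on ball 1 1 \<and>
    (\<forall>s\<in>cball 1 (1/2). norm (F s) \<le> C * (real Q)\<^sup>2) \<and>
    (\<forall>s\<in>ball 1 1. s \<noteq> 1 \<longrightarrow> (F s = 0 \<longleftrightarrow> dirichlet_L nu s = 0)) \<and>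
    (\<forall>s\<in>ball 1 1. Re s > 1 \<longrightarrow> F s = (if d = 1 then s - 1 else 1) *
       exp (dirichlet_sum (log_coeff (\<lambda>n. if coprime n Q then nu (int n) else 0)) s)))"

text \<open>Passing from conductor \<open>d\<close> to modulus \<open>Q\<close> multiplies by the
  finite product \<open>E\<close> over the primes of \<open>Q\<close>. In the disk Re s > 0, so its
  factors are nonzero and at most 2 in modulus; hence the zeros are unchanged and
  \<open>C * d\<close> grows at most to C Q^2.\<close>

lemma regularized_L_bound_exists:
  obtains C where "C \<ge> 1"
    "\<And>d nu Q. primitive_character d nu \<Longrightarrow> d dvd Q \<Longrightarrow> Q > 0 \<Longrightarrow> regularized_L_bound C Q d nu"
proof -
  obtain C :: real where C: "C \<ge> 1" "\<And>d nu. primitive_character d nu \<Longrightarrow> \<exists>F. F holomorphic_on ball 1 1 \<and>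
    (\<forall>s\<in>cball 1 (1/2). norm (F s) \<le> C * d) \<and>
    (\<forall>s\<in>ball 1 1. s \<noteq> 1 \<longrightarrow> F s = (if d = 1 then s - 1 else 1) * dirichlet_L nu s) \<and>
    (\<forall>s\<in>ball 1 1. Re s > 1 \<longrightarrow> F s = (if d = 1 then s - 1 else 1) * dirichlet_sum (\<lambda>n. nu (int n)) s)"
    by (rule primitive_L_regularized) (rule that; assumption)
  show ?thesis
  proof (rule that[of C, OF C(1)])
    fix d nu Q assume nu: "primitive_character d nu" and dQ: "d dvd Q" and Q: "Q > 0"
    have dc: "dirichlet_character d nu" using nu by (simp add: primitive_character_def)
    obtain F where F: "F holomorphic_on ball 1 1"
      "\<forall>s\<in>cball 1 (1/2). norm (F s) \<le> C * d"
      "\<forall>s\<in>ball 1 1. s \<noteq> 1 \<longrightarrow> F s = (if d = 1 then s - 1 else 1) * dirichlet_L nu s"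
      "\<forall>s\<in>ball 1 1. Re s > 1 \<longrightarrow> F s = (if d = 1 then s - 1 else 1) * dirichlet_sum (\<lambda>n. nu (int n)) s"
      using C(2)[OF nu] by blast
    define P where "P = prime_factors Q"
    define b where "b = (\<lambda>n. nu (int n))"
    define E where "E = (\<lambda>s. \<Prod>p\<in>P. 1 - b p / of_nat p powr s)"
    have P: "finite P" "\<And>p. p \<in> P \<Longrightarrow> prime p" by (auto simp: P_def)
    have b: "norm (b n) \<le> 1" for n unfolding b_def by (rule norm_character_le[OF dc])
    have small: "norm (b p / of_nat p powr s) < 1" if "prime p" "s \<in> ball 1 1" for p s
    proof -
      have "\<bar>Re (1 - s)\<bar> < 1" using that(2) abs_Re_le_cmod[of "1 - s"] by (simp add: dist_norm)
      hence "Re (1 - s) < 1" by linarith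
      hence re: "Re s > 0" by simp
      have p: "real p > 1" using that(1) prime_gt_1_nat by simp
      have "norm ((of_nat p :: complex) powr s) = real p powr Re s"
        using p by (subst norm_powr_real_powr) auto
      moreover have "real p powr Re s > 1" using p re by simp
      ultimately show ?thesis using b[of p] by (simp add: norm_divide divide_less_eq)
    qed
    have E_nz: "E s \<noteq> 0" if "s \<in> ball 1 1" for s
    proof
      assume "E s = 0"
      then obtain p where p: "p \<in> P" "1 = b p / of_nat p powr s"
        using P(1) by (auto simp: E_def)
      hence "norm (1::complex) < 1" using small[OF P(2)[OF p(1)] that] by metis
      thus False by simp
    qed
    have E_le: "norm (E s) \<le> Q" if "s \<in> ball 1 1" for s
    proof -
      have "norm (E s) \<le> (\<Prod>p\<in>P. 2)"
        unfolding E_def prod_norm[symmetric]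
      proof (intro prod_mono conjI norm_ge_zero)
        fix p assume "p \<in> P"
        thus "norm (1 - b p / of_nat p powr s) \<le> 2"
          using norm_triangle_ineq4[of 1 "b p / of_nat p powr s"] small[OF P(2) that, of p] by simp
      qed
      \<comment> \<open>2 to the number of primes dividing \<open>Q\<close> is at most
        \<open>Q\<close>.\<close>
      also have "\<dots> \<le> (\<Prod>p\<in>P. real p ^ multiplicity p Q)"
      proof (intro prod_mono conjI)
        fix p assume p: "p \<in> P"
        hence "multiplicity p Q > 0" by (simp add: P_def prime_factors_multiplicity)
        hence "real p ^ 1 \<le> real p ^ multiplicity p Q"
          using prime_gt_0_nat[OF P(2)[OF p]] by (intro power_increasing) auto
        moreover have "real p \<ge> 2" using prime_ge_2_nat[OF P(2)[OF p]] by simp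
        ultimately show "2 \<le> real p ^ multiplicity p Q" by (metis power_one_right order_trans)
      qed auto
      also have "\<dots> = real (\<Prod>p\<in>P. p ^ multiplicity p Q)" by simp
      also have "(\<Prod>p\<in>P. p ^ multiplicity p Q) = Q"
        using prime_factorization_nat[OF Q] by (simp add: P_def)
      finally show ?thesis .
    qed
    have Ehol: "E holomorphic_on ball 1 1"
      unfolding E_def using P(2) prime_gt_0_nat
      by (intro holomorphic_on_prod holomorphic_intros) (auto simp: powr_def)
    define \<psi> where "\<psi> = (\<lambda>n. if coprime n Q then nu (int n) else 0)"
    have psi: "\<psi> = (\<lambda>n. if \<exists>p\<in>P. p dvd n then 0 else b n)"
    proof
      fix n
      have "(\<exists>p\<in>P. p dvd n) \<longleftrightarrow> \<not> coprime n Q"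
      proof
        assume "\<exists>p\<in>P. p dvd n"
        then obtain p where p: "prime p" "p dvd Q" "p dvd n" by (auto simp: P_def)
        have "\<not> is_unit p" using p(1) by auto
        thus "\<not> coprime n Q" using coprime_common_divisor[of n Q p] p(2,3) by auto
      next
        assume "\<not> coprime n Q"
        hence "gcd n Q \<noteq> 1" unfolding coprime_iff_gcd_eq_1 .
        then obtain p where "prime p" "p dvd gcd n Q" using prime_factor_nat by blast
        thus "\<exists>p\<in>P. p dvd n" using Q by (auto simp: P_def prime_factors_dvd)
      qed
      thus "\<psi> n = (if \<exists>p\<in>P. p dvd n then 0 else b n)" by (simp add: \<psi>_def b_def)
    qed
    have exp: "exp (dirichlet_sum (log_coeff \<psi>) s) = dirichlet_sum b s * E s" if "Re s > 1" for s
    proof -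
      have "exp (dirichlet_sum (log_coeff \<psi>) s) = dirichlet_sum \<psi> s"
      proof (rule dirichlet_sum_eq_exp[symmetric, OF _ _ _ that])
        show "\<psi> 1 = 1" by (simp add: \<psi>_def character_one[OF dc])
        show "\<psi> (m * n) = \<psi> m * \<psi> n" for m n by (simp add: \<psi>_def character_mult[OF dc])
        show "norm (\<psi> n) \<le> 1" for n using b[of n] by (simp add: \<psi>_def b_def)
      qed
      also have "\<dots> = dirichlet_sum b s * E s"
        unfolding psi E_def
        by (rule sieved_dirichlet_sum[OF b _ that P]) (simp_all add: b_def character_mult[OF dc])
      finally show ?thesis .
    qed
    show "regularized_L_bound C Q d nu"
      unfolding regularized_L_bound_def
    proof (intro exI[of _ "\<lambda>s. F s * E s"] conjI ballI impI)
      show "(\<lambda>s. F s * E s) holomorphic_on ball 1 1" by (intro holomorphic_intros F Ehol)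
    next
      fix s :: complex assume s: "s \<in> cball 1 (1/2)"
      have "norm (F s) * norm (E s) \<le> (C * Q) * Q"
      proof (intro mult_mono E_le)
        have "C * d \<le> C * Q" using C(1) dvd_imp_le[OF dQ Q] by (intro mult_left_mono) auto
        thus "norm (F s) \<le> C * Q" using F(2) s by fastforce
      qed (use s C(1) in auto)
      thus "norm (F s * E s) \<le> C * (real Q)\<^sup>2" by (simp add: norm_mult power2_eq_square)
    next
      fix s :: complex assume s: "s \<in> ball 1 1" "s \<noteq> 1"
      show "F s * E s = 0 \<longleftrightarrow> dirichlet_L nu s = 0" using F(3) s E_nz[OF s(1)] by auto
    next
      fix s :: complex assume s: "s \<in> ball 1 1" "Re s > 1"
      show "F s * E s = (if d = 1 then s - 1 else 1) *
       exp (dirichlet_sum (log_coeff (\<lambda>n. if coprime n Q then nu (int n) else 0)) s)"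
        using F(4) s exp[OF s(2)] by (simp add: \<psi>_def b_def)
    qed
  qed
qed

section \<open>Repulsion of real zeros\<close>

text \<open>The integral test by hand: each term after the first is at most a difference of values
  of x^(-\<eta>) / \<eta>, and these telescope. The bound is explicit because it enters the
  effective constant.\<close>

lemma sum_powr_le:
  assumes e: "\<eta> > 0"
  shows "(\<Sum>n. (real n + 1) powr (-(1 + \<eta>))) \<le> 1 + 1 / \<eta>"
proof (rule suminf_le_const)
  show "summable (\<lambda>n. (real n + 1) powr (-(1 + \<eta>)))" using e by (intro summable_Suc_powr) auto
  have step: "\<eta> * x powr (-(1 + \<eta>)) \<le> (x - 1) powr (-\<eta>) - x powr (-\<eta>)" if x: "x > 1" for x :: real
  proof -
    have "ln (1 - 1 / x) \<le> - (1 / x)" using ln_le_minus_one[of "1 - 1 / x"] x by simp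
    hence "1 + \<eta> / x \<le> 1 + (- \<eta>) * ln (1 - 1 / x)"
      using mult_left_mono_neg[of "ln (1 - 1 / x)" "- (1 / x)" "- \<eta>"] e by simp
    also have "\<dots> \<le> exp (- \<eta> * ln (1 - 1 / x))" by (rule exp_ge_add_one_self)
    also have "\<dots> = (1 - 1 / x) powr (- \<eta>)" using x by (simp add: powr_def)
    finally have "x powr (-\<eta>) * (1 + \<eta> / x) \<le> x powr (-\<eta>) * (1 - 1 / x) powr (- \<eta>)"
      by (intro mult_left_mono) auto
    also have "\<dots> = (x * (1 - 1 / x)) powr (-\<eta>)" by (rule powr_mult[symmetric])
    also have "x * (1 - 1 / x) = x - 1" using x by (simp add: field_simps)
    finally have "x powr (-\<eta>) * (1 + \<eta> / x) \<le> (x - 1) powr (-\<eta>)" .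
    moreover have "x powr (-\<eta>) * (1 + \<eta> / x) = x powr (-\<eta>) + \<eta> * (x powr (-\<eta>) * x powr (-1))"
      using x by (simp add: distrib_left powr_minus_divide)
    moreover have "x powr (-\<eta>) * x powr (-1) = x powr (-(1 + \<eta>))" by (simp only: powr_add[symmetric]) (simp add: algebra_simps)
    ultimately have "x powr (-\<eta>) + \<eta> * x powr (-(1 + \<eta>)) \<le> (x - 1) powr (-\<eta>)"
      by (simp only:)
    thus ?thesis by linarith
  qed
  have bound: "(\<Sum>n<Suc N. (real n + 1) powr (-(1 + \<eta>))) \<le> 1 + (1 - (real N + 1) powr (-\<eta>)) / \<eta>" for N
  proof (induction N)
    case (Suc N)
    have "(real N + 2) powr (-(1 + \<eta>)) \<le> ((real N + 1) powr (-\<eta>) - (real N + 2) powr (-\<eta>)) / \<eta>"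
      using step[of "real N + 2"] e by (simp add: field_simps)
    thus ?case using Suc by (simp add: diff_divide_distrib add_ac)
  qed auto
  show "(\<Sum>n<N. (real n + 1) powr (-(1 + \<eta>))) \<le> 1 + 1 / \<eta>" for N
  proof -
    have "(\<Sum>n<N. (real n + 1) powr (-(1 + \<eta>))) \<le> (\<Sum>n<Suc N. (real n + 1) powr (-(1 + \<eta>)))" by simp
    also note bound[of N]
    also have "1 + (1 - (real N + 1) powr (-\<eta>)) / \<eta> \<le> 1 + 1 / \<eta>"
      using e by (intro add_left_mono divide_right_mono) auto
    finally show ?thesis .
  qed
qed

lemma norm_dirichlet_sum_le:
  assumes b: "\<And>n. norm (b n) \<le> 1" and e: "\<eta> > 0"
  shows "norm (dirichlet_sum b (of_real (1 + \<eta>))) \<le> 1 + 1 / \<eta>"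
proof -
  have "norm (dirichlet_sum b (of_real (1 + \<eta>))) \<le> (\<Sum>n. (real n + 1) powr (-(1 + \<eta>)))"
    unfolding dirichlet_sum_def
  proof (rule norm_suminf_le)
    show "summable (\<lambda>n. (real n + 1) powr (-(1 + \<eta>)))" using e by (intro summable_Suc_powr) auto
    show "norm (b (Suc n) / of_nat (Suc n) powr of_real (1 + \<eta>)) \<le> (real n + 1) powr (-(1 + \<eta>))" for n
      unfolding norm_dirichlet_term
      using mult_right_mono[OF b[of "Suc n"], of "(real n + 1) powr (-(1 + \<eta>))"] by simp
  qed
  thus ?thesis using sum_powr_le[OF e] by linarith
qed

text \<open>
  The main estimate for a single \<open>L\<close>-function \<open>F = (s - 1) exp H\<close> or \<open>F = exp H\<close>, evaluated at distance
  \<open>\<delta>/10\<close> to the right of 1: the zeros outside of the disk contribute a term that is smaller than the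
  contribution of a pole or zero close to 1 by a factor that is exponentially small in \<open>k\<close>.
\<close>

lemma log_L_deriv_le:
  fixes F H :: "complex \<Rightarrow> complex" and pole :: bool and \<delta> C Q :: real
  assumes F: "F holomorphic_on ball 1 1" and C: "C \<ge> 1" and Q: "Q \<ge> 1"
    and F_le: "\<And>s. s \<in> cball 1 (1/2) \<Longrightarrow> norm (F s) \<le> C * Q\<^sup>2"
    and H: "H holomorphic_on {s. Re s > 1}"
    and FH: "\<And>s. s \<in> ball 1 1 \<Longrightarrow> Re s > 1 \<Longrightarrow> F s = (if pole then s - 1 else 1) * exp (H s)"
    and \<delta>: "0 < \<delta>" "\<delta> \<le> 1/10"
    and H_le: "norm (H (of_real (1 + \<delta>/10))) \<le> 1 + 10 / \<delta>"
    and zeros: "\<And>z. z \<in> ball 1 \<delta> \<Longrightarrow> F z = 0 \<Longrightarrow> z \<in> \<real>"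
    and k: "even k" "k > 0"
  defines "err \<equiv> 4 * real k * (ln C + 2 * ln Q + 2 + 20 / \<delta>) * (20 / (9 * \<delta>)) ^ k"
    and "D \<equiv> Re ((deriv ^^ k) H (of_real (1 + \<delta>/10))) / fact (k - 1)"
    and "P \<equiv> if pole then (10 / \<delta>) ^ k else 0"
  shows "D \<le> P + err"
    and "\<And>\<beta>. F (of_real \<beta>) = 0 \<Longrightarrow> \<beta> < 1 \<Longrightarrow> 1 - \<beta> < 4 * \<delta> / 5 \<Longrightarrow> D \<le> P + err - 1 / (1 + \<delta>/10 - \<beta>) ^ k"
proof -
  define x where "x = 1 + \<delta>/10"
  define s where "s = complex_of_real x"
  \<comment> \<open>The largest radius for which the disk about \<open>s\<close> stays in the disk
    of radius \<delta> about 1, as \<delta>/10 + 9 \<delta>/10 = \<delta>.\<close>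
  define r where "r = 9/10 * \<delta>"
  \<comment> \<open>exp A is C Q^2 times two factors exp(1 + 10/\<delta>): one compensates the lower
    bound for |exp(H s)|, the other outweighs the 10/\<delta> lost when \<open>F s\<close> contains
    the factor s - 1.\<close>
  define A where "A = ln C + 2 * ln Q + 2 + 20 / \<delta>"
  define T where "T = (deriv ^^ (k - 1)) (\<lambda>z. deriv F z / F z) s"
  have r: "0 < r" "2 * r < 1/2" using \<delta> by (auto simp: r_def)
  have "ln C \<ge> 0" "ln Q \<ge> 0" "20 / \<delta> > 0" using C Q \<delta> by auto
  hence A: "A > 0" unfolding A_def by linarith
  have ds: "dist 1 s = \<delta>/10"
    using \<delta> by (simp add: s_def x_def dist_norm norm_divide)
  have s1: "s \<in> ball 1 1" "Re s > 1" using ds \<delta> by (auto simp: s_def x_def)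
  have Fs: "F s = (if pole then s - 1 else 1) * exp (H s)" using FH s1 by blast
  have "s \<noteq> 1" using s1 by auto
  hence Fs0: "F s \<noteq> 0" unfolding Fs by simp
  have Fs_ge: "norm (F s) \<ge> \<delta>/10 * exp (- (1 + 10 / \<delta>))"
  proof -
    have "exp (- (1 + 10 / \<delta>)) \<le> exp (Re (H s))"
      using abs_Re_le_cmod[of "H s"] H_le by (simp add: s_def x_def)
    moreover have "\<delta>/10 \<le> norm (if pole then s - 1 else 1)"
      using ds \<delta> by (auto simp: dist_norm norm_minus_commute)
    ultimately have "\<delta>/10 * exp (- (1 + 10 / \<delta>)) \<le> norm (if pole then s - 1 else 1) * exp (Re (H s))"
      using \<delta> by (intro mult_mono) auto
    thus ?thesis unfolding Fs norm_mult by simp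
  qed
  have bound: "norm (F z) \<le> exp A * norm (F s)" if z: "dist s z = 2 * r" for z
  proof -
    have "dist 1 z \<le> dist 1 s + dist s z" by (rule dist_triangle)
    hence "z \<in> cball 1 (1/2)" using ds z \<delta> by (simp add: r_def)
    hence "norm (F z) \<le> C * Q\<^sup>2 * 1" using F_le by simp
    also have "1 \<le> \<delta>/10 * exp (1 + 10 / \<delta>)"
    proof -
      have "10 / \<delta> \<le> exp (1 + 10 / \<delta>)" using exp_ge_add_one_self[of "1 + 10 / \<delta>"] by linarith
      thus ?thesis using \<delta> by (simp add: field_simps)
    qed
    hence "C * Q\<^sup>2 * 1 \<le> C * Q\<^sup>2 * (\<delta>/10 * exp (1 + 10 / \<delta>))"
      using C by (intro mult_left_mono) auto
    also have "\<dots> = exp A * (\<delta>/10 * exp (- (1 + 10 / \<delta>)))"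
    proof -
      have "exp A = C * Q\<^sup>2 * exp (2 + 20 / \<delta>)"
        using C Q by (simp add: A_def exp_add exp_double)
      moreover have "exp (2 + 20 / \<delta>) * exp (- (1 + 10 / \<delta>)) = exp (1 + 10 / \<delta>)"
        by (simp flip: exp_add)
      ultimately show ?thesis by simp
    qed
    also have "\<dots> \<le> exp A * norm (F s)" by (intro mult_left_mono Fs_ge) auto
    finally show ?thesis .
  qed
  have real: "z \<in> \<real>" if "z \<in> ball s r" "F z = 0" for z
  proof (rule zeros[OF _ that(2)])
    have "dist 1 z \<le> dist 1 s + dist s z" by (rule dist_triangle)
    thus "z \<in> ball 1 \<delta>" using ds that(1) by (simp add: r_def)
  qed
  have hol: "F holomorphic_on ball s (1/2)"
  proof (rule holomorphic_on_subset[OF F], rule subsetI)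
    fix z assume "z \<in> ball s (1/2)"
    moreover have "dist 1 z \<le> dist 1 s + dist s z" by (rule dist_triangle)
    ultimately show "z \<in> ball 1 1" using ds \<delta> by simp
  qed
  note landau = log_deriv_real_zeros_le[of F x "1/2" r A k, folded s_def, folded T_def]
  have T1: "Re T \<le> fact (k - 1) * (4 * real k * A * (2 / r) ^ k)"
    by (rule landau(1)) (use hol r Fs0 A bound real k in auto)
  have T2: "Re T \<le> fact (k - 1) * (4 * real k * A * (2 / r) ^ k - 1 / (x - \<beta>) ^ k)"
    if "\<bar>x - \<beta>\<bar> < r" "F (of_real \<beta>) = 0" for \<beta>
    by (rule landau(2)) (use hol r Fs0 A bound real k that in auto)
  have err_eq: "4 * real k * A * (2 / r) ^ k = err"
    by (simp add: err_def A_def r_def)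
  define U where "U = ball 1 1 \<inter> {s. Re s > 1}"
  have U: "open U" "s \<in> U" using s1 by (auto simp: U_def open_halfspace_Re_gt)
  have HU: "deriv H holomorphic_on U"
    using holomorphic_deriv[OF H open_halfspace_Re_gt] by (rule holomorphic_on_subset) (auto simp: U_def)
  have ld: "deriv F z / F z = (if pole then 1 / (z - 1) else 0) + deriv H z" if z: "z \<in> U" for z
  proof -
    have z1: "z \<in> ball 1 1" "Re z > 1" "z \<noteq> 1" using z by (auto simp: U_def)
    have dH: "(H has_field_derivative deriv H z) (at z)"
      using holomorphic_derivI[OF H open_halfspace_Re_gt] z1 by auto
    have dg: "((\<lambda>z. if pole then z - 1 else 1) has_field_derivative (if pole then 1 else 0)) (at z)"
      by (cases pole) (auto intro!: derivative_eq_intros)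
    have "((\<lambda>z. (if pole then z - 1 else 1) * exp (H z)) has_field_derivative
       (if pole then 1 else 0) * exp (H z) + exp (H z) * deriv H z * (if pole then z - 1 else 1)) (at z)"
      by (rule DERIV_mult[OF dg DERIV_fun_exp[OF dH]])
    hence "(F has_field_derivative
       (if pole then 1 else 0) * exp (H z) + exp (H z) * deriv H z * (if pole then z - 1 else 1)) (at z)"
      by (rule has_field_derivative_transform_within_open[OF _ U(1) z]) (auto simp: U_def FH)
    hence "deriv F z = (if pole then 1 else 0) * exp (H z) + exp (H z) * deriv H z * (if pole then z - 1 else 1)"
      by (rule DERIV_imp_deriv)
    thus ?thesis using FH[OF z1(1,2)] z1(3) by (auto simp: field_simps)
  qed
  have "T = (deriv ^^ (k - 1)) (\<lambda>z. (if pole then 1 / (z - 1) else 0) + deriv H z) s"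
    unfolding T_def using eventually_nhds_in_open[OF U]
    by (intro higher_deriv_cong_ev refl) (auto elim!: eventually_mono simp: ld)
  also have "\<dots> = (deriv ^^ (k - 1)) (\<lambda>z. if pole then 1 / (z - 1) else 0) s + (deriv ^^ (k - 1)) (deriv H) s"
  proof (rule higher_deriv_add[OF _ HU U])
    show "(\<lambda>z. if pole then 1 / (z - 1) else 0) holomorphic_on U"
      by (cases pole) (auto intro!: holomorphic_intros simp: U_def)
  qed
  also have "(deriv ^^ (k - 1)) (deriv H) s = (deriv ^^ k) H s"
    using k(2) by (metis Suc_diff_1 comp_apply funpow_Suc_right)
  \<comment> \<open>\<open>k - 1\<close> is odd, so the pole term is negative here and
    \<open>P\<close> enters \<open>D\<close> with a plus sign.\<close>
  also have "(deriv ^^ (k - 1)) (\<lambda>z. if pole then 1 / (z - 1) else 0) s = of_real (- (fact (k - 1) * P))"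
  proof (cases pole)
    case True
    have "(deriv ^^ (k - 1)) (\<lambda>z. 1 / (z - 1)) s = - fact (k - 1) / (s - 1) ^ k"
      using higher_deriv_inverse_diff[OF \<open>s \<noteq> 1\<close>, of "k - 1"] k by simp
    moreover have "s - 1 = of_real (\<delta>/10)" by (simp add: s_def x_def)
    ultimately show ?thesis using True by (simp add: P_def power_divide)
  next
    case False
    have "(deriv ^^ (k - 1)) (\<lambda>w. 0::complex) s = 0"
      by (induction "k - 1") (simp_all add: higher_deriv_const)
    thus ?thesis using False by (simp add: P_def)
  qed
  finally have "Re T = - (fact (k - 1) * P) + Re ((deriv ^^ k) H s)"
    by (simp only: plus_complex.sel Re_complex_of_real)
  hence "Re ((deriv ^^ k) H s) = fact (k - 1) * P + Re T" by simp
  hence D: "D = P + Re T / fact (k - 1)"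
    by (simp add: D_def s_def x_def add_divide_distrib)
  have div: "Re T / fact (k - 1) \<le> c" if "Re T \<le> fact (k - 1) * c" for c
  proof -
    have "Re T / fact (k - 1) \<le> fact (k - 1) * c / fact (k - 1)"
      using that by (rule divide_right_mono) simp
    thus ?thesis by simp
  qed
  have "Re T / fact (k - 1) \<le> err" using div[OF T1] unfolding err_eq .
  thus "D \<le> P + err" unfolding D by linarith
  fix \<beta> :: real assume b: "F (of_real \<beta>) = 0" "\<beta> < 1" "1 - \<beta> < 4 * \<delta> / 5"
  \<comment> \<open>\<delta>/10 + 4 \<delta>/5 = r: this is the origin of the condition on
    \<beta>.\<close>
  have "\<bar>x - \<beta>\<bar> < r" using b \<delta> by (simp add: x_def r_def)
  from div[OF T2[OF this b(1)]] have "Re T / fact (k - 1) \<le> err - 1 / (x - \<beta>) ^ k"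
    unfolding err_eq .
  thus "D \<le> P + err - 1 / (1 + \<delta>/10 - \<beta>) ^ k" unfolding D x_def by linarith
qed

lemma regularized_log_L_deriv_le:
  fixes \<delta> C :: real and nu :: "int \<Rightarrow> complex" and d Q k :: nat
  defines "D \<equiv> Re ((deriv ^^ k) (dirichlet_sum (log_coeff (\<lambda>n. if coprime n Q then nu (int n) else 0)))
              (of_real (1 + \<delta>/10))) / fact (k - 1)"
    and "P \<equiv> if d = 1 then (10 / \<delta>) ^ k else 0"
    and "err \<equiv> 4 * real k * (ln C + 2 * ln (real Q) + 2 + 20 / \<delta>) * (20 / (9 * \<delta>)) ^ k"
  assumes C: "C \<ge> 1" "regularized_L_bound C Q d nu" and nu: "primitive_character d nu" and Q: "Q > 0"
    and \<delta>: "0 < \<delta>" "\<delta> \<le> 1/10"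
    and zeros: "\<And>z. z \<in> ball 1 \<delta> \<Longrightarrow> dirichlet_L nu z = 0 \<Longrightarrow> z \<in> \<real>" and k: "even k" "k > 0"
  shows "D \<le> P + err"
    and "\<And>\<beta>. dirichlet_L nu (of_real \<beta>) = 0 \<Longrightarrow> \<beta> < 1 \<Longrightarrow> 1 - \<beta> < 4 * \<delta> / 5 \<Longrightarrow>
         D \<le> P + err - 1 / (1 + \<delta>/10 - \<beta>) ^ k"
proof -
  define \<psi> where "\<psi> = (\<lambda>n. if coprime n Q then nu (int n) else 0)"
  obtain F where F: "F holomorphic_on ball 1 1"
    "\<forall>s\<in>cball 1 (1/2). norm (F s) \<le> C * (real Q)\<^sup>2"
    "\<forall>s\<in>ball 1 1. s \<noteq> 1 \<longrightarrow> (F s = 0 \<longleftrightarrow> dirichlet_L nu s = 0)"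
    "\<forall>s\<in>ball 1 1. Re s > 1 \<longrightarrow> F s = (if d = 1 then s - 1 else 1) * exp (dirichlet_sum (log_coeff \<psi>) s)"
    using C(2) unfolding regularized_L_bound_def \<psi>_def[symmetric] by blast
  have "norm (\<psi> n) \<le> 1" for n
    using norm_character_le[of d nu "int n"] nu by (simp add: \<psi>_def primitive_character_def)
  note le = norm_log_coeff_le[of \<psi>, OF this]
  have Fz: "z \<in> \<real>" if "z \<in> ball 1 \<delta>" "F z = 0" for z
  \<comment> \<open>At 1 the zeros of \<open>F\<close> and of the L-function are not compared, but 1
    is real anyway.\<close>
  proof (cases "z = 1")
    case False
    have "z \<in> ball 1 1" using that(1) \<delta> by simp
    thus ?thesis using F(3) False that zeros by blast
  qed simp
  have Q1: "real Q \<ge> 1" using Q by simp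
  have Hle: "norm (dirichlet_sum (log_coeff \<psi>) (of_real (1 + \<delta>/10))) \<le> 1 + 10 / \<delta>"
    using norm_dirichlet_sum_le[of "log_coeff \<psi>" "\<delta>/10", OF le] \<delta> by simp
  have hol: "dirichlet_sum (log_coeff \<psi>) holomorphic_on {s. Re s > 1}"
    by (rule holomorphic_dirichlet_sum[of "log_coeff \<psi>", OF le])
  have F2: "norm (F s) \<le> C * (real Q)\<^sup>2" if "s \<in> cball 1 (1/2)" for s using F(2) that by blast
  have F4: "F s = (if d = 1 then s - 1 else 1) * exp (dirichlet_sum (log_coeff \<psi>) s)"
    if "s \<in> ball 1 1" "Re s > 1" for s using F(4) that by blast
  note main = log_L_deriv_le[of F C "real Q" "dirichlet_sum (log_coeff \<psi>)" "d = 1" \<delta> k,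
    folded D_def[folded \<psi>_def] P_def err_def]
  show "D \<le> P + err"
  proof (rule main(1)[OF F(1) C(1) Q1 _ hol _ \<delta> Hle _ k])
    show "norm (F s) \<le> C * (real Q)\<^sup>2" if "s \<in> cball 1 (1/2)" for s using that by (rule F2)
    show "F s = (if d = 1 then s - 1 else 1) * exp (dirichlet_sum (log_coeff \<psi>) s)"
      if "s \<in> ball 1 1" "Re s > 1" for s using that by (rule F4)
    show "z \<in> \<real>" if "z \<in> ball 1 \<delta>" "F z = 0" for z using that by (rule Fz)
  qed
  fix \<beta> :: real
  assume b: "dirichlet_L nu (of_real \<beta>) = 0" "\<beta> < 1" "1 - \<beta> < 4 * \<delta> / 5"
  have "dist (complex_of_real 1) (of_real \<beta>) = dist 1 \<beta>" by (rule dist_of_real)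
  moreover have "dist 1 \<beta> < 1" using b(2,3) \<delta> by (simp add: dist_real_def)
  ultimately have "complex_of_real \<beta> \<in> ball 1 1" by simp
  moreover have "complex_of_real \<beta> \<noteq> 1" using b(2) by simp
  ultimately have Fb: "F (of_real \<beta>) = 0" using F(3) b(1) by blast
  show "D \<le> P + err - 1 / (1 + \<delta>/10 - \<beta>) ^ k"
  proof (rule main(2)[OF F(1) C(1) Q1 _ hol _ \<delta> Hle _ k Fb b(2,3)])
    show "norm (F s) \<le> C * (real Q)\<^sup>2" if "s \<in> cball 1 (1/2)" for s using that by (rule F2)
    show "F s = (if d = 1 then s - 1 else 1) * exp (dirichlet_sum (log_coeff \<psi>) s)"
      if "s \<in> ball 1 1" "Re s > 1" for s using that by (rule F4)
    show "z \<in> \<real>" if "z \<in> ball 1 \<delta>" "F z = 0" for z using that by (rule Fz)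
  qed
qed

text \<open>Even \<open>k\<close> removes the sign of (-ln n)^k, which makes the weight of
  \<open>\<psi> n\<close> nonnegative.\<close>

lemma log_coeff_deriv_term:
  assumes "even k" "n > 0"
  shows "log_coeff \<psi> n * (- of_real (ln (real n))) ^ k / of_nat n powr of_real x =
    of_real (mangoldt n / ln (real n) * ln (real n) ^ k / real n powr x) * \<psi> n"
proof -
  have "complex_of_real (real n) powr of_real x = of_real (real n powr x)"
    by (rule powr_of_real) auto
  hence "(of_nat n :: complex) powr of_real x = of_real (real n powr x)" by simp
  thus ?thesis using assms(1) by (simp add: log_coeff_def)
qed

text \<open>
  The positivity behind the repulsion of zeros:
  \<open>Re (1 + x + y + x y / 2 + x (cnj y) / 2) = (1 + Re x) (1 + Re y) \<ge> 0\<close> on the unit disk.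
\<close>

lemma log_L_deriv_combination_nonneg:
  fixes x y :: "nat \<Rightarrow> complex" and Q :: nat
  defines "H \<equiv> \<lambda>u. dirichlet_sum (log_coeff (\<lambda>n. if coprime n Q then u n else 0))"
  assumes x: "\<And>n. norm (x n) \<le> 1" and y: "\<And>n. norm (y n) \<le> 1" and k: "even k" and t: "t > 1"
  shows "0 \<le> Re ((deriv ^^ k) (H (\<lambda>_. 1)) (of_real t)) + Re ((deriv ^^ k) (H x) (of_real t))
    + Re ((deriv ^^ k) (H y) (of_real t)) + Re ((deriv ^^ k) (H (\<lambda>n. x n * y n)) (of_real t)) / 2
    + Re ((deriv ^^ k) (H (\<lambda>n. x n * cnj (y n))) (of_real t)) / 2"
proof -
  define w where "w = (\<lambda>n. mangoldt n / ln (real n) * ln (real n) ^ k / real n powr t)"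
  define \<psi> where "\<psi> = (\<lambda>u n. if coprime n Q then u n else (0::complex))"
  have w: "w (Suc n) \<ge> 0" for n
    unfolding w_def by (intro mult_nonneg_nonneg divide_nonneg_nonneg mangoldt_nonneg zero_le_power) auto
  have sums: "(\<lambda>n. w (Suc n) * Re (\<psi> u (Suc n))) sums Re ((deriv ^^ k) (H u) (of_real t))"
    if u: "\<And>n. norm (u n) \<le> 1" for u
  proof -
    have le: "norm (log_coeff (\<psi> u) n) \<le> 1" for n
      by (rule norm_log_coeff_le) (simp add: \<psi>_def u)
    have Hu: "H u = dirichlet_sum (log_coeff (\<psi> u))" by (simp add: H_def \<psi>_def)
    have "(\<lambda>n. log_coeff (\<psi> u) (Suc n) * (- of_real (ln (real (Suc n)))) ^ k / of_nat (Suc n) powr of_real t)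
        sums (deriv ^^ k) (H u) (of_real t)"
      unfolding Hu by (rule higher_deriv_dirichlet_sum[of "log_coeff (\<psi> u)", OF le]) (use t in simp)
    hence "(\<lambda>n. of_real (w (Suc n)) * \<psi> u (Suc n)) sums (deriv ^^ k) (H u) (of_real t)"
      unfolding w_def by (simp only: log_coeff_deriv_term[OF k zero_less_Suc])
    from sums_Re[OF this] show ?thesis by simp
  qed
  have xy: "norm (x n * y n) \<le> 1" "norm (x n * cnj (y n)) \<le> 1" for n
    using mult_mono[OF x[of n] y[of n]] by (auto simp: norm_mult)
  have S: "(\<lambda>n. w (Suc n) * Re (\<psi> (\<lambda>_. 1) (Suc n)) + w (Suc n) * Re (\<psi> x (Suc n)) + w (Suc n) * Re (\<psi> y (Suc n))
      + w (Suc n) * Re (\<psi> (\<lambda>n. x n * y n) (Suc n)) / 2 + w (Suc n) * Re (\<psi> (\<lambda>n. x n * cnj (y n)) (Suc n)) / 2)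
    sums (Re ((deriv ^^ k) (H (\<lambda>_. 1)) (of_real t)) + Re ((deriv ^^ k) (H x) (of_real t))
    + Re ((deriv ^^ k) (H y) (of_real t)) + Re ((deriv ^^ k) (H (\<lambda>n. x n * y n)) (of_real t)) / 2
    + Re ((deriv ^^ k) (H (\<lambda>n. x n * cnj (y n))) (of_real t)) / 2)"
    by (intro sums_add sums_divide sums x y xy) simp
  \<comment> \<open>Where n + 1 is not coprime to \<open>Q\<close>, all five terms vanish together;
    this is the purpose of the common modulus.\<close>
  have "0 \<le> w (Suc n) * Re (\<psi> (\<lambda>_. 1) (Suc n)) + w (Suc n) * Re (\<psi> x (Suc n)) + w (Suc n) * Re (\<psi> y (Suc n))
      + w (Suc n) * Re (\<psi> (\<lambda>n. x n * y n) (Suc n)) / 2 + w (Suc n) * Re (\<psi> (\<lambda>n. x n * cnj (y n)) (Suc n)) / 2" for n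
  proof (cases "coprime (Suc n) Q")
    case True
    have "1 + Re (x (Suc n)) \<ge> 0" "1 + Re (y (Suc n)) \<ge> 0"
      using abs_Re_le_cmod[of "x (Suc n)"] abs_Re_le_cmod[of "y (Suc n)"] x[of "Suc n"] y[of "Suc n"] by linarith+
    hence "0 \<le> w (Suc n) * ((1 + Re (x (Suc n))) * (1 + Re (y (Suc n))))"
      using w[of n] by simp
    thus ?thesis using True by (simp add: \<psi>_def algebra_simps add_divide_distrib diff_divide_distrib)
  qed (simp add: \<psi>_def)
  from sums_le[OF this sums_zero S] show ?thesis .
qed

text \<open>A residue coprime to \<open>d\<close> lifts to one coprime to \<open>Q\<close>, so the
  relation psi^m = 1 descends. This brings the products of two characters under the hypothesis on
  zeros.\<close>

lemma inducing_character_in_primitive_characters: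
  assumes psi: "dirichlet_character Q psi" and m: "m > 0"
    and order: "\<And>a. coprime a (int Q) \<Longrightarrow> psi a ^ m = 1"
  obtains d nu where "d dvd Q" "primitive_character d nu" "nu \<in> primitive_characters m"
    "\<And>a. coprime a (int Q) \<Longrightarrow> psi a = nu a"
proof -
  obtain d nu where d: "d dvd Q" and nu: "primitive_character d nu"
    and eq: "\<And>a. coprime a (int Q) \<Longrightarrow> psi a = nu a"
    by (rule inducing_primitive_character[OF psi]) (rule that; assumption)
  have dc: "dirichlet_character d nu" using nu by (simp add: primitive_character_def)
  have "nu a ^ m = 1" if a: "coprime a (int d)" for a
  proof -
    obtain b where b: "[b = a] (mod int d)" "coprime b (int Q)"
      using coprime_lift[OF a, of "int Q"] character_pos[OF psi] by auto
    have "nu a = nu b" using character_cong[OF dc b(1)] by simp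
    also have "\<dots> = psi b" using eq[OF b(2)] by simp
    finally show ?thesis using order[OF b(2)] by simp
  qed
  hence "nu \<in> primitive_characters m"
    using nu character_order_dvd_iff[OF dc m] by (auto simp: primitive_characters_def)
  thus ?thesis using that d nu eq by blast
qed

text \<open>Upper bounds for the five derivatives are set against the nonnegativity of their
  combination. Its total weight is 1 + 1 + 1 + 1/2 + 1/2 = 4, which turns the 4 k of a single error
  term into 16 k.\<close>

lemma zero_repulsion:
  fixes m q1 q2 k :: nat and C \<delta> \<beta>1 \<beta>2 :: real and chi1 chi2 :: "int \<Rightarrow> complex"
  assumes C: "C \<ge> 1"
      "\<And>d nu Q. primitive_character d nu \<Longrightarrow> d dvd Q \<Longrightarrow> Q > 0 \<Longrightarrow> regularized_L_bound C Q d nu"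
    and m: "m > 0" and \<delta>: "0 < \<delta>" "\<delta> \<le> 1/10"
    and zeros: "\<And>\<nu> z. \<nu> \<in> primitive_characters m \<Longrightarrow> z \<in> ball 1 \<delta> \<Longrightarrow> dirichlet_L \<nu> z = 0 \<Longrightarrow> z \<in> \<real>"
    and p1: "primitive_character q1 chi1" and p2: "primitive_character q2 chi2"
    and m1: "chi1 \<in> primitive_characters m" and m2: "chi2 \<in> primitive_characters m"
    and q: "q1 \<noteq> 1" "q2 \<noteq> 1" and ne: "chi2 \<notin> {chi1, cnj \<circ> chi1}"
    and b1: "dirichlet_L chi1 (of_real \<beta>1) = 0" "\<beta>1 < 1" "1 - \<beta>1 < 4 * \<delta> / 5"
    and b2: "dirichlet_L chi2 (of_real \<beta>2) = 0" "\<beta>2 < 1" "1 - \<beta>2 < 4 * \<delta> / 5"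
    and k: "even k" "k > 0"
  shows "1 / (1 + \<delta>/10 - \<beta>1) ^ k + 1 / (1 + \<delta>/10 - \<beta>2) ^ k \<le>
    (10 / \<delta>) ^ k + 16 * real k * (ln C + 2 * ln (real (q1 * q2)) + 2 + 20 / \<delta>) * (20 / (9 * \<delta>)) ^ k"
proof -
  define Q where "Q = q1 * q2"
  note d1 = p1[unfolded primitive_character_def, THEN conjunct1]
  note d2 = p2[unfolded primitive_character_def, THEN conjunct1]
  have Q0: "Q > 0" using character_pos[OF d1] character_pos[OF d2] by (simp add: Q_def)
  have cop: "coprime a (int Q) \<longleftrightarrow> coprime a (int q1) \<and> coprime a (int q2)" for a by (simp add: Q_def)
  \<comment> \<open>Membership in \<open>primitive_characters m\<close> speaks of some modulus;
    uniqueness identifies it with the given one.\<close>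
  have pow: "chi a ^ m = 1" if chi: "chi \<in> primitive_characters m" "primitive_character q' chi" "coprime a (int q')"
    for chi q' a
  proof -
    obtain q'' where q'': "primitive_character q'' chi" "character_order q'' chi dvd m"
      using chi(1) by (auto simp: primitive_characters_def)
    have "q'' = q'" using modulus_eq[OF q''(1)] modulus_eq[OF chi(2)] by simp
    thus ?thesis using character_order_dvd_iff[of q' chi m] q'' m chi(2,3)
      by (auto simp: primitive_character_def)
  qed
  define err where "err = 4 * real k * (ln C + 2 * ln Q + 2 + 20 / \<delta>) * (20 / (9 * \<delta>)) ^ k"
  define D where "D = (\<lambda>u. Re ((deriv ^^ k) (dirichlet_sum (log_coeff (\<lambda>n. if coprime n Q then u n else 0)))
            (of_real (1 + \<delta>/10))) / fact (k - 1))"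
  have upper: "D u \<le> (if d = 1 then (10 / \<delta>) ^ k else 0) + err"
    "\<And>\<beta>. dirichlet_L nu (of_real \<beta>) = 0 \<Longrightarrow> \<beta> < 1 \<Longrightarrow> 1 - \<beta> < 4 * \<delta> / 5 \<Longrightarrow>
       D u \<le> (if d = 1 then (10 / \<delta>) ^ k else 0) + err - 1 / (1 + \<delta>/10 - \<beta>) ^ k"
    if nu: "primitive_character d nu" "d dvd Q" "nu \<in> primitive_characters m"
      "\<And>n. coprime n Q \<Longrightarrow> u n = nu (int n)" for d nu u
  proof -
    have "(\<lambda>n. if coprime n Q then u n else 0) = (\<lambda>n. if coprime n Q then nu (int n) else 0)"
      using nu(4) by auto
    hence "D u = Re ((deriv ^^ k) (dirichlet_sum (log_coeff (\<lambda>n. if coprime n Q then nu (int n) else 0)))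
            (of_real (1 + \<delta>/10))) / fact (k - 1)" unfolding D_def by simp
    note bound = regularized_log_L_deriv_le[OF C(1) C(2)[OF nu(1,2) Q0] nu(1) Q0 \<delta> _ k,
        folded this err_def]
    show "D u \<le> (if d = 1 then (10 / \<delta>) ^ k else 0) + err"
      by (rule bound(1)) (rule zeros[OF nu(3)])
    show "D u \<le> (if d = 1 then (10 / \<delta>) ^ k else 0) + err - 1 / (1 + \<delta>/10 - \<beta>) ^ k"
      if "dirichlet_L nu (of_real \<beta>) = 0" "\<beta> < 1" "1 - \<beta> < 4 * \<delta> / 5" for \<beta>
      by (rule bound(2)[OF _ that]) (rule zeros[OF nu(3)])
  qed
  define x where "x = (\<lambda>n. chi1 (int n))"
  define y where "y = (\<lambda>n. chi2 (int n))"
  have nx: "norm (x n) \<le> 1" "norm (y n) \<le> 1" for n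
    by (auto simp: x_def y_def norm_character_le[OF d1] norm_character_le[OF d2])
  have one: "D (\<lambda>_. 1) \<le> (10 / \<delta>) ^ k + err"
  proof -
    have "(\<lambda>_. 1) \<in> primitive_characters m"
      using primitive_trivial character_order_dvd_iff[OF trivial_character m] by (auto simp: primitive_characters_def)
    from upper(1)[OF primitive_trivial _ this, of "\<lambda>_. 1"] show ?thesis by simp
  qed
  have X: "D x \<le> err - 1 / (1 + \<delta>/10 - \<beta>1) ^ k"
    using upper(2)[OF p1 _ m1 _ b1, of x] q by (simp add: x_def Q_def)
  have Y: "D y \<le> err - 1 / (1 + \<delta>/10 - \<beta>2) ^ k"
    using upper(2)[OF p2 _ m2 _ b2, of y] q by (simp add: y_def Q_def)
  \<comment> \<open>Covers both products: \<open>xi\<close> will be \<open>chi2\<close> or its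
    conjugate.\<close>
  have mixed: "D (\<lambda>n. x n * z n) \<le> err"
    if z: "primitive_character q2 xi" "chi1 \<noteq> cnj \<circ> xi" "\<And>n. z n = xi (int n)"
      "\<And>a. coprime a (int q2) \<Longrightarrow> xi a ^ m = 1" for xi z
  proof -
    have dxi: "dirichlet_character q2 xi" using z(1) by (simp add: primitive_character_def)
    have dc: "dirichlet_character Q (\<lambda>a. chi1 a * xi a)"
      unfolding Q_def by (rule dirichlet_character_times[OF d1 dxi])
    have ord: "(chi1 a * xi a) ^ m = 1" if "coprime a (int Q)" for a
      using pow[OF m1 p1] z(4) that by (simp add: power_mult_distrib cop)
    obtain d nu where nu: "d dvd Q" "primitive_character d nu" "nu \<in> primitive_characters m"
      "\<And>a. coprime a (int Q) \<Longrightarrow> chi1 a * xi a = nu a"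
      by (rule inducing_character_in_primitive_characters[OF dc m ord]) (assumption, (rule that; assumption))
    \<comment> \<open>A pole would mean that the product is trivial on units, hence that
      \<open>chi1\<close> is the conjugate of \<open>xi\<close>, against the assumption that the
      classes differ.\<close>
    have "d \<noteq> 1"
    proof
      assume "d = 1"
      hence "nu = (\<lambda>_. 1)" using nu(2) primitive_modulus_1 by simp
      hence prod1: "chi1 a * xi a = 1" if "coprime a (int q1)" "coprime a (int q2)" for a
        using nu(4)[of a] that by (simp add: cop)
      have "chi1 a = (cnj \<circ> xi) a" if a: "coprime a (int q1)" "coprime a (int q2)" for a
      proof -
        have "xi a * cnj (xi a) = 1"
          using norm_character_eq_1[OF dxi a(2)] by (simp add: complex_norm_square[symmetric])
        hence "chi1 a = chi1 a * xi a * cnj (xi a)" by (simp add: mult.assoc)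
        thus ?thesis using prod1[OF a] by simp
      qed
      hence "chi1 = cnj \<circ> xi"
        using primitive_eq_if_agree[OF p1 primitive_character_cnj[OF z(1)]] by blast
      thus False using z(2) by simp
    qed
    moreover have "x n * z n = nu (int n)" if "coprime n Q" for n
      using nu(4)[of "int n"] that by (simp add: x_def z(3))
    ultimately show ?thesis
      using upper(1)[OF nu(2,1,3), of "\<lambda>n. x n * z n"] by simp
  qed
  have XY: "D (\<lambda>n. x n * y n) \<le> err"
  proof (rule mixed[OF p2])
    show "chi1 \<noteq> cnj \<circ> chi2"
    proof
      assume "chi1 = cnj \<circ> chi2"
      hence "chi2 = cnj \<circ> chi1" by (auto simp: fun_eq_iff)
      thus False using ne by simp
    qed
  qed (use pow[OF m2 p2] in \<open>auto simp: y_def\<close>)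
  have XY': "D (\<lambda>n. x n * cnj (y n)) \<le> err"
  proof (rule mixed[OF primitive_character_cnj[OF p2]])
    show "chi1 \<noteq> cnj \<circ> (cnj \<circ> chi2)" using ne by (auto simp: o_def)
    show "(cnj \<circ> chi2) a ^ m = 1" if "coprime a (int q2)" for a
      using arg_cong[OF pow[OF m2 p2 that], of cnj] by simp
  qed (auto simp: y_def)
  have "0 \<le> (D (\<lambda>_. 1) + D x + D y + D (\<lambda>n. x n * y n) / 2 + D (\<lambda>n. x n * cnj (y n)) / 2) * fact (k - 1)"
    using log_L_deriv_combination_nonneg[OF nx k(1), of "1 + \<delta>/10" Q] \<delta>
    by (simp add: D_def distrib_right)
  hence "0 \<le> D (\<lambda>_. 1) + D x + D y + D (\<lambda>n. x n * y n) / 2 + D (\<lambda>n. x n * cnj (y n)) / 2"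
    by (rule mult_right_le_imp_le[of 0 "fact (k - 1)", unfolded mult_zero_left]) simp
  hence "1 / (1 + \<delta>/10 - \<beta>1) ^ k + 1 / (1 + \<delta>/10 - \<beta>2) ^ k \<le> (10 / \<delta>) ^ k + 4 * err"
    using one X Y XY XY' by argo
  thus "1 / (1 + \<delta>/10 - \<beta>1) ^ k + 1 / (1 + \<delta>/10 - \<beta>2) ^ k \<le>
      (10 / \<delta>) ^ k + 16 * real k * (ln C + 2 * ln (real (q1 * q2)) + 2 + 20 / \<delta>) * (20 / (9 * \<delta>)) ^ k"
    by (simp add: err_def Q_def algebra_simps)
qed

section \<open>The effective constant\<close>

lemma recursive_compose1:
  assumes "recursive_function 1 f" "recursive_function n g"
  shows "recursive_function n (\<lambda>xs. f [g xs])"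
  using recursive_function.comp[of "[g]" f n] assms by simp

lemma recursive_compose2:
  assumes "recursive_function 2 f" "recursive_function n g" "recursive_function n h"
  shows "recursive_function n (\<lambda>xs. f [g xs, h xs])"
  using recursive_function.comp[of "[g, h]" f n] assms by (simp add: numeral_2_eq_2)

lemma recursive_Suc: "recursive_function n g \<Longrightarrow> recursive_function n (\<lambda>xs. Suc (g xs))"
  using recursive_compose1[OF recursive_function.succ] by simp

lemma recursive_const: "recursive_function n (\<lambda>_. c)"
  by (induction c) (auto intro: recursive_function.zero recursive_Suc)

text \<open>Primitive recursion with one parameter; addition, multiplication and power each iterate
  the operation before them.\<close>

lemma recursive_iterate:
  assumes f: "recursive_function 1 f" and g: "recursive_function 3 g"
    and a: "recursive_function n a" and b: "recursive_function n b"
  shows "recursive_function n (\<lambda>xs. rec_nat (f [b xs]) (\<lambda>k r. g [k, r, b xs]) (a xs))"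
proof -
  have "recursive_function 2 (\<lambda>xs. rec_nat (f (tl xs)) (\<lambda>k r. g (k # r # tl xs)) (hd xs))"
    using recursive_function.prec[of 1 f g] f g by (simp add: numeral_2_eq_2 numeral_3_eq_3)
  from recursive_compose2[OF this a b] show ?thesis by simp
qed

lemma recursive_add:
  assumes "recursive_function n a" "recursive_function n b"
  shows "recursive_function n (\<lambda>xs. a xs + b xs)"
proof -
  have "recursive_function 1 (\<lambda>xs. xs ! 0)" "recursive_function 3 (\<lambda>xs. Suc (xs ! 1))"
    by (auto intro!: recursive_Suc recursive_function.proj)
  from recursive_iterate[OF this assms]
  have "recursive_function n (\<lambda>xs. rec_nat (b xs) (\<lambda>k r. Suc r) (a xs))" by simp
  moreover have "rec_nat y (\<lambda>k r. Suc r) x = x + y" for x y :: nat by (induction x) auto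
  ultimately show ?thesis by simp
qed

lemma recursive_mult:
  assumes "recursive_function n a" "recursive_function n b"
  shows "recursive_function n (\<lambda>xs. a xs * b xs)"
proof -
  have "recursive_function 1 (\<lambda>xs. 0)" "recursive_function 3 (\<lambda>xs. xs ! 1 + xs ! 2)"
    by (auto intro!: recursive_add recursive_function.proj recursive_function.zero)
  from recursive_iterate[OF this assms]
  have "recursive_function n (\<lambda>xs. rec_nat 0 (\<lambda>k r. r + b xs) (a xs))" by simp
  moreover have "rec_nat 0 (\<lambda>k r. r + y) x = x * y" for x y :: nat by (induction x) auto
  ultimately show ?thesis by simp
qed

lemma recursive_power:
  assumes "recursive_function n a" "recursive_function n b"
  shows "recursive_function n (\<lambda>xs. b xs ^ a xs)"
proof -
  have "recursive_function 1 (\<lambda>xs. 1)" "recursive_function 3 (\<lambda>xs. xs ! 1 * xs ! 2)"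
    by (auto intro!: recursive_mult recursive_function.proj recursive_const)
  from recursive_iterate[OF this assms]
  have "recursive_function n (\<lambda>xs. rec_nat 1 (\<lambda>k r. r * b xs) (a xs))" by simp
  moreover have "rec_nat 1 (\<lambda>k r. r * y) x = y ^ x" for x y :: nat by (induction x) auto
  ultimately show ?thesis by simp
qed

section \<open>The numerical comparison of pole and zeros\<close>

lemma powr_inverse_ge:
  fixes W x :: real and d :: nat
  assumes "W > 0" "d > 0" "W ^ (4 * d) \<le> x"
  shows "W \<le> x powr (1 / (4 * real d))"
proof -
  have "W = (W powr (4 * real d)) powr (1 / (4 * real d))"
    using assms(1,2) by (simp add: powr_powr)
  also have "W powr (4 * real d) = W ^ (4 * d)"
    using powr_realpow[OF assms(1), of "4 * d"] by simp
  also have "(W ^ (4 * d)) powr (1 / (4 * real d)) \<le> x powr (1 / (4 * real d))"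
    using assms by (intro powr_mono2) auto
  finally show ?thesis .
qed

text \<open>The fourth power leaves room: one factor is lost to \<open>k\<close>, and the remaining
  three still beat 1 / y.\<close>

lemma powr_minus_inverse_eq:
  fixes x :: real and d :: nat
  assumes "d > 0"
  shows "x powr (- (1 / real d)) = 1 / (x powr (1 / (4 * real d))) ^ 4"
proof -
  have "(x powr (1 / (4 * real d))) ^ 4 = x powr (1 / real d)"
  proof (cases "x = 0")
    case False
    hence "(x powr (1 / (4 * real d))) ^ 4 = (x powr (1 / (4 * real d))) powr real 4"
      by (subst powr_realpow) auto
    thus ?thesis using assms by (simp add: powr_powr)
  qed simp
  thus ?thesis by (simp add: powr_minus_divide)
qed

lemma powr_minus_inverse_le:
  fixes W x :: real and d :: nat
  assumes "W \<ge> 1" "d > 0" "W ^ (4 * d) \<le> x"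
  shows "x powr (- (1 / real d)) \<le> 1 / W"
proof -
  define y where "y = x powr (1 / (4 * real d))"
  have y: "W \<le> y" unfolding y_def using assms by (intro powr_inverse_ge) auto
  also have "y ^ 1 \<le> y ^ 4" using y assms(1) by (intro power_increasing) auto
  finally have "W \<le> y ^ 4" by simp
  hence "1 / y ^ 4 \<le> 1 / W" using assms(1) by (intro frac_le) auto
  thus ?thesis using powr_minus_inverse_eq[OF assms(2)] by (simp add: y_def)
qed

lemma even_between:
  fixes t :: real
  assumes "t > 0"
  obtains k :: nat where "even k" "k > 0" "2 * t \<le> k" "k \<le> 2 * t + 2"
proof
  show "even (2 * nat \<lceil>t\<rceil>)" by simp
  show "2 * nat \<lceil>t\<rceil> > 0" using assms by simp
  show "2 * t \<le> real (2 * nat \<lceil>t\<rceil>)" "real (2 * nat \<lceil>t\<rceil>) \<le> 2 * t + 2"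
    using assms by linarith+
qed

text \<open>
  With \<open>k\<close> close to \<open>2 ln x2\<close>, the zero \<open>1 - l2\<close> almost cancels the pole, up to \<open>y ^ -3\<close> where
  \<open>y = x2 powr (1/(4 d))\<close>, and so does the error term, while \<open>1 - l1\<close> contributes at least \<open>1 / y\<close>.
\<close>

lemma repulsion_numerics:
  fixes b d N :: nat and c x1 x2 l1 l2 :: real
  assumes pos: "b > 0" "d > 0" and c: "c \<ge> 0" "c + 3 \<le> N"
    and x: "real (3000 * N * b * d) ^ (4 * d) \<le> x1" "x1 \<le> x2"
    and l1: "0 < l1" "l1 \<le> x1 powr (- (1 / real d))"
    and l2: "0 < l2" "l2 \<le> x2 powr (- (1 / real d))"
  obtains k :: nat where "even k" "k > 0"
    "(10 * real b) ^ k + 16 * real k * (c + 2 * (x1 + x2) + 2 + 20 * real b) * (20 * real b / 9) ^ k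
      < 1 / (1 / (10 * real b) + l1) ^ k + 1 / (1 / (10 * real b) + l2) ^ k"
proof -
  define W where "W = real (3000 * N * b * d)"
  define y where "y = x2 powr (1 / (4 * real d))"
  define E where "E = 10 * real b"
  have bd: "real b \<ge> 1" "real d \<ge> 1" "real N \<ge> 3" using pos c by auto
  have W_ge: "3000 * (real b * real d) * 1 \<le> W" "W \<ge> 3000" "W \<ge> 3000 * real N * real b"
  proof -
    have Wr: "W = 3000 * (real b * real d) * real N" by (simp add: W_def)
    have b1: "real b * real d \<ge> 1 * 1" using bd by (intro mult_mono) auto
    show 1: "3000 * (real b * real d) * 1 \<le> W"
      unfolding Wr using bd by (intro mult_left_mono) auto
    show "W \<ge> 3000" using 1 b1 by linarith
    have "3000 * real N * real b * 1 \<le> 3000 * real N * real b * real d"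
      using bd by (intro mult_left_mono) auto
    thus "W \<ge> 3000 * real N * real b" by (simp add: Wr mult_ac)
  qed
  have xW: "W ^ (4 * d) \<le> x1" "W ^ (4 * d) \<le> x2" using x by (auto simp: W_def)
  have yW: "W \<le> y" unfolding y_def using xW W_ge pos by (intro powr_inverse_ge) auto
  hence y: "y \<ge> 3000 * (real b * real d)" "y \<ge> 3000" using W_ge by auto
  have xy: "x2 = y ^ (4 * d)"
  proof -
    have x2: "x2 > 0" using xW(2) W_ge by (meson less_le_trans zero_less_power less_le_trans zero_less_numeral)
    have "y ^ (4 * d) = y powr real (4 * d)" using y by (subst powr_realpow) auto
    thus ?thesis using x2 pos by (simp add: y_def powr_powr)
  qed
  have x4: "y ^ 4 \<le> x2"
    unfolding xy using y pos by (intro power_increasing) auto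
  have "y ^ 1 \<le> y ^ 4" using y by (intro power_increasing) auto
  hence xyle: "y \<le> x2" using x4 by simp
  have xpos: "x2 \<ge> 3000" using xyle y by linarith
  have lnx: "ln x2 = 4 * real d * ln y" unfolding xy using y by (simp add: ln_realpow)
  have lny: "ln y \<le> y - 1" using y by (intro ln_le_minus_one) auto
  have lny1: "ln y \<ge> 1"
  proof -
    have "exp 1 \<le> (3::real)" by (rule exp_le)
    hence "exp 1 \<le> y" using y by linarith
    thus ?thesis using y by (simp add: ln_ge_iff)
  qed
  have "ln x2 > 0" using xpos by simp
  then obtain k :: nat where k: "even k" "k > 0" "2 * ln x2 \<le> k" "k \<le> 2 * ln x2 + 2"
    by (rule even_between)
  have k_le: "real k \<le> 8 * real d * y"
  proof -
    have "real k \<le> 8 * real d * ln y + 2" using k(4) lnx by simp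
    also have "8 * real d * ln y \<le> 8 * real d * (y - 1)" using lny by (intro mult_left_mono) auto
    finally show ?thesis using bd by (simp add: algebra_simps)
  qed
  have E: "E \<ge> 10" using bd by (simp add: E_def)
  \<comment> \<open>The contribution of a zero relative to that of the pole, after division by
    E^k.\<close>
  define p where "p = (\<lambda>l. 1 / (1 + E * l))"
  have scale: "1 / (1 / (10 * real b) + l) ^ k = E ^ k * p l ^ k" if "l > 0" for l
  proof -
    have "1 / (10 * real b) + l = (1 + E * l) / E" using E by (simp add: E_def field_simps)
    hence "1 / (1 / (10 * real b) + l) = E * p l" by (simp add: p_def)
    hence "(1 / (1 / (10 * real b) + l)) ^ k = E ^ k * p l ^ k" by (simp add: power_mult_distrib)
    thus ?thesis by (simp add: power_one_over)
  qed
  \<comment> \<open>Bernoulli's inequality with k \<le> 8 d y and E l2 \<le> 10 b / y^4.\<close>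
  have p2: "p l2 ^ k \<ge> 1 - 80 * (real b * real d) / y ^ 3"
  proof -
    have El: "E * l2 > 0" using E l2(1) by simp
    have "1 + real k * (- (E * l2 / (1 + E * l2))) \<le> (1 + (- (E * l2 / (1 + E * l2)))) ^ k"
      using El by (intro Bernoulli_inequality) (simp add: divide_le_eq)
    also have "1 + (- (E * l2 / (1 + E * l2))) = p l2"
      using El by (simp add: p_def field_simps)
    finally have "1 - real k * (E * l2 / (1 + E * l2)) \<le> p l2 ^ k" by simp
    moreover have "real k * (E * l2 / (1 + E * l2)) \<le> 80 * (real b * real d) / y ^ 3"
    proof -
      have "E * l2 / (1 + E * l2) \<le> E * l2 / 1"
        using El by (intro divide_left_mono) auto
      also have "E * l2 / 1 \<le> E * (1 / y ^ 4)"
        using l2(2) mult_left_mono[of l2 "1 / y ^ 4" E] E powr_minus_inverse_eq[OF pos(2), of x2]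
        by (simp add: y_def)
      finally have "real k * (E * l2 / (1 + E * l2)) \<le> (8 * real d * y) * (E * (1 / y ^ 4))"
        using k_le El E y by (intro mult_mono) auto
      also have "\<dots> = 80 * (real b * real d) / y ^ 3"
        using y by (simp add: E_def field_simps power_numeral_reduce)
      finally show ?thesis .
    qed
    ultimately show ?thesis by linarith
  qed
  have p1: "p l1 ^ k \<ge> 1 / y"
  proof -
    have El: "E * l1 > 0" using E l1(1) by simp
    have "exp (- (E * l1)) \<le> p l1"
      using exp_ge_add_one_self[of "E * l1"] El by (simp add: p_def exp_minus field_simps)
    hence "exp (- (E * l1)) ^ k \<le> p l1 ^ k" by (intro power_mono) auto
    moreover have "exp (- (E * l1)) ^ k = exp (- (real k * (E * l1)))"
      by (simp add: exp_of_nat_mult[symmetric])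
    moreover have "exp (- (real k * (E * l1))) \<ge> exp (- ln y)"
    proof -
      \<comment> \<open>Only 1 / W is available, as \<open>x1\<close> may be far smaller than
        \<open>x2\<close>. It suffices: E / W \<le> 1 / (300 d) and k \<le> 8 d ln y + 2 keep the
        exponent at most ln y.\<close>
      have "l1 \<le> 1 / W" using l1(2) powr_minus_inverse_le[of W d x1] W_ge pos xW(1) by linarith
      hence "E * l1 \<le> E / W" using mult_left_mono[of l1 "1 / W" E] E by simp
      also have "\<dots> \<le> E / (3000 * (real b * real d))"
        using W_ge(1) E pos by (intro frac_le) auto
      also have "\<dots> = 1 / (300 * real d)" using bd by (simp add: E_def)
      finally have "real k * (E * l1) \<le> (8 * real d * ln y + 2) * (1 / (300 * real d))"
        using k(4) lnx El lny1 by (intro mult_mono) auto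
      also have "\<dots> = 8 / 300 * ln y + 2 / (300 * real d)" using bd by (simp add: field_simps)
      also have "\<dots> \<le> 8 / 300 * ln y + 2 / 300"
        using bd by (intro add_left_mono frac_le) auto
      also have "\<dots> \<le> ln y" using lny1 by linarith
      finally show ?thesis by simp
    qed
    moreover have "exp (- ln y) = 1 / y" using y by (simp add: exp_minus field_simps)
    ultimately show ?thesis by simp
  qed
  define A where "A = c + 2 * (x1 + x2) + 2 + 20 * real b"
  have A: "0 \<le> A" "A \<le> 5 * x2"
  proof -
    have "x1 > 0" using xW(1) W_ge by (meson less_le_trans zero_less_power zero_less_numeral)
    thus "0 \<le> A" using c xpos by (simp add: A_def)
    have "3000 * real N * real b \<ge> 3000 * (real N * 1)" using bd by simp
    moreover have "3000 * real N * real b \<ge> 3000 * (1 * real b)" using bd by simp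
    ultimately have "c + 2 + 20 * real b \<le> 3000 * real N * real b" using c bd by linarith
    hence "c + 2 + 20 * real b \<le> x2" using W_ge(3) yW xyle by linarith
    thus "A \<le> 5 * x2" using x(2) by (simp add: A_def)
  qed
  \<comment> \<open>Because 2/9 \<le> 1/e and k \<ge> 2 ln x2, the power is at most x2^(-2): one
    factor \<open>x2\<close> pays for \<open>A\<close>, the other is at least y^4.\<close>
  have err: "16 * real k * A * (2 / 9) ^ k \<le> 640 * real d / y ^ 3"
  proof -
    have "exp 1 * (2 / 9) \<le> (1::real)" using exp_le by simp
    hence "2 / 9 \<le> exp (-1 :: real)" by (simp add: exp_minus field_simps)
    hence "(2 / 9 :: real) ^ k \<le> exp (-1) ^ k" by (intro power_mono) auto
    also have "\<dots> = exp (- real k)" by (simp add: exp_of_nat_mult[symmetric])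
    also have "\<dots> \<le> exp (- (2 * ln x2))" using k(3) by simp
    also have "exp (- (2 * ln x2)) = inverse (exp (ln x2) ^ 2)" by (simp only: exp_minus exp_double)
    also have "\<dots> = 1 / x2\<^sup>2" using xpos by (simp add: divide_inverse)
    finally have pw: "(2 / 9 :: real) ^ k \<le> 1 / x2\<^sup>2" .
    have "16 * real k * A * (2 / 9) ^ k \<le> (16 * (8 * real d * y) * (5 * x2)) * (1 / x2\<^sup>2)"
      using k_le A pw y bd by (intro mult_mono) auto
    also have "\<dots> = 640 * real d * y * (1 / x2)" using xpos by (simp add: power2_eq_square)
    also have "\<dots> \<le> 640 * real d * y * (1 / y ^ 4)"
      using x4 y bd by (intro mult_left_mono frac_le) auto
    also have "\<dots> = 640 * real d / y ^ 3" using y by (simp add: field_simps power_numeral_reduce)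
    finally show ?thesis .
  qed
  \<comment> \<open>Both losses together are at most 720 b d / y^3, less than 1 / y because y \<ge>
    3000 b d; this is what the 3000 is for.\<close>
  have final: "1 + 640 * real d / y ^ 3 < 1 / y + (1 - 80 * (real b * real d) / y ^ 3)"
  proof -
    have "real d * 1 \<le> real d * real b" using bd by (intro mult_left_mono) auto
    hence "640 * real d + 80 * (real b * real d) \<le> 720 * (real b * real d)" by (simp add: mult.commute)
    also have "\<dots> < y * 1" using y bd by simp
    also have "\<dots> \<le> y * y" using y by (intro mult_left_mono) auto
    finally have "(640 * real d + 80 * (real b * real d)) / y ^ 3 < y * y / y ^ 3"
      using y by (intro divide_strict_right_mono) auto
    also have "y * y / y ^ 3 = 1 / y" using y by (simp add: power3_eq_cube)
    finally show ?thesis by (simp add: add_divide_distrib)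
  qed
  have "1 + 16 * real k * A * (2 / 9) ^ k < p l1 ^ k + p l2 ^ k"
    using err final p1 p2 by linarith
  hence "E ^ k * (1 + 16 * real k * A * (2 / 9) ^ k) < E ^ k * (p l1 ^ k + p l2 ^ k)"
    using E by (intro mult_strict_left_mono) auto
  moreover have "(20 * real b / 9) ^ k = E ^ k * (2 / 9) ^ k"
    unfolding power_mult_distrib[symmetric] by (simp add: E_def)
  ultimately have "E ^ k + 16 * real k * A * (20 * real b / 9) ^ k
      < 1 / (1 / (10 * real b) + l1) ^ k + 1 / (1 / (10 * real b) + l2) ^ k"
    unfolding scale[OF l1(1)] scale[OF l2(1)] by (simp add: algebra_simps)
  thus ?thesis using that[OF k(1,2)] by (simp add: E_def A_def)
qed

section \<open>The recursive bound and the count of classes\<close>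

lemma card_le_1_if_unique:
  assumes "\<And>x y. x \<in> E \<Longrightarrow> y \<in> E \<Longrightarrow> x = y"
  shows "finite E \<and> card E \<le> 1"
proof (cases "E = {}")
  case False
  then obtain x where "x \<in> E" by blast
  hence "E = {x}" using assms by blast
  thus ?thesis by simp
qed simp

theorem theorem4p1:
  shows "\<exists>Q. recursive_function 5 Q \<and>
    (\<forall>m::nat. \<forall>\<delta>::real. m \<ge> 2 \<longrightarrow> 0 < \<delta> \<longrightarrow> \<delta> < 1/10 \<longrightarrow>
      (\<forall>\<nu>\<in>primitive_characters m. \<forall>z\<in>ball 1 \<delta>. dirichlet_L \<nu> z = 0 \<longrightarrow> z \<in> \<real>) \<longrightarrow>
      (\<forall>\<epsilon>::real. \<epsilon> > 0 \<longrightarrow>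
        (\<forall>a b c d :: nat. a > 0 \<longrightarrow> b > 0 \<longrightarrow> c > 0 \<longrightarrow> d > 0 \<longrightarrow>
           real a / real b \<le> \<delta> \<longrightarrow> real c / real d \<le> \<epsilon> \<longrightarrow>
           (let q\<^sub>0 = Q [m, a, b, c, d];
                E = {C \<in> primitive_characters m // conj_rel m. \<exists>chi\<in>C. modulus chi \<ge> q\<^sub>0 \<and>
                       (\<exists>\<beta>::real. 1 - ln (real (modulus chi)) powr (-\<epsilon>) \<le> \<beta> \<and> \<beta> < 1 \<and>
                          dirichlet_L chi (complex_of_real \<beta>) = 0)}
            in q\<^sub>0 > 0 \<and> finite E \<and> card E \<le> 1))))"
proof -
  obtain C where C: "C \<ge> 1"
    "\<And>d nu Q. primitive_character d nu \<Longrightarrow> d dvd Q \<Longrightarrow> Q > 0 \<Longrightarrow> regularized_L_bound C Q d nu"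
    by (rule regularized_L_bound_exists) (rule that; assumption)
  \<comment> \<open>A fixed numeral, chosen before all parameters; through it alone \<open>C\<close>
    enters the constant.\<close>
  define N where "N = nat \<lceil>ln C + 3\<rceil>"
  have lnC: "ln C \<ge> 0" "ln C + 3 \<le> real N" using C(1) unfolding N_def by (simp, linarith)
  \<comment> \<open>Positions 2 and 4 hold \<open>b\<close> and \<open>d\<close>. Since ln 3 \<ge>
    1, moduli beyond this value have logarithm at least (3000 N b d)^(4 d), the lower bound demanded
    by the numerical lemma.\<close>
  define Q where "Q = (\<lambda>xs::nat list. (3::nat) ^ ((3000 * N * xs ! 2 * xs ! 4) ^ (4 * xs ! 4)))"
  have "recursive_function 5 Q"
    unfolding Q_def by (intro recursive_power recursive_mult recursive_const recursive_function.proj) auto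
  moreover have "q\<^sub>0 > 0 \<and> finite E \<and> card E \<le> 1"
    if m: "m \<ge> 2" and \<delta>: "0 < \<delta>" "\<delta> < 1/10"
      and zeros: "\<forall>\<nu>\<in>primitive_characters m. \<forall>z\<in>ball 1 \<delta>. dirichlet_L \<nu> z = 0 \<longrightarrow> z \<in> \<real>"
      and pos: "a > 0" "b > 0" "c > 0" "d > 0"
      and rat: "real a / real b \<le> \<delta>" "real c / real d \<le> \<epsilon>"
      and q0: "q\<^sub>0 = Q [m, a, b, c, d]"
      and E: "E = {C \<in> primitive_characters m // conj_rel m. \<exists>chi\<in>C. modulus chi \<ge> q\<^sub>0 \<and>
                       (\<exists>\<beta>::real. 1 - ln (real (modulus chi)) powr (-\<epsilon>) \<le> \<beta> \<and> \<beta> < 1 \<and>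
                          dirichlet_L chi (complex_of_real \<beta>) = 0)}"
    for m a b c d q\<^sub>0 :: nat and \<delta> \<epsilon> :: real and E
  proof -
    define W where "W = real (3000 * N * b * d)"
    \<comment> \<open>As a, c \<ge> 1, one may lower \<delta> to 1/b and \<epsilon> to 1/d: the
      hypothesis on zeros passes to the smaller disk, and the interval for \<beta> only
      grows.\<close>
    define \<delta>' where "\<delta>' = 1 / real b"
    have \<delta>'_le: "\<delta>' \<le> \<delta>"
      using rat(1) pos by (intro order_trans[OF _ rat(1)]) (auto simp: \<delta>'_def intro: divide_right_mono)
    have \<delta>': "0 < \<delta>'" "\<delta>' \<le> 1/10" using \<delta>'_le \<delta> pos by (simp add: \<delta>'_def, linarith)
    have \<epsilon>: "1 / real d \<le> \<epsilon>"
      using pos by (intro order_trans[OF _ rat(2)]) (auto intro: divide_right_mono)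
    have W: "W \<ge> 3000 * real b" "W \<ge> 1"
    proof -
      have "real N * real d \<ge> 1 * 1" using lnC pos by (intro mult_mono) auto
      hence "3000 * real b * 1 \<le> 3000 * real b * (real N * real d)" by (intro mult_left_mono) auto
      thus "W \<ge> 3000 * real b" by (simp add: W_def mult_ac)
      thus "W \<ge> 1" using pos by simp
    qed
    define X where "X = W ^ (4 * d)"
    have X1: "X \<ge> 1" using W by (simp add: X_def)
    have lnq: "X \<le> ln (real q)" if "q \<ge> q\<^sub>0" for q :: nat
    proof -
      have e: "q\<^sub>0 = 3 ^ ((3000 * N * b * d) ^ (4 * d))" by (simp add: q0 Q_def)
      have "1 \<le> ln (3::real)" using exp_le by (simp add: ln_ge_iff)
      hence "X * 1 \<le> X * ln 3" using X1 by (intro mult_left_mono) auto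
      also have "X * ln 3 = ln (real q\<^sub>0)" by (simp add: e ln_realpow X_def W_def)
      also have "\<dots> \<le> ln (real q)"
      proof -
        have "real q\<^sub>0 > 0" unfolding e by simp
        thus ?thesis using that by (intro ln_mono) auto
      qed
      finally show ?thesis by simp
    qed
    have zeros': "z \<in> \<real>" if "\<nu> \<in> primitive_characters m" "z \<in> ball 1 \<delta>'" "dirichlet_L \<nu> z = 0" for \<nu> z
    proof -
      have "z \<in> ball 1 \<delta>" using that(2) \<delta>'_le by simp
      thus ?thesis using zeros that by blast
    qed
    \<comment> \<open>The numerical lemma treats the two zeros differently, so the characters are
      ordered by modulus first.\<close>
    have contra: False
      if chi: "chi1 \<in> primitive_characters m" "chi2 \<in> primitive_characters m" "chi2 \<notin> {chi1, cnj \<circ> chi1}"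
        and q: "modulus chi1 \<ge> q\<^sub>0" "modulus chi2 \<ge> q\<^sub>0" "modulus chi1 \<le> modulus chi2"
        and b1: "1 - ln (real (modulus chi1)) powr (-\<epsilon>) \<le> \<beta>1" "\<beta>1 < 1" "dirichlet_L chi1 (complex_of_real \<beta>1) = 0"
        and b2: "1 - ln (real (modulus chi2)) powr (-\<epsilon>) \<le> \<beta>2" "\<beta>2 < 1" "dirichlet_L chi2 (complex_of_real \<beta>2) = 0"
      for chi1 chi2 \<beta>1 \<beta>2
    proof -
      obtain q1 q2 where p: "primitive_character q1 chi1" "primitive_character q2 chi2"
        using chi by (auto simp: primitive_characters_def)
      note mod = modulus_eq[OF p(1)] modulus_eq[OF p(2)]
      have ln: "X \<le> ln (real q1)" "X \<le> ln (real q2)" using lnq q mod by auto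
      have q1: "q1 > 1" "q2 > 1" 
      proof -
        \<comment> \<open>ln 0 and ln 1 are both 0, whereas X \<ge> 1.\<close>
        have "q > 1" if "X \<le> ln (real q)" for q :: nat
          using that X1 by (cases "q \<le> 1") (auto simp: le_Suc_eq)
        thus "q1 > 1" "q2 > 1" using ln by auto
      qed
      have gap: "1 - \<beta> \<le> ln (real q) powr (- (1 / real d))" "1 - \<beta> < 4 * \<delta>' / 5"
        if "X \<le> ln (real q)" "1 - ln (real q) powr (-\<epsilon>) \<le> \<beta>" for q :: nat and \<beta> :: real
      proof -
        have "ln (real q) powr (-\<epsilon>) \<le> ln (real q) powr (- (1 / real d))"
          using that(1) X1 \<epsilon> by (intro powr_mono) auto
        thus 1: "1 - \<beta> \<le> ln (real q) powr (- (1 / real d))" using that(2) by linarith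
        also have "\<dots> \<le> 1 / W" using W pos that(1) by (intro powr_minus_inverse_le) (auto simp: X_def)
        also have "\<dots> \<le> 1 / (3000 * real b)" using W pos by (intro divide_left_mono) auto
        also have "\<dots> < 4 * \<delta>' / 5" using pos by (simp add: \<delta>'_def field_simps)
        finally show "1 - \<beta> < 4 * \<delta>' / 5" .
      qed
      note g1 = gap[OF ln(1) b1(1)[unfolded mod]] and g2 = gap[OF ln(2) b2(1)[unfolded mod]]
      obtain k :: nat where k: "even k" "k > 0"
        "(10 * real b) ^ k + 16 * real k * (ln C + 2 * (ln (real q1) + ln (real q2)) + 2 + 20 * real b) * (20 * real b / 9) ^ k
          < 1 / (1 / (10 * real b) + (1 - \<beta>1)) ^ k + 1 / (1 / (10 * real b) + (1 - \<beta>2)) ^ k"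
      proof (rule repulsion_numerics[OF pos(2,4) lnC])
        show "real (3000 * N * b * d) ^ (4 * d) \<le> ln (real q1)" using ln(1) by (simp only: X_def W_def)
        show "ln (real q1) \<le> ln (real q2)" using q(3) mod q1 by simp
        show "0 < 1 - \<beta>1" "0 < 1 - \<beta>2" using b1(2) b2(2) by auto
        show "1 - \<beta>1 \<le> ln (real q1) powr (- (1 / real d))" by (rule g1(1))
        show "1 - \<beta>2 \<le> ln (real q2) powr (- (1 / real d))" by (rule g2(1))
      qed (rule that; assumption)
      have "1 / (1 + \<delta>'/10 - \<beta>1) ^ k + 1 / (1 + \<delta>'/10 - \<beta>2) ^ k \<le>
        (10 / \<delta>') ^ k + 16 * real k * (ln C + 2 * ln (real (q1 * q2)) + 2 + 20 / \<delta>') * (20 / (9 * \<delta>')) ^ k"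
      proof (rule zero_repulsion[OF C(1) _ _ \<delta>' _ p chi(1,2) _ _ chi(3) b1(3,2) g1(2) b2(3,2) g2(2) k(1,2)])
        show "regularized_L_bound C Q d nu" if "primitive_character d nu" "d dvd Q" "Q > 0" for d nu Q
          using that by (rule C(2))
        show "m > 0" using m by simp
        show "z \<in> \<real>" if "\<nu> \<in> primitive_characters m" "z \<in> ball 1 \<delta>'" "dirichlet_L \<nu> z = 0" for \<nu> z
          using that by (rule zeros')
      qed (use q1 in auto)
      moreover have "1 + \<delta>'/10 - \<beta> = 1 / (10 * real b) + (1 - \<beta>)" for \<beta>
        by (simp add: \<delta>'_def)
      moreover have "10 / \<delta>' = 10 * real b" "20 / \<delta>' = 20 * real b" "20 / (9 * \<delta>') = 20 * real b / 9"
        by (simp_all add: \<delta>'_def)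
      moreover have "ln (real (q1 * q2)) = ln (real q1) + ln (real q2)"
        using q1 by (simp add: ln_mult)
      ultimately show False using k(3) by simp
    qed
    have "finite E \<and> card E \<le> 1"
    proof (rule card_le_1_if_unique, rule ccontr)
      fix C1 C2 assume *: "C1 \<in> E" "C2 \<in> E" "C1 \<noteq> C2"
      obtain chi1 \<beta>1 where 1: "C1 \<in> primitive_characters m // conj_rel m" "chi1 \<in> C1" "modulus chi1 \<ge> q\<^sub>0"
        "1 - ln (real (modulus chi1)) powr (-\<epsilon>) \<le> \<beta>1" "\<beta>1 < 1" "dirichlet_L chi1 (complex_of_real \<beta>1) = 0"
        using *(1) unfolding E by blast
      obtain chi2 \<beta>2 where 2: "C2 \<in> primitive_characters m // conj_rel m" "chi2 \<in> C2" "modulus chi2 \<ge> q\<^sub>0"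
        "1 - ln (real (modulus chi2)) powr (-\<epsilon>) \<le> \<beta>2" "\<beta>2 < 1" "dirichlet_L chi2 (complex_of_real \<beta>2) = 0"
        using *(2) unfolding E by blast
      have S: "chi1 \<in> primitive_characters m" "chi2 \<in> primitive_characters m"
        using in_quotient_imp_subset[OF equiv_conj_rel 1(1)] in_quotient_imp_subset[OF equiv_conj_rel 2(1)] 1(2) 2(2)
        by auto
      have "(chi1, chi2) \<notin> conj_rel m"
        using quotient_eqI[OF equiv_conj_rel 1(1) 2(1) 1(2) 2(2)] *(3) by blast
      hence ne: "chi2 \<notin> {chi1, cnj \<circ> chi1}" using S by (auto simp: conj_rel_def)
      have ne': "chi1 \<notin> {chi2, cnj \<circ> chi2}"
      proof
        assume "chi1 \<in> {chi2, cnj \<circ> chi2}"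
        hence "chi2 \<in> {chi1, cnj \<circ> chi1}" by (auto simp: fun_eq_iff)
        thus False using ne by simp
      qed
      show False
      proof (cases "modulus chi1 \<le> modulus chi2")
        case True
        show ?thesis by (rule contra[OF S ne 1(3) 2(3) True 1(4-6) 2(4-6)])
      next
        case False
        hence "modulus chi2 \<le> modulus chi1" by simp
        thus ?thesis by (rule contra[OF S(2,1) ne' 2(3) 1(3) _ 2(4-6) 1(4-6)])
      qed
    qed
    moreover have "q\<^sub>0 > 0" by (simp add: q0 Q_def)
    ultimately show ?thesis by simp
  qed
  ultimately show ?thesis
    unfolding Let_def by (intro exI[of _ Q] conjI allI impI) blast+
qed

end
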